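(* Let $\nu\ge 1$, let $V_0$ be a real-valued potential on $\mathbb{R}^\nu$ such that $H_0=-\Delta+V_0$ satisfies $\inf\operatorname{spec}(H_0)=0$ and $H_0$ has a regular ground state $u_0$, and let $\beta=\beta(V_0)=\left(\sup u_0/\inf u_0\right)^2$. Then for any $V\le 0$ on $\mathbb{R}^\nu$ and any $\gamma>0$, $$S_\gamma(0;\beta^{-1}V)\le S_\gamma(V_0;V)\le S_\gamma(0;\beta V).$$
   Context: $H_0$ has a regular ground state if there is a function $u_0$ on $\mathbb{R}^\nu$ with $(-\Delta+V_0)u_0=0$ (in the distributional sense) and $0<c_1\le u_0(x)\le c_2<\infty$ for all $x$, for some constants $c_1,c_2$; one takes $c_1=\inf u_0$, $c_2=\sup u_0$ and $\beta(V_0)=(c_2/c_1)^2$. Standing technical convention: $u_0$ is continuous, and $H_0=-\Delta+V_0$ is the nonnegative self-adjoint operator on $L^2(\mathbb{R}^\nu)$ given by the ground state representation: its form domain is $\{gu_0 : g\in L^2(\mathbb{R}^\nu,u_0^2\,dx),\ \nabla g\in L^2(\mathbb{R}^\nu,u_0^2\,dx)\}$ ($\nabla g$ the distributional gradient), with $\langle gu_0,H_0gu_0\rangle=\int|\nabla g|^2u_0^2\,d^\nu x$. (This holds, for instance, if the positive part of $V_0$ is in $L^1_{\rm loc}$, the negative part is in the Kato class $K_\nu$, and $H_0$ is the form closure of $-\Delta+V_0$ on $C_0^\infty$.) For measurable $V\le0$, the operators $H_0+V$ and $-\Delta+tV$ ($t>0$) are form sums; it is tacitly assumed that $V$ is such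 that the quadratic forms of the operators appearing are well defined on the form domain of $H_0$, respectively $-\Delta$, closed and bounded below. For $j=1,2,\dots$, with $H=-\Delta+V_0+V$ and $P_I(H)$ its spectral projections, $$E_j(V_0;V)=\min\bigl(0,\ \inf\{\lambda:\dim \operatorname{Ran} P_{(-\infty,\lambda]}(H)\ge j\}\bigr).$$ $E_j(0;W)$ denotes the same quantity for $-\Delta+W$. The moments are $$S_\gamma(V_0;V)=\sum_{j=1}^\infty|E_j(V_0;V)|^\gamma\in[0,\infty],$$ and $S_\gamma(0;W)$ is the same with $E_j(0;W)$. *)

theory Defs
  imports "HOL-Analysis.Analysis"
begin

section \<open>Complex inner product spaces\<close>

text \<open>The norm and topology are those of the underlying real inner product space, whose inner
  product is the real part of the complex one.  Inner products are conjugate linear in the first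
  argument.\<close>

class complex_inner = real_inner +
  fixes scaleC :: "complex \<Rightarrow> 'a \<Rightarrow> 'a"  (infixr "*\<^sub>C" 75)
    and cinner :: "'a \<Rightarrow> 'a \<Rightarrow> complex"
  assumes scaleC_add_right: "c *\<^sub>C (x + y) = c *\<^sub>C x + c *\<^sub>C y"
    and scaleC_add_left: "(c + d) *\<^sub>C x = c *\<^sub>C x + d *\<^sub>C x"
    and scaleC_scaleC: "c *\<^sub>C d *\<^sub>C x = (c * d) *\<^sub>C x"
    and scaleR_scaleC: "r *\<^sub>R x = complex_of_real r *\<^sub>C x"
    and cinner_commute: "cinner x y = cnj (cinner y x)"
    and cinner_add_right: "cinner x (y + z) = cinner x y + cinner x z"
    and cinner_scaleC_right: "cinner x (c *\<^sub>C y) = c * cinner x y"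
    and inner_eq_Re_cinner: "inner x y = Re (cinner x y)"

global_interpretation complex_vector: vector_space "scaleC :: complex \<Rightarrow> 'a \<Rightarrow> 'a::complex_inner"
  by unfold_locales
     (auto simp: scaleC_add_right scaleC_add_left scaleC_scaleC
        scaleR_scaleC[of 1, symmetric, simplified])

section \<open>Unbounded operators, forms, spectral projections\<close>

text \<open>An unbounded operator is given by its graph, a set of pairs \<open>(f, H f)\<close>.\<close>

definition form_operator :: "'a::complex_inner set \<Rightarrow> ('a \<Rightarrow> 'a \<Rightarrow> complex) \<Rightarrow> ('a \<times> 'a) set" where
  "form_operator D q = {(f, h). f \<in> D \<and> (\<forall>g\<in>D. q g f = cinner g h)}"

definition semibounded_form :: "'a::complex_inner set \<Rightarrow> ('a \<Rightarrow> 'a \<Rightarrow> complex) \<Rightarrow> bool" where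
  "semibounded_form D q \<longleftrightarrow> (\<exists>c. \<forall>f\<in>D. c * (norm f)\<^sup>2 \<le> Re (q f f))"

definition closed_form :: "'a::complex_inner set \<Rightarrow> ('a \<Rightarrow> 'a \<Rightarrow> complex) \<Rightarrow> bool" where
  "closed_form D q \<longleftrightarrow>
     (\<forall>X f. (\<forall>n. X n \<in> D) \<and> X \<longlonglongrightarrow> f \<and>
        (\<forall>e>0. \<exists>N. \<forall>m\<ge>N. \<forall>n\<ge>N. cmod (q (X m - X n) (X m - X n)) < e)
      \<longrightarrow> f \<in> D \<and> (\<lambda>n. q (X n - f) (X n - f)) \<longlonglongrightarrow> 0)"

text \<open>\<open>z\<close> is in the resolvent set iff \<open>H - z\<close> maps the domain of \<open>H\<close> bijectively onto the whole
  space, with bounded inverse \<open>R\<close>.\<close>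

definition resolvent_set :: "('a::complex_inner \<times> 'a) set \<Rightarrow> complex set" where
  "resolvent_set H =
     {z. \<exists>R. bounded_linear R \<and> (\<forall>f g. (f, g + z *\<^sub>C f) \<in> H \<longleftrightarrow> f = R g)}"

definition inf_spec :: "('a::complex_inner \<times> 'a) set \<Rightarrow> ereal" where
  "inf_spec H = (INF z\<in>- resolvent_set H. ereal (Re z))"

definition orth_projection :: "('a::complex_inner \<Rightarrow> 'a) \<Rightarrow> bool" where
  "orth_projection P \<longleftrightarrow>
     Vector_Spaces.linear scaleC scaleC P \<and>
     (\<forall>f. P (P f) = P f) \<and> (\<forall>f g. cinner (P f) g = cinner f (P g))"

definition spectral_family :: "(real \<Rightarrow> 'a::complex_inner \<Rightarrow> 'a) \<Rightarrow> bool" where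
  "spectral_family P \<longleftrightarrow>
     (\<forall>t. orth_projection (P t)) \<and>
     (\<forall>s t f. s \<le> t \<longrightarrow> P s (P t f) = P s f) \<and>
     (\<forall>t f. ((\<lambda>s. P s f) \<longlongrightarrow> P t f) (at_right t)) \<and>
     (\<forall>f. ((\<lambda>t. P t f) \<longlongrightarrow> 0) at_bot) \<and>
     (\<forall>f. ((\<lambda>t. P t f) \<longlongrightarrow> f) at_top)"

definition spectral_measure_at :: "(real \<Rightarrow> 'a::complex_inner \<Rightarrow> 'a) \<Rightarrow> 'a \<Rightarrow> real measure" where
  "spectral_measure_at P f = interval_measure (\<lambda>t. (norm (P t f))\<^sup>2)"

text \<open>\<open>H = \<integral> t dP(t)\<close>: a vector \<open>f\<close> is in the domain iff \<open>\<integral> t\<^sup>2 d\<parallel>P(t)f\<parallel>\<^sup>2 < \<infinity>\<close>, and then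
  \<open>\<langle>f, H f\<rangle> = \<integral> t d\<parallel>P(t)f\<parallel>\<^sup>2\<close>, which determines \<open>H f\<close> by polarization.\<close>

definition spectral_resolution ::
    "('a::complex_inner \<times> 'a) set \<Rightarrow> (real \<Rightarrow> 'a \<Rightarrow> 'a) \<Rightarrow> bool" where
  "spectral_resolution H P \<longleftrightarrow>
     spectral_family P \<and>
     Domain H = {f. integrable (spectral_measure_at P f) (\<lambda>t. t\<^sup>2)} \<and>
     (\<forall>(f, h)\<in>H. cinner f h = complex_of_real (\<integral>t. t \<partial>spectral_measure_at P f))"

text \<open>\<open>spectral_proj H t\<close> is the spectral projection of \<open>H\<close> for the interval \<open>(-\<infinity>, t]\<close>.  By the
  spectral theorem, a self-adjoint operator has exactly one spectral resolution.\<close>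

definition spectral_proj :: "('a::complex_inner \<times> 'a) set \<Rightarrow> real \<Rightarrow> 'a \<Rightarrow> 'a" where
  "spectral_proj H = (SOME P. spectral_resolution H P)"

definition dim_at_least :: "'a::complex_inner set \<Rightarrow> nat \<Rightarrow> bool" where
  "dim_at_least S j \<longleftrightarrow>
     (\<exists>B\<subseteq>S. finite B \<and> card B = j \<and> complex_vector.independent B)"

text \<open>The infimum is taken in the extended reals, so that it is \<open>\<infinity>\<close> over the empty set; for \<open>H\<close>
  bounded below and \<open>j > 0\<close> the minimum is finite.\<close>

definition eigenvalue :: "('a::complex_inner \<times> 'a) set \<Rightarrow> nat \<Rightarrow> real" where
  "eigenvalue H j =
     real_of_ereal (min 0 (INF t\<in>{t. dim_at_least (range (spectral_proj H t)) j}. ereal t))"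

definition moment :: "real \<Rightarrow> ('a::complex_inner \<times> 'a) set \<Rightarrow> ennreal" where
  "moment \<gamma> H = (\<Sum>j. ennreal (\<bar>eigenvalue H (Suc j)\<bar> powr \<gamma>))"

section \<open>The Hilbert space of square integrable functions\<close>

definition square_integrable :: "(real ^ 'n::finite \<Rightarrow> complex) \<Rightarrow> bool" where
  "square_integrable f \<longleftrightarrow>
     f \<in> borel_measurable lebesgue \<and> integrable lebesgue (\<lambda>x. (cmod (f x))\<^sup>2)"

definition L2_rel :: "(real ^ 'n::finite \<Rightarrow> complex) \<Rightarrow> (real ^ 'n \<Rightarrow> complex) \<Rightarrow> bool" where
  "L2_rel f g \<longleftrightarrow> square_integrable f \<and> square_integrable g \<and> (AE x in lebesgue. f x = g x)"

lemma square_integrable_0: "square_integrable (\<lambda>x. 0)"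
  by (simp add: square_integrable_def)

lemma square_integrable_prod:
  assumes "square_integrable f" "square_integrable g"
  shows "integrable lebesgue (\<lambda>x. cnj (f x) * g x)"
proof (rule Bochner_Integration.integrable_bound)
  show "integrable lebesgue (\<lambda>x. (cmod (f x))\<^sup>2 + (cmod (g x))\<^sup>2)"
    using assms by (auto simp: square_integrable_def)
  have "f \<in> borel_measurable lebesgue" "g \<in> borel_measurable lebesgue"
    using assms by (auto simp: square_integrable_def)
  moreover have "(\<lambda>x. cnj (f x)) \<in> borel_measurable lebesgue"
    using borel_measurable_continuous_on[OF _ \<open>f \<in> _\<close>, of cnj]
    by (simp add: continuous_on_cnj)
  ultimately show "(\<lambda>x. cnj (f x) * g x) \<in> borel_measurable lebesgue"
    by (intro borel_measurable_times)
  have "a * b \<le> a\<^sup>2 + b\<^sup>2" if "0 \<le> a" "0 \<le> b" for a b :: real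
    using sum_squares_bound[of a b] mult_nonneg_nonneg[OF that] by linarith
  then show "AE x in lebesgue. norm (cnj (f x) * g x)
      \<le> norm ((cmod (f x))\<^sup>2 + (cmod (g x))\<^sup>2)"
    by (auto simp: norm_mult)
qed

lemma square_integrable_add:
  assumes "square_integrable f" "square_integrable g"
  shows "square_integrable (\<lambda>x. f x + g x)"
  unfolding square_integrable_def
proof
  show m: "(\<lambda>x. f x + g x) \<in> borel_measurable lebesgue"
    using assms by (auto simp: square_integrable_def)
  show "integrable lebesgue (\<lambda>x. (cmod (f x + g x))\<^sup>2)"
  proof (rule Bochner_Integration.integrable_bound)
    show "integrable lebesgue (\<lambda>x. 2 * (cmod (f x))\<^sup>2 + 2 * (cmod (g x))\<^sup>2)"
      using assms by (auto simp: square_integrable_def)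
    show "(\<lambda>x. (cmod (f x + g x))\<^sup>2) \<in> borel_measurable lebesgue"
      using m by measurable
    have "(cmod (a + b))\<^sup>2 \<le> 2 * (cmod a)\<^sup>2 + 2 * (cmod b)\<^sup>2" for a b
    proof -
      have "(cmod (a + b))\<^sup>2 \<le> (cmod a + cmod b)\<^sup>2"
        by (intro power_mono norm_triangle_ineq) auto
      also have "\<dots> \<le> 2 * (cmod a)\<^sup>2 + 2 * (cmod b)\<^sup>2"
        using sum_squares_bound[of "cmod a" "cmod b"] by (simp add: power2_sum)
      finally show ?thesis .
    qed
    then show "AE x in lebesgue. norm ((cmod (f x + g x))\<^sup>2)
        \<le> norm (2 * (cmod (f x))\<^sup>2 + 2 * (cmod (g x))\<^sup>2)"
      by auto
  qed
qed

lemma square_integrable_scale: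
  assumes "square_integrable f"
  shows "square_integrable (\<lambda>x. c * f x)"
  using assms by (auto simp: square_integrable_def norm_mult power_mult_distrib)

quotient_type (overloaded) 'n L2 = "real ^ 'n::finite \<Rightarrow> complex" / partial: L2_rel
proof (rule part_equivpI)
  show "\<exists>f. L2_rel f f"
    using square_integrable_0 by (auto simp: L2_rel_def)
  show "symp L2_rel"
    by (auto simp: symp_def L2_rel_def)
  show "transp L2_rel"
    by (auto simp: transp_def L2_rel_def)
qed

instantiation L2 :: (finite) complex_inner
begin

lift_definition zero_L2 :: "'a L2" is "\<lambda>x. 0"
  by (simp add: L2_rel_def square_integrable_0)

lift_definition plus_L2 :: "'a L2 \<Rightarrow> 'a L2 \<Rightarrow> 'a L2" is "\<lambda>f g x. f x + g x"
  by (auto simp: L2_rel_def square_integrable_add)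

lift_definition scaleC_L2 :: "complex \<Rightarrow> 'a L2 \<Rightarrow> 'a L2" is "\<lambda>c f x. c * f x"
  by (auto simp: L2_rel_def square_integrable_scale)

lift_definition cinner_L2 :: "'a L2 \<Rightarrow> 'a L2 \<Rightarrow> complex" is
  "\<lambda>f g. \<integral>x. cnj (f x) * g x \<partial>lebesgue"
proof -
  fix f f' g g' :: "real ^ 'a \<Rightarrow> complex"
  assume *: "L2_rel f f'" "L2_rel g g'"
  then have "AE x in lebesgue. cnj (f x) * g x = cnj (f' x) * g' x"
    unfolding L2_rel_def by auto
  moreover have "(\<lambda>x. cnj (f x) * g x) \<in> borel_measurable lebesgue"
    "(\<lambda>x. cnj (f' x) * g' x) \<in> borel_measurable lebesgue"
    using * by (auto simp: L2_rel_def intro!: borel_measurable_integrable square_integrable_prod)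
  ultimately show "(\<integral>x. cnj (f x) * g x \<partial>lebesgue) = (\<integral>x. cnj (f' x) * g' x \<partial>lebesgue)"
    by (intro integral_cong_AE)
qed

definition uminus_L2 :: "'a L2 \<Rightarrow> 'a L2" where "- F = (- 1) *\<^sub>C F" for F :: "'a L2"
definition minus_L2 :: "'a L2 \<Rightarrow> 'a L2 \<Rightarrow> 'a L2" where "F - G = F + (- G)" for F G :: "'a L2"
definition scaleR_L2 :: "real \<Rightarrow> 'a L2 \<Rightarrow> 'a L2" where
  "r *\<^sub>R F = complex_of_real r *\<^sub>C F" for F :: "'a L2"
definition inner_L2 :: "'a L2 \<Rightarrow> 'a L2 \<Rightarrow> real" where
  "inner F G = Re (cinner F G)" for F G :: "'a L2"
definition norm_L2 :: "'a L2 \<Rightarrow> real" where "norm F = sqrt (inner F F)" for F :: "'a L2"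
definition dist_L2 :: "'a L2 \<Rightarrow> 'a L2 \<Rightarrow> real" where
  "dist F G = norm (F - G)" for F G :: "'a L2"
definition sgn_L2 :: "'a L2 \<Rightarrow> 'a L2" where
  "sgn F = inverse (norm F) *\<^sub>R F" for F :: "'a L2"
definition uniformity_L2 :: "('a L2 \<times> 'a L2) filter" where
  "uniformity = (INF e\<in>{0<..}. principal {(F :: 'a L2, G). dist F G < e})"
definition open_L2 :: "'a L2 set \<Rightarrow> bool" where
  "open U \<longleftrightarrow> (\<forall>F\<in>U. \<forall>\<^sub>F (F', G) in uniformity. F' = F \<longrightarrow> G \<in> U)" for U :: "'a L2 set"

instance
proof
  fix F G K :: "'a L2" and c d :: complex and r s :: real
  show "F + G + K = F + (G + K)"
    by transfer (auto simp: L2_rel_def square_integrable_add algebra_simps)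
  show "F + G = G + F"
    by transfer (auto simp: L2_rel_def square_integrable_add algebra_simps)
  show "0 + F = F"
    by transfer (auto simp: L2_rel_def)
  show "- F + F = 0"
    unfolding uminus_L2_def
    by transfer (auto simp: L2_rel_def square_integrable_0 square_integrable_add
        square_integrable_scale intro: square_integrable_add[OF square_integrable_scale, of _ _ "-1"])
  show "F - G = F + - G"
    by (rule minus_L2_def)
  have addr: "c *\<^sub>C (F + G) = c *\<^sub>C F + c *\<^sub>C G" for c and F G :: "'a L2"
    by transfer (auto simp: L2_rel_def square_integrable_add square_integrable_scale algebra_simps)
  show "c *\<^sub>C (F + G) = c *\<^sub>C F + c *\<^sub>C G"
    by (rule addr)
  have addl: "(c + d) *\<^sub>C F = c *\<^sub>C F + d *\<^sub>C F" for c d and F :: "'a L2"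
    by transfer (auto simp: L2_rel_def square_integrable_add square_integrable_scale algebra_simps
        intro: square_integrable_add[OF square_integrable_scale square_integrable_scale])
  show "(c + d) *\<^sub>C F = c *\<^sub>C F + d *\<^sub>C F"
    by (rule addl)
  have mul: "c *\<^sub>C d *\<^sub>C F = (c * d) *\<^sub>C F" for c d and F :: "'a L2"
    by transfer (auto simp: L2_rel_def square_integrable_scale algebra_simps
        intro: square_integrable_scale[OF square_integrable_scale])
  show "c *\<^sub>C d *\<^sub>C F = (c * d) *\<^sub>C F"
    by (rule mul)
  have one: "1 *\<^sub>C F = F" for F :: "'a L2"
    by transfer (auto simp: L2_rel_def)
  show "r *\<^sub>R (F + G) = r *\<^sub>R F + r *\<^sub>R G" "(r + s) *\<^sub>R F = r *\<^sub>R F + s *\<^sub>R F"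
    "r *\<^sub>R s *\<^sub>R F = (r * s) *\<^sub>R F" "1 *\<^sub>R F = F" "r *\<^sub>R F = complex_of_real r *\<^sub>C F"
    by (simp_all add: scaleR_L2_def addr addl mul one)
  have comm: "cinner F G = cnj (cinner G F)" for F G :: "'a L2"
  proof transfer
    fix f g :: "real ^ 'a \<Rightarrow> complex"
    show "(\<integral>x. cnj (f x) * g x \<partial>lebesgue) = cnj (\<integral>x. cnj (g x) * f x \<partial>lebesgue)"
      by (simp add: Bochner_Integration.integral_cnj[symmetric] mult.commute)
  qed
  show "cinner F G = cnj (cinner G F)"
    by (rule comm)
  have cadd: "cinner F (G + K) = cinner F G + cinner F K" for F G K :: "'a L2"
    by transfer (auto simp: L2_rel_def square_integrable_prod distrib_left)
  show "cinner F (G + K) = cinner F G + cinner F K"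
    by (rule cadd)
  have cscale: "cinner F (c *\<^sub>C G) = c * cinner F G" for c and F G :: "'a L2"
  proof transfer
    fix c and f g :: "real ^ 'a \<Rightarrow> complex"
    have "(\<lambda>x. cnj (f x) * (c * g x)) = (\<lambda>x. c * (cnj (f x) * g x))"
      by (simp add: algebra_simps)
    then show "(\<integral>x. cnj (f x) * (c * g x) \<partial>lebesgue) = c * (\<integral>x. cnj (f x) * g x \<partial>lebesgue)"
      by (simp only: integral_mult_right_zero)
  qed
  show "cinner F (c *\<^sub>C G) = c * cinner F G"
    by (rule cscale)
  show "inner F G = Re (cinner F G)"
    by (rule inner_L2_def)
  show ic: "inner F G = inner G F"
    unfolding inner_L2_def using comm[of F G] by simp
  have ic': "inner F G = inner G F" for F G :: "'a L2"
    unfolding inner_L2_def using comm[of F G] by simp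
  show "inner (F + G) K = inner F K + inner G K"
    unfolding ic'[of _ K] by (simp add: inner_L2_def cadd)
  show "inner (r *\<^sub>R F) G = r * inner F G"
    unfolding ic'[of _ G] by (simp add: inner_L2_def scaleR_L2_def cscale)
  have sq: "(\<lambda>x. cnj (f x) * f x) = (\<lambda>x. complex_of_real ((cmod (f x))\<^sup>2))"
    for f :: "real ^ 'a \<Rightarrow> complex"
    by (simp add: complex_norm_square mult.commute del: of_real_power)
  show "0 \<le> inner F F"
    unfolding inner_L2_def by transfer (simp add: sq del: of_real_power)
  show "inner F F = 0 \<longleftrightarrow> F = 0"
    unfolding inner_L2_def
  proof transfer
    fix f :: "real ^ 'a \<Rightarrow> complex"
    assume f: "L2_rel f f"
    then have "(\<integral>x. (cmod (f x))\<^sup>2 \<partial>lebesgue) = 0 \<longleftrightarrow> (AE x in lebesgue. (cmod (f x))\<^sup>2 = 0)"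
      by (intro integral_nonneg_eq_0_iff_AE) (auto simp: L2_rel_def square_integrable_def)
    with f show "(Re (\<integral>x. cnj (f x) * f x \<partial>lebesgue) = 0) = L2_rel f (\<lambda>x. 0)"
      by (simp add: sq L2_rel_def square_integrable_0 del: of_real_power)
  qed
  show "norm F = sqrt (inner F F)"
    by (rule norm_L2_def)
  show "dist F G = norm (F - G)"
    by (rule dist_L2_def)
  show "sgn F = inverse (norm F) *\<^sub>R F"
    by (rule sgn_L2_def)
  show "uniformity = (INF e\<in>{0<..}. principal {(F :: 'a L2, G). dist F G < e})"
    by (rule uniformity_L2_def)
  show "open U \<longleftrightarrow> (\<forall>F\<in>U. \<forall>\<^sub>F (F', G) in uniformity. F' = F \<longrightarrow> G \<in> U)" for U :: "'a L2 set"
    by (rule open_L2_def)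
qed

end

section \<open>Test functions and distributional derivatives\<close>

definition partial :: "'n \<Rightarrow> (real ^ 'n::finite \<Rightarrow> real) \<Rightarrow> real ^ 'n \<Rightarrow> real" where
  "partial i \<phi> x = frechet_derivative \<phi> (at x) (axis i 1)"

text \<open>Smoothness: all iterated partial derivatives exist and are (totally) differentiable.\<close>

definition test_function :: "(real ^ 'n::finite \<Rightarrow> real) \<Rightarrow> bool" where
  "test_function \<phi> \<longleftrightarrow>
     (\<forall>is. \<forall>x. foldr partial is \<phi> differentiable (at x)) \<and> compact (closure {x. \<phi> x \<noteq> 0})"

definition laplacian :: "(real ^ 'n::finite \<Rightarrow> real) \<Rightarrow> real ^ 'n \<Rightarrow> real" where
  "laplacian \<phi> x = (\<Sum>i\<in>UNIV. partial i (partial i \<phi>) x)"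

definition locally_integrable ::
    "(real ^ 'n::finite \<Rightarrow> 'b::{banach, second_countable_topology}) \<Rightarrow> bool" where
  "locally_integrable f \<longleftrightarrow> (\<forall>K. compact K \<longrightarrow> set_integrable lebesgue K f)"

definition has_weak_gradient ::
    "(real ^ 'n::finite \<Rightarrow> complex) \<Rightarrow> (real ^ 'n \<Rightarrow> complex ^ 'n) \<Rightarrow> bool" where
  "has_weak_gradient g G \<longleftrightarrow>
     locally_integrable g \<and> locally_integrable G \<and>
     (\<forall>\<phi> i. test_function \<phi> \<longrightarrow>
        (\<integral>x. partial i \<phi> x *\<^sub>R g x \<partial>lebesgue) = - (\<integral>x. \<phi> x *\<^sub>R (G x $ i) \<partial>lebesgue))"

text \<open>A weak gradient is unique up to null sets, so integrals involving it do not depend on the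
  choice.\<close>

definition weak_gradient :: "(real ^ 'n::finite \<Rightarrow> complex) \<Rightarrow> real ^ 'n \<Rightarrow> complex ^ 'n" where
  "weak_gradient g = (SOME G. has_weak_gradient g G)"

section \<open>Schroedinger operators in the ground state representation\<close>

text \<open>\<open>(-\<Delta> + V0) u0 = 0\<close> in the sense of distributions; for this \<open>V0 u0\<close> has to be locally
  integrable.\<close>

definition regular_ground_state ::
    "(real ^ 'n::finite \<Rightarrow> real) \<Rightarrow> (real ^ 'n \<Rightarrow> real) \<Rightarrow> bool" where
  "regular_ground_state V0 u0 \<longleftrightarrow>
     continuous_on UNIV u0 \<and>
     locally_integrable (\<lambda>x. V0 x * u0 x) \<and>
     (\<forall>\<phi>. test_function \<phi> \<longrightarrow>
        (\<integral>x. u0 x * (- laplacian \<phi> x) \<partial>lebesgue) + (\<integral>x. V0 x * u0 x * \<phi> x \<partial>lebesgue) = 0) \<and>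
     (\<exists>c1 c2. 0 < c1 \<and> (\<forall>x. c1 \<le> u0 x \<and> u0 x \<le> c2))"

definition ground_state_ratio :: "(real ^ 'n::finite \<Rightarrow> real) \<Rightarrow> real" where
  "ground_state_ratio u0 = ((SUP x. u0 x) / (INF x. u0 x))\<^sup>2"

text \<open>Since \<open>u0 > 0\<close>, an element \<open>f\<close> of the Hilbert space is \<open>f = g u0\<close> with \<open>g = f / u0\<close>, and
  \<open>f\<close> is square integrable iff \<open>g\<close> is so with respect to \<open>u0\<^sup>2 dx\<close>.  For \<open>u0 = 1\<close> the form below is
  that of \<open>-\<Delta>\<close> on its form domain \<open>H\<^sup>1\<close>.\<close>

definition gs_quotient :: "(real ^ 'n::finite \<Rightarrow> real) \<Rightarrow> 'n L2 \<Rightarrow> real ^ 'n \<Rightarrow> complex" where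
  "gs_quotient u0 F x = rep_L2 F x / complex_of_real (u0 x)"

definition gs_domain :: "(real ^ 'n::finite \<Rightarrow> real) \<Rightarrow> 'n L2 set" where
  "gs_domain u0 =
     {F. \<exists>G. has_weak_gradient (gs_quotient u0 F) G \<and>
             integrable lebesgue (\<lambda>x. (norm (G x))\<^sup>2 * (u0 x)\<^sup>2)}"

definition gs_form :: "(real ^ 'n::finite \<Rightarrow> real) \<Rightarrow> 'n L2 \<Rightarrow> 'n L2 \<Rightarrow> complex" where
  "gs_form u0 F1 F2 =
     (\<integral>x. (\<Sum>i\<in>UNIV. cnj (weak_gradient (gs_quotient u0 F1) x $ i) *
                         weak_gradient (gs_quotient u0 F2) x $ i) *
           complex_of_real ((u0 x)\<^sup>2) \<partial>lebesgue)"

definition potential_form :: "(real ^ 'n::finite \<Rightarrow> real) \<Rightarrow> 'n L2 \<Rightarrow> 'n L2 \<Rightarrow> complex" where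
  "potential_form V F1 F2 =
     (\<integral>x. complex_of_real (V x) * (cnj (rep_L2 F1 x) * rep_L2 F2 x) \<partial>lebesgue)"

definition schroedinger_form ::
    "(real ^ 'n::finite \<Rightarrow> real) \<Rightarrow> (real ^ 'n \<Rightarrow> real) \<Rightarrow> 'n L2 \<Rightarrow> 'n L2 \<Rightarrow> complex" where
  "schroedinger_form u0 V F1 F2 = gs_form u0 F1 F2 + potential_form V F1 F2"

text \<open>The form sum \<open>H0 + V\<close>, where \<open>H0\<close> is the operator whose ground state representation is given
  by \<open>u0\<close>.  Thus \<open>H0\<close> itself is the case \<open>V = 0\<close>, and \<open>-\<Delta> + W\<close> is the case \<open>u0 = 1\<close>, \<open>V = W\<close>.\<close>

definition schroedinger ::
    "(real ^ 'n::finite \<Rightarrow> real) \<Rightarrow> (real ^ 'n \<Rightarrow> real) \<Rightarrow> ('n L2 \<times> 'n L2) set" where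
  "schroedinger u0 V = form_operator (gs_domain u0) (schroedinger_form u0 V)"

text \<open>The convention under which \<open>H0 + V\<close> is defined as a form sum: the form is well defined on the
  form domain of \<open>H0\<close>, bounded below and closed.\<close>

definition form_admissible ::
    "(real ^ 'n::finite \<Rightarrow> real) \<Rightarrow> (real ^ 'n \<Rightarrow> real) \<Rightarrow> bool" where
  "form_admissible u0 V \<longleftrightarrow>
     (\<forall>F\<in>gs_domain u0. integrable lebesgue (\<lambda>x. V x * (cmod (rep_L2 F x))\<^sup>2)) \<and>
     semibounded_form (gs_domain u0) (schroedinger_form u0 V) \<and>
     closed_form (gs_domain u0) (schroedinger_form u0 V)"

end

theory Submission
  imports Defs
begin

text \<open>For a closed semibounded form \<open>q\<close> the dimension of the spectral subspace for \<open>(-\<infinity>, t]\<close>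
  is controlled by the largest dimension of a subspace on which \<open>q f f \<le> t \<parallel>f\<parallel>\<^sup>2\<close> (Glazman's
  lemma).  Writing \<open>f = g u0\<close>, the form of \<open>H0 + V\<close> is \<open>\<integral> \<bar>\<nabla>g\<bar>\<^sup>2 u0\<^sup>2 + \<integral> V \<bar>g\<bar>\<^sup>2 u0\<^sup>2\<close>
  and the squared norm is \<open>\<integral> \<bar>g\<bar>\<^sup>2 u0\<^sup>2\<close>; bounding \<open>u0\<^sup>2\<close> by its extrema compares these with
  the corresponding terms for \<open>-\<Delta>\<close>, at the cost of the factor \<open>\<beta>\<close> in front of \<open>V\<close>.

  Since eigenvalues are defined by spectral projections, the spectral theorem for form operators
  is needed.  The resolvent \<open>R = (H + c)\<^sup>-\<^sup>1\<close> is found by minimization in the form domain, and the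
  spectral projection of \<open>H\<close> for \<open>(-\<infinity>, t]\<close> is the projection onto the kernel of the positive part
  of \<open>1 - (t + c) R\<close>, where \<open>\<bar>T\<bar>\<close> is the square root of \<open>T\<^sup>2\<close>.\<close>

section \<open>Symmetric forms and operators on real Hilbert spaces\<close>

text \<open>\<open>spectral_proj\<close> is a choice, so a resolution has to be exhibited before
  anything is known about it; from then on only the properties in \<open>spectral_resolution\<close>
  are available. They give the domain of H and the diagonal values of its form, but do not say that
  H commutes with the projections. The orthogonality of different spectral pieces with respect to
  the form is recovered by polarization: the diagonal integral is additive on sums of vectors with
  disjoint spectral windows. The operator theory takes place in real Hilbert spaces, with the real
  part as inner product. Complex linearity returns because each projection commutes with every
  bounded operator that commutes, together with its adjoint, with R; multiplication by a complex
  scalar is one of these. In the comparison g is kept and only the weight changes. The gradient term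
  and, because t < 0, the norm term call for one extremum of u0^2, the potential term, because V
  \<le> 0, for the other; the quotient of the two extrema is \<beta>.\<close>

lemma nonneg_quadratic_discriminant:
  fixes a b c :: real
  assumes "0 \<le> a" and *: "\<And>r. 0 \<le> a * r\<^sup>2 + 2 * b * r + c"
  shows "b\<^sup>2 \<le> a * c"
proof (cases "a = 0")
  case True
  have "b = 0"
  proof (rule ccontr)
    assume "b \<noteq> 0"
    \<comment> \<open>At this r the function 2 b r + c takes the value -1.\<close>
    then show False
      using *[of "- (c + 1) / (2 * b)"] True by (simp add: field_simps)
  qed
  then show ?thesis using True by simp
next
  case False
  then have "a > 0" using assms(1) by simp
  then show ?thesis
    using *[of "- b / a"] by (simp add: field_simps power2_eq_square)
qed

text \<open>The form lives on a subspace D, because it has to serve for the shifted form on its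
  domain, for the inner product on a closed subspace and for x \<bullet> R y on a spectral
  subspace.\<close>

locale psd_form =
  fixes D :: "'a::real_inner set" and B :: "'a \<Rightarrow> 'a \<Rightarrow> real"
  assumes subspace: "subspace D"
    and add_right: "\<And>x y z. x \<in> D \<Longrightarrow> y \<in> D \<Longrightarrow> z \<in> D \<Longrightarrow> B x (y + z) = B x y + B x z"
    and scale_right: "\<And>r x y. x \<in> D \<Longrightarrow> y \<in> D \<Longrightarrow> B x (r *\<^sub>R y) = r * B x y"
    and sym: "\<And>x y. x \<in> D \<Longrightarrow> y \<in> D \<Longrightarrow> B x y = B y x"
    and nonneg: "\<And>x. x \<in> D \<Longrightarrow> 0 \<le> B x x"
begin

lemmas mem = subspace_add[OF subspace] subspace_scale[OF subspace] subspace_diff[OF subspace]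

lemma add_left: "x \<in> D \<Longrightarrow> y \<in> D \<Longrightarrow> z \<in> D \<Longrightarrow> B (x + y) z = B x z + B y z"
  by (metis add_right sym mem(1))

lemma scale_left: "x \<in> D \<Longrightarrow> y \<in> D \<Longrightarrow> B (r *\<^sub>R x) y = r * B x y"
  by (metis scale_right sym mem(2))

lemma diff_right: "x \<in> D \<Longrightarrow> y \<in> D \<Longrightarrow> z \<in> D \<Longrightarrow> B x (y - z) = B x y - B x z"
  using add_right[of x y "(- 1) *\<^sub>R z"] scale_right[of x z "- 1"] mem(2)[of z "- 1"] by simp

lemma diff_left: "x \<in> D \<Longrightarrow> y \<in> D \<Longrightarrow> z \<in> D \<Longrightarrow> B (x - y) z = B x z - B y z"
  by (metis diff_right sym mem(3))

lemma cauchy_schwarz: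
  assumes x: "x \<in> D" and y: "y \<in> D"
  shows "(B x y)\<^sup>2 \<le> B x x * B y y"
proof (rule nonneg_quadratic_discriminant[OF nonneg[OF x]])
  fix r
  have "0 \<le> B (r *\<^sub>R x + y) (r *\<^sub>R x + y)"
    using x y by (intro nonneg mem)
  also have "\<dots> = B x x * r\<^sup>2 + 2 * B x y * r + B y y"
    using x y by (simp add: add_right add_left scale_left scale_right mem sym[of y x]
        power2_eq_square algebra_simps)
  finally show "0 \<le> B x x * r\<^sup>2 + 2 * B x y * r + B y y" .
qed

text \<open>The minimizer of \<open>B x x - 2 (x \<bullet> g)\<close> over \<open>D\<close>; a minimizing sequence is Cauchy by the
  parallelogram law.\<close>

lemma riesz_representation:
  fixes g :: 'a
  assumes complete: "complete (UNIV :: 'a set)"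
    and \<delta>: "\<delta> > 0" and coercive: "\<And>x. x \<in> D \<Longrightarrow> \<delta> * (norm x)\<^sup>2 \<le> B x x"
    and closed: "\<And>X f. (\<And>n. X n \<in> D) \<Longrightarrow> X \<longlonglongrightarrow> f \<Longrightarrow>
       (\<And>e. e > 0 \<Longrightarrow> \<exists>N. \<forall>m\<ge>N. \<forall>n\<ge>N. B (X m - X n) (X m - X n) < e) \<Longrightarrow>
       f \<in> D \<and> (\<lambda>n. B (X n - f) (X n - f)) \<longlonglongrightarrow> 0"
  shows "\<exists>f\<in>D. \<forall>k\<in>D. B k f = k \<bullet> g"
proof -
  define J where "J x = B x x - 2 * (x \<bullet> g)" for x
  define m where "m = Inf (J ` D)"
  have D0: "0 \<in> D" by (rule subspace_0[OF subspace])
  have bdd: "bdd_below (J ` D)"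
  proof (rule bdd_belowI2)
    fix x assume x: "x \<in> D"
    have "x \<bullet> g \<le> norm x * norm g" by (rule norm_cauchy_schwarz)
    \<comment> \<open>Completing the square bounds J below by -|g|^2 / \<delta>.\<close>
    moreover have "0 \<le> (\<delta> * norm x - norm g)\<^sup>2 / \<delta>" using \<delta> by simp
    then have "2 * (norm x * norm g) \<le> \<delta> * (norm x)\<^sup>2 + (norm g)\<^sup>2 / \<delta>"
      using \<delta> by (simp add: field_simps power2_eq_square)
    ultimately show "- ((norm g)\<^sup>2 / \<delta>) \<le> J x"
      using coercive[OF x] by (simp add: J_def)
  qed
  have m_le: "m \<le> J x" if "x \<in> D" for x
    unfolding m_def using that bdd by (intro cInf_lower) auto
  have "\<exists>x\<in>D. J x < m + inverse (real (Suc n))" for n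
  proof -
    have "Inf (J ` D) < m + inverse (real (Suc n))" by (simp add: m_def)
    then show ?thesis
      using cInf_less_iff[of "J ` D"] bdd D0 by (metis (no_types, lifting) empty_iff image_iff)
  qed
  then obtain X where XD: "\<And>n. X n \<in> D" and XJ: "\<And>n. J (X n) < m + inverse (real (Suc n))"
    by metis
  have para: "B (x - y) (x - y) \<le> 2 * (J x - m) + 2 * (J y - m)" if "x \<in> D" "y \<in> D" for x y
  proof -
    have "B (x - y) (x - y) = 2 * J x + 2 * J y - 4 * J ((1/2) *\<^sub>R (x + y))"
      using that unfolding J_def
      by (simp add: diff_right diff_left scale_left scale_right add_left add_right mem
          inner_add_left sym[of y x]) argo
    moreover have "m \<le> J ((1/2) *\<^sub>R (x + y))" using that by (intro m_le mem)
    ultimately show ?thesis by simp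
  qed
  have cauchyB: "\<exists>N. \<forall>m\<ge>N. \<forall>n\<ge>N. B (X m - X n) (X m - X n) < e" if e: "e > 0" for e
  proof -
    obtain N where N: "inverse (real (Suc N)) < e / 4"
      using reals_Archimedean[of "e / 4"] e by auto
    have "B (X i - X j) (X i - X j) < e" if "i \<ge> N" "j \<ge> N" for i j
    proof -
      have "inverse (real (Suc i)) \<le> inverse (real (Suc N))"
        "inverse (real (Suc j)) \<le> inverse (real (Suc N))"
        using that by (auto intro!: le_imp_inverse_le)
      then have "J (X i) - m < e / 4" "J (X j) - m < e / 4"
        using XJ[of i] XJ[of j] N by linarith+
      then show ?thesis
        using para[OF XD XD, of i j] by argo
    qed
    then show ?thesis by blast
  qed
  have "Cauchy X"
  proof (rule metric_CauchyI)
    fix e :: real assume e: "e > 0"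
    then obtain N where N: "\<forall>m\<ge>N. \<forall>n\<ge>N. B (X m - X n) (X m - X n) < \<delta> * e\<^sup>2"
      using cauchyB[of "\<delta> * e\<^sup>2"] \<delta> by auto
    have "dist (X i) (X j) < e" if "i \<ge> N" "j \<ge> N" for i j
    proof -
      have "\<delta> * (norm (X i - X j))\<^sup>2 < \<delta> * e\<^sup>2"
        using coercive[of "X i - X j"] N that XD mem by fastforce
      then have "(norm (X i - X j))\<^sup>2 < e\<^sup>2" using \<delta> by simp
      then show ?thesis using e by (simp add: dist_norm power_less_imp_less_base)
    qed
    then show "\<exists>M. \<forall>m\<ge>M. \<forall>n\<ge>M. dist (X m) (X n) < e" by blast
  qed
  then obtain f where "X \<longlonglongrightarrow> f" using complete by (auto simp: complete_def)
  then have fD: "f \<in> D" and Bf: "(\<lambda>n. B (X n - f) (X n - f)) \<longlonglongrightarrow> 0"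
    using closed[of X f] XD cauchyB by auto
  have "B k f = k \<bullet> g" if k: "k \<in> D" for k
  proof -
    have "(\<lambda>n. B k (X n - f)) \<longlonglongrightarrow> 0"
    proof (rule Lim_null_comparison)
      show "\<forall>\<^sub>F n in sequentially. norm (B k (X n - f)) \<le> sqrt (B k k * B (X n - f) (X n - f))"
        using cauchy_schwarz[OF k mem(3)[OF XD fD]] by (auto intro!: always_eventually real_le_rsqrt)
      have "(\<lambda>n. sqrt (B k k * B (X n - f) (X n - f))) \<longlonglongrightarrow> sqrt (B k k * 0)"
        by (intro tendsto_intros Bf)
      then show "(\<lambda>n. sqrt (B k k * B (X n - f) (X n - f))) \<longlonglongrightarrow> 0" by simp
    qed
    moreover have "(\<lambda>n. B k (X n) - k \<bullet> g) \<longlonglongrightarrow> 0"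
    proof (rule Lim_null_comparison)
      \<comment> \<open>Near minimality of X n makes J (X n + r k) - m plus the error a nonnegative
        quadratic in r; its discriminant bounds the first variation B k (X n) - k \<bullet>
        g.\<close>
      have "(B k (X n) - k \<bullet> g)\<^sup>2 \<le> B k k * inverse (real (Suc n))" for n
      proof (rule nonneg_quadratic_discriminant[OF nonneg[OF k]])
        fix r
        have "m \<le> J (X n + r *\<^sub>R k)" using XD k by (intro m_le mem)
        also have "\<dots> = J (X n) + 2 * r * (B k (X n) - k \<bullet> g) + r\<^sup>2 * B k k"
          unfolding J_def using XD k
          by (simp add: add_left add_right scale_left scale_right mem sym[of "X n" k]
              power2_eq_square inner_add_left algebra_simps)
        finally show "0 \<le> B k k * r\<^sup>2 + 2 * (B k (X n) - k \<bullet> g) * r + inverse (real (Suc n))"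
          using XJ[of n] by (simp add: algebra_simps)
      qed
      then show "\<forall>\<^sub>F n in sequentially. norm (B k (X n) - k \<bullet> g)
          \<le> sqrt (B k k * inverse (real (Suc n)))"
        by (auto intro!: always_eventually real_le_rsqrt)
      have "(\<lambda>n. sqrt (B k k * inverse (real (Suc n)))) \<longlonglongrightarrow> sqrt (B k k * 0)"
        by (intro tendsto_intros LIMSEQ_inverse_real_of_nat)
      then show "(\<lambda>n. sqrt (B k k * inverse (real (Suc n)))) \<longlonglongrightarrow> 0" by simp
    qed
    ultimately have "(\<lambda>n. (B k (X n) - k \<bullet> g) - B k (X n - f)) \<longlonglongrightarrow> 0 - 0"
      using tendsto_diff by blast
    moreover have "(B k (X n) - k \<bullet> g) - B k (X n - f) = B k f - k \<bullet> g" for n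
      using diff_right[OF k XD fD] by simp
    ultimately have "(\<lambda>n::nat. B k f - k \<bullet> g) \<longlonglongrightarrow> 0" by simp
    then have "B k f - k \<bullet> g = 0" by (simp only: LIMSEQ_const_iff)
    then show ?thesis by simp
  qed
  with fD show ?thesis by blast
qed

end

section \<open>Bounded symmetric operators and orthogonal projections\<close>

definition symmetric_op :: "('a::real_inner \<Rightarrow> 'a) \<Rightarrow> bool" where
  "symmetric_op S \<longleftrightarrow> bounded_linear S \<and> (\<forall>x y. S x \<bullet> y = x \<bullet> S y)"

definition positive_op :: "('a::real_inner \<Rightarrow> 'a) \<Rightarrow> bool" where
  "positive_op S \<longleftrightarrow> symmetric_op S \<and> (\<forall>x. 0 \<le> x \<bullet> S x)"

text \<open>The real counterpart of \<open>orth_projection\<close>, with boundedness included so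
  that it passes to limits.\<close>

definition orthoproj :: "('a::real_inner \<Rightarrow> 'a) \<Rightarrow> bool" where
  "orthoproj P \<longleftrightarrow> symmetric_op P \<and> (\<forall>x. P (P x) = P x)"

lemma positive_op_psd_form: "positive_op S \<Longrightarrow> psd_form UNIV (\<lambda>x y. x \<bullet> S y)"
  unfolding positive_op_def symmetric_op_def
  by unfold_locales (auto simp: linear_simps inner_add_right inner_commute)

text \<open>Cauchy-Schwarz for the form x \<bullet> S y, applied to S x and x, gives |S x|^4 \<le>
  (x \<bullet> S x) (S x \<bullet> S (S x)); bounding the last factor by c |S x|^2 leaves a factor
  |S x|^2 to cancel.\<close>

lemma positive_op_norm_le:
  assumes S: "positive_op S" and c: "\<And>x. norm (S x) \<le> c * norm x"
  shows "(norm (S x))\<^sup>2 \<le> c * (x \<bullet> S x)"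
proof -
  interpret psd_form UNIV "\<lambda>x y. x \<bullet> S y" by (rule positive_op_psd_form[OF S])
  let ?n = "(norm (S x))\<^sup>2"
  have nn: "0 \<le> x \<bullet> S x" using nonneg[of x] by simp
  have "?n\<^sup>2 \<le> (x \<bullet> S x) * (S x \<bullet> S (S x))"
    using cauchy_schwarz[of "S x" x]
    by (simp add: power2_norm_eq_inner mult.commute)
  also have "\<dots> \<le> (x \<bullet> S x) * (norm (S x) * norm (S (S x)))"
    by (intro mult_left_mono norm_cauchy_schwarz nn)
  also have "\<dots> \<le> (x \<bullet> S x) * (norm (S x) * (c * norm (S x)))"
    by (intro mult_left_mono nn c) auto
  finally have "?n * ?n \<le> (c * (x \<bullet> S x)) * ?n" by (simp add: power2_eq_square mult_ac)
  moreover have "0 \<le> c * (x \<bullet> S x)"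
  proof (cases "x = 0")
    case False
    have "0 \<le> c * norm x" using c[of x] by (meson norm_ge_zero order_trans)
    then have "0 \<le> c" using False by (simp add: zero_le_mult_iff)
    then show ?thesis using nn by simp
  qed (use S in \<open>simp add: positive_op_def symmetric_op_def linear_simps\<close>)
  ultimately show ?thesis
    by (cases "?n = 0") (simp_all only: mult_le_cancel_right, auto)
qed

lemma positive_op_eq_0:
  assumes S: "positive_op S" and "x \<bullet> S x = 0"
  shows "S x = 0"
proof -
  obtain K where "\<And>x. norm (S x) \<le> K * norm x"
    using S unfolding positive_op_def symmetric_op_def by (metis bounded_linear.bounded mult.commute)
  then show ?thesis using positive_op_norm_le[OF S, of K x] assms(2) by simp
qed

lemma orthoproj_linear: "orthoproj P \<Longrightarrow> bounded_linear P"
  and orthoproj_idem: "orthoproj P \<Longrightarrow> P (P x) = P x"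
  and orthoproj_sym: "orthoproj P \<Longrightarrow> P x \<bullet> y = x \<bullet> P y"
  by (auto simp: orthoproj_def symmetric_op_def)

lemma orthoproj_inner: "orthoproj P \<Longrightarrow> x \<bullet> P x = (norm (P x))\<^sup>2"
  by (metis orthoproj_idem orthoproj_sym power2_norm_eq_inner)

lemma orthoproj_pythagoras:
  assumes "orthoproj P"
  shows "(norm x)\<^sup>2 = (norm (P x))\<^sup>2 + (norm (x - P x))\<^sup>2"
  using orthoproj_inner[OF assms, of x]
  by (simp add: power2_norm_eq_inner inner_diff_left inner_diff_right inner_commute)

lemma orthoproj_norm_le:
  assumes "orthoproj P"
  shows "norm (P x) \<le> norm x"
  using orthoproj_pythagoras[OF assms, of x] power2_le_imp_le[of "norm (P x)" "norm x"] by simp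

text \<open>Riesz representation on M, with the inner product itself as the coercive form, produces
  P g; closedness of M is closedness of that form. Uniqueness of the representing vector makes P
  linear.\<close>

lemma orthoproj_exists:
  fixes M :: "'a::{real_inner,complete_space} set"
  assumes sub: "subspace M" and cl: "closed M"
  shows "\<exists>P. orthoproj P \<and> range P = M"
proof -
  interpret psd_form M inner
    by unfold_locales (auto simp: sub inner_add_right inner_commute)
  have "\<exists>f\<in>M. \<forall>k\<in>M. k \<bullet> f = k \<bullet> g" for g
  proof (rule riesz_representation[where \<delta> = 1])
    fix X and f assume X: "\<And>n. X n \<in> M" "X \<longlonglongrightarrow> f"
    then have "f \<in> M" by (metis cl closed_sequentially)
    moreover have "(\<lambda>n. (X n - f) \<bullet> (X n - f)) \<longlonglongrightarrow> (f - f) \<bullet> (f - f)"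
      by (intro tendsto_intros X)
    ultimately show "f \<in> M \<and> (\<lambda>n. (X n - f) \<bullet> (X n - f)) \<longlonglongrightarrow> 0" by simp
  qed (auto simp: power2_norm_eq_inner complete_UNIV)
  then obtain P where PM: "\<And>g. P g \<in> M" and P: "\<And>g k. k \<in> M \<Longrightarrow> k \<bullet> P g = k \<bullet> g"
    by metis
  have uniq: "y = P g" if "y \<in> M" "\<And>k. k \<in> M \<Longrightarrow> k \<bullet> y = k \<bullet> g" for y g
  proof -
    have "(y - P g) \<bullet> (y - P g) = 0"
      using that P[of "y - P g" g] mem(3)[OF that(1) PM[of g]] by (simp add: inner_diff_right)
    then show ?thesis by simp
  qed
  have nrm: "norm (P g) \<le> norm g" for g
  proof -
    have "norm (P g) * norm (P g) \<le> norm (P g) * norm g"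
      using P[OF PM, of g g] norm_cauchy_schwarz[of "P g" g]
      by (simp add: power2_norm_eq_inner flip: power2_eq_square)
    then show ?thesis by (cases "norm (P g) = 0") auto
  qed
  have "bounded_linear P"
  proof (rule bounded_linear_intro[where K = 1])
    show "P (x + y) = P x + P y" for x y
      by (rule uniq[symmetric]) (auto simp: PM mem P inner_add_right)
    show "P (r *\<^sub>R x) = r *\<^sub>R P x" for r x
      by (rule uniq[symmetric]) (auto simp: PM mem P)
  qed (simp add: nrm)
  moreover have "P x \<bullet> y = x \<bullet> P y" for x y
    by (metis P PM inner_commute)
  moreover have id: "P x = x" if "x \<in> M" for x
    by (rule uniq[symmetric]) (auto simp: that)
  moreover have "range P = M" using PM id by (metis (no_types) image_subset_iff subsetI subset_antisym rangeI)
  ultimately show ?thesis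
    using PM by (intro exI[of _ P]) (auto simp: orthoproj_def symmetric_op_def)
qed

section \<open>Square roots of positive operators\<close>

text \<open>Polynomials in X with nonnegative coefficients, kept as operators. They form a cone
  closed under composition, which is what the squares in the square root iteration require.\<close>

inductive_set nonneg_poly :: "('a::real_inner \<Rightarrow> 'a) \<Rightarrow> ('a \<Rightarrow> 'a) set" for X where
  id: "(\<lambda>x. x) \<in> nonneg_poly X"
| mult: "p \<in> nonneg_poly X \<Longrightarrow> (\<lambda>x. X (p x)) \<in> nonneg_poly X"
| add: "p \<in> nonneg_poly X \<Longrightarrow> q \<in> nonneg_poly X \<Longrightarrow> (\<lambda>x. p x + q x) \<in> nonneg_poly X"
| scale: "p \<in> nonneg_poly X \<Longrightarrow> 0 \<le> r \<Longrightarrow> (\<lambda>x. r *\<^sub>R p x) \<in> nonneg_poly X"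

lemma nonneg_poly_comp:
  assumes "p \<in> nonneg_poly X" "q \<in> nonneg_poly X"
  shows "(\<lambda>x. p (q x)) \<in> nonneg_poly X"
  using assms(1)
  by (induction p rule: nonneg_poly.induct)
     (auto intro: nonneg_poly.intros assms(2))

text \<open>Both positivity claims have to go through the induction together: multiplication by X
  makes the old second claim the new first one, and x \<bullet> X (X (p x)) = X x \<bullet> p (X x)
  reduces the new second claim to the old first one.\<close>

lemma nonneg_poly_props:
  assumes X: "positive_op X" and p: "p \<in> nonneg_poly X"
  shows "symmetric_op p" and "p (X x) = X (p x)"
    and "0 \<le> x \<bullet> p x" and "0 \<le> x \<bullet> X (p x)"
proof -
  have Xl: "bounded_linear X" and Xs: "\<And>x y. X x \<bullet> y = x \<bullet> X y" and Xp: "\<And>x. 0 \<le> x \<bullet> X x"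
    using X by (auto simp: positive_op_def symmetric_op_def)
  have "symmetric_op p \<and> (\<forall>x. p (X x) = X (p x)) \<and> (\<forall>x. 0 \<le> x \<bullet> p x) \<and> (\<forall>x. 0 \<le> x \<bullet> X (p x))"
    using p
  proof (induction p rule: nonneg_poly.induct)
    case id
    then show ?case using Xp by (auto simp: symmetric_op_def)
  next
    case (mult p)
    then have "0 \<le> x \<bullet> X (X (p x))" for x
      by (metis Xs)
    with mult Xl Xs show ?case
      by (auto simp: symmetric_op_def intro: bounded_linear_compose)
  next
    case (add p q)
    then show ?case
      by (auto simp: symmetric_op_def linear_simps[OF Xl] inner_add_left inner_add_right
          intro: bounded_linear_add)
  next
    case (scale p r)
    then show ?case
      by (auto simp: symmetric_op_def linear_simps[OF Xl] intro: bounded_linear_const_scaleR)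
  qed
  then show "symmetric_op p" "p (X x) = X (p x)" "0 \<le> x \<bullet> p x" "0 \<le> x \<bullet> X (p x)"
    by blast+
qed

text \<open>The iteration \<open>Y' = (X + Y\<^sup>2) / 2\<close> converges to \<open>1 - sqrt (1 - X)\<close>.\<close>

primrec sqrt_iter :: "('a::real_inner \<Rightarrow> 'a) \<Rightarrow> nat \<Rightarrow> 'a \<Rightarrow> 'a" where
  "sqrt_iter X 0 = (\<lambda>x. 0)"
| "sqrt_iter X (Suc n) = (\<lambda>x. (1/2) *\<^sub>R (X x + sqrt_iter X n (sqrt_iter X n x)))"

lemma sqrt_iter_nonneg_poly: "sqrt_iter X n \<in> nonneg_poly X"
proof (induction n)
  case 0
  show ?case using nonneg_poly.scale[OF nonneg_poly.id, of 0] by simp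
next
  case (Suc n)
  show ?case
    using nonneg_poly.scale[OF nonneg_poly.add[OF nonneg_poly.mult[OF nonneg_poly.id]
        nonneg_poly_comp[OF Suc Suc]], of "1/2"] by simp
qed

lemma sqrt_iter_bounded_linear: "positive_op X \<Longrightarrow> bounded_linear (sqrt_iter X n)"
  using nonneg_poly_props(1)[OF _ sqrt_iter_nonneg_poly] by (auto simp: symmetric_op_def)

text \<open>Write Y' for the successor of Y and D for Y' - Y. The next difference is (Y' Y' - Y Y) /
  2 = (D Y' + Y D) / 2, and both products are compositions of nonnegative polynomials.\<close>

lemma sqrt_iter_step_nonneg_poly:
  assumes "positive_op X"
  shows "(\<lambda>x. sqrt_iter X (Suc n) x - sqrt_iter X n x) \<in> nonneg_poly X"
proof (induction n)
  case 0
  show ?case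
    using nonneg_poly.scale[OF nonneg_poly.mult[OF nonneg_poly.id], of "1/2" X] by simp
next
  case (Suc n)
  note lin = linear_simps[OF sqrt_iter_bounded_linear[OF assms]]
  have "(\<lambda>x. sqrt_iter X (Suc (Suc n)) x - sqrt_iter X (Suc n) x) =
    (\<lambda>x. (1/2) *\<^sub>R ((\<lambda>x. sqrt_iter X (Suc n) x - sqrt_iter X n x) (sqrt_iter X (Suc n) x)
       + sqrt_iter X n ((\<lambda>x. sqrt_iter X (Suc n) x - sqrt_iter X n x) x)))" (is "_ = ?r")
  proof
    fix x
    have "sqrt_iter X (Suc (Suc n)) x - sqrt_iter X (Suc n) x =
      (1/2) *\<^sub>R (sqrt_iter X (Suc n) (sqrt_iter X (Suc n) x) - sqrt_iter X n (sqrt_iter X n x))"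
      by (subst (1 2) sqrt_iter.simps(2)) (simp add: algebra_simps del: sqrt_iter.simps)
    then show "sqrt_iter X (Suc (Suc n)) x - sqrt_iter X (Suc n) x = ?r x"
      by (simp add: lin del: sqrt_iter.simps)
  qed
  moreover have "?r \<in> nonneg_poly X"
    by (rule nonneg_poly.scale[OF nonneg_poly.add[OF
          nonneg_poly_comp[OF Suc sqrt_iter_nonneg_poly]
          nonneg_poly_comp[OF sqrt_iter_nonneg_poly Suc]]]) simp
  ultimately show ?case by (simp only:)
qed

lemma sqrt_iter_diff_nonneg_poly:
  assumes "positive_op X" "n \<le> m"
  shows "(\<lambda>x. sqrt_iter X m x - sqrt_iter X n x) \<in> nonneg_poly X"
  using assms(2)
proof (induction m rule: dec_induct)
  case base
  show ?case using nonneg_poly.scale[OF nonneg_poly.id, of 0] by simp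
next
  case (step m)
  then show ?case
    using nonneg_poly.add[OF sqrt_iter_step_nonneg_poly[OF assms(1), of m] step.IH]
    by (simp del: sqrt_iter.simps)
qed

lemma sqrt_iter_norm_le:
  assumes "\<And>x. norm (X x) \<le> norm x"
  shows "norm (sqrt_iter X n x) \<le> norm x"
proof (induction n arbitrary: x)
  case (Suc n)
  have "norm (X x + sqrt_iter X n (sqrt_iter X n x)) \<le> norm x + norm x"
    using Suc[of "sqrt_iter X n x"] Suc[of x] assms[of x]
    by (intro norm_triangle_le) linarith
  then show ?case by simp
qed simp

lemma sqrt_iter_commute:
  assumes S: "bounded_linear S" and c: "\<And>x. S (X x) = X (S x)"
  shows "S (sqrt_iter X n x) = sqrt_iter X n (S x)"
  by (induction n arbitrary: x) (auto simp: linear_simps[OF S] c)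

text \<open>The Cauchy property is inherited from the real sequence. This serves bounded monotone
  sequences of operators and of projections; the factor 2 is the norm bound for a difference of two
  contractions, and for projections \<open>a\<close> consists of halves of squared norms.\<close>

lemma convergent_of_square_increments:
  fixes u :: "nat \<Rightarrow> 'a::{real_inner,complete_space}"
  assumes "convergent a" and u: "\<And>m n. n \<le> m \<Longrightarrow> (norm (u m - u n))\<^sup>2 \<le> 2 * (a m - a n)"
  shows "convergent u"
proof -
  have "Cauchy a" using assms(1) by (rule convergent_Cauchy)
  have "Cauchy u"
  proof (rule metric_CauchyI)
    fix e :: real assume e: "e > 0"
    then obtain N where N: "\<And>m n. m \<ge> N \<Longrightarrow> n \<ge> N \<Longrightarrow> dist (a m) (a n) < e\<^sup>2 / 2"
      using metric_CauchyD[OF \<open>Cauchy a\<close>, of "e\<^sup>2 / 2"] by auto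
    have *: "dist (u m) (u n) < e" if "m \<ge> n" "n \<ge> N" for m n
    proof -
      have "\<bar>a m - a n\<bar> < e\<^sup>2 / 2" using N[of m n] that by (simp add: dist_real_def)
      then have "a m - a n < e\<^sup>2 / 2" by (rule le_less_trans[OF abs_ge_self])
      then have "(norm (u m - u n))\<^sup>2 < e\<^sup>2"
        using u[OF that(1)] by argo
      then show ?thesis
        using e by (simp add: dist_norm power_less_imp_less_base)
    qed
    have "dist (u m) (u n) < e" if "m \<ge> N" "n \<ge> N" for m n
      using *[of n m] *[of m n] that by (cases "n \<le> m") (auto simp: dist_commute)
    then show "\<exists>N. \<forall>m\<ge>N. \<forall>n\<ge>N. dist (u m) (u n) < e" by blast
  qed
  then show ?thesis by (rule Cauchy_convergent)
qed

text \<open>With X = 1 - A the limit Z of the iteration satisfies Z = (X + Z Z) / 2, hence (1 - Z)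
  (1 - Z) = 1 - X = A. A bounded operator that commutes with A commutes with all iterates and so
  with Z.\<close>

lemma positive_contraction_sqrt:
  fixes A :: "'a::{real_inner,complete_space} \<Rightarrow> 'a"
  assumes A: "positive_op A" and A1: "\<And>x. norm (A x) \<le> norm x"
  shows "\<exists>B. positive_op B \<and> (\<forall>x. B (B x) = A x) \<and>
    (\<forall>S. bounded_linear S \<longrightarrow> (\<forall>x. S (A x) = A (S x)) \<longrightarrow> (\<forall>x. S (B x) = B (S x)))"
proof -
  have Al: "bounded_linear A" and As: "\<And>x y. A x \<bullet> y = x \<bullet> A y" and Ap: "\<And>x. 0 \<le> x \<bullet> A x"
    using A by (auto simp: positive_op_def symmetric_op_def)
  define X where "X x = x - A x" for x
  have Xn: "norm (X x) \<le> norm x" for x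
  proof -
    have "(norm (X x))\<^sup>2 = (norm x)\<^sup>2 - 2 * (x \<bullet> A x) + (norm (A x))\<^sup>2"
      by (simp add: X_def power2_norm_eq_inner inner_diff_left inner_diff_right inner_commute)
    also have "\<dots> \<le> (norm x)\<^sup>2"
      using positive_op_norm_le[OF A, of 1 x] A1 Ap[of x] by simp
    finally show ?thesis by (rule power2_le_imp_le) auto
  qed
  have X: "positive_op X"
    unfolding positive_op_def symmetric_op_def
  proof (intro conjI allI)
    show "bounded_linear X" unfolding X_def by (intro bounded_linear_sub bounded_linear_ident Al)
    show "X x \<bullet> y = x \<bullet> X y" for x y
      by (simp add: X_def inner_diff_left inner_diff_right As)
    have "x \<bullet> A x \<le> norm x * norm x" for x
      by (rule order_trans[OF norm_cauchy_schwarz]) (intro mult_left_mono A1, simp)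
    then show "0 \<le> x \<bullet> X x" for x
      by (simp add: X_def inner_diff_right power2_eq_square dot_square_norm)
  qed
  let ?Y = "sqrt_iter X"
  note Ynp = nonneg_poly_props[OF X sqrt_iter_nonneg_poly]
  note Yl = sqrt_iter_bounded_linear[OF X]
  note Yn = sqrt_iter_norm_le[of X, OF Xn]
  have diff: "(norm (?Y m x - ?Y n x))\<^sup>2 \<le> 2 * (x \<bullet> ?Y m x - x \<bullet> ?Y n x)"
    and mono: "x \<bullet> ?Y n x \<le> x \<bullet> ?Y m x" if "n \<le> m" for m n x
  proof -
    note p = nonneg_poly_props[OF X sqrt_iter_diff_nonneg_poly[OF X that]]
    have "norm (?Y m x - ?Y n x) \<le> 2 * norm x" for x
      using Yn[of m x] Yn[of n x] by (intro order_trans[OF norm_triangle_ineq4]) linarith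
    from positive_op_norm_le[OF _ this]
    show "(norm (?Y m x - ?Y n x))\<^sup>2 \<le> 2 * (x \<bullet> ?Y m x - x \<bullet> ?Y n x)"
      using p(1,3) by (simp add: positive_op_def inner_diff_right)
    show "x \<bullet> ?Y n x \<le> x \<bullet> ?Y m x"
      using p(3)[of x] by (simp add: inner_diff_right)
  qed
  have "convergent (\<lambda>n. ?Y n x)" for x
  proof -
    have "x \<bullet> ?Y n x \<le> norm x * norm x" for n
      by (rule order_trans[OF norm_cauchy_schwarz]) (intro mult_left_mono Yn, simp)
    then have "convergent (\<lambda>n. x \<bullet> ?Y n x)"
      by (intro Bseq_monoseq_convergent BseqI'[of _ "norm x * norm x"] monoI1)
         (use mono Ynp(3)[of x] in auto)
    then show ?thesis
      by (rule convergent_of_square_increments) (rule diff)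
  qed
  then obtain Z where Z: "\<And>x. (\<lambda>n. ?Y n x) \<longlonglongrightarrow> Z x"
    unfolding convergent_def by metis
  have Zn: "norm (Z x) \<le> norm x" for x
    by (rule LIMSEQ_le_const2[OF tendsto_norm[OF Z]]) (use Yn in auto)
  have Zl: "bounded_linear Z"
  proof (rule bounded_linear_intro[where K = 1])
    show "Z (x + y) = Z x + Z y" for x y
      using tendsto_add[OF Z[of x] Z[of y]] Z[of "x + y"]
      by (simp add: linear_simps[OF Yl] LIMSEQ_unique)
    show "Z (r *\<^sub>R x) = r *\<^sub>R Z x" for r x
      using tendsto_scaleR[OF tendsto_const Z[of x], of r] Z[of "r *\<^sub>R x"]
      by (simp add: linear_simps[OF Yl] LIMSEQ_unique)
  qed (simp add: Zn)
  have Zs: "Z x \<bullet> y = x \<bullet> Z y" for x y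
  proof (rule LIMSEQ_unique)
    show "(\<lambda>n. ?Y n x \<bullet> y) \<longlonglongrightarrow> Z x \<bullet> y" by (intro tendsto_intros Z)
    have "(\<lambda>n. ?Y n x \<bullet> y) = (\<lambda>n. x \<bullet> ?Y n y)"
      using Ynp(1) by (auto simp: symmetric_op_def)
    then show "(\<lambda>n. ?Y n x \<bullet> y) \<longlonglongrightarrow> x \<bullet> Z y" by (simp only:) (intro tendsto_intros Z)
  qed
  have ZZ: "(\<lambda>n. ?Y n (?Y n x)) \<longlonglongrightarrow> Z (Z x)" for x
  proof -
    \<comment> \<open>Strong convergence passes to the squares because the iterates are uniformly
      bounded by 1.\<close>
    have "(\<lambda>n. ?Y n (?Y n x - Z x)) \<longlonglongrightarrow> 0"
    proof (rule Lim_null_comparison)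
      show "\<forall>\<^sub>F n in sequentially. norm (?Y n (?Y n x - Z x)) \<le> norm (?Y n x - Z x)"
        using Yn by auto
      show "(\<lambda>n. norm (?Y n x - Z x)) \<longlonglongrightarrow> 0"
        using Z[of x] by (simp add: LIM_zero tendsto_norm_zero)
    qed
    from tendsto_add[OF this Z[of "Z x"]] show ?thesis
      by (simp add: linear_simps[OF Yl])
  qed
  have Zeq: "Z x = (1/2) *\<^sub>R (X x + Z (Z x))" for x
  proof (rule LIMSEQ_unique)
    show "(\<lambda>n. ?Y (Suc n) x) \<longlonglongrightarrow> Z x" using Z[of x] by (rule LIMSEQ_Suc)
    show "(\<lambda>n. ?Y (Suc n) x) \<longlonglongrightarrow> (1/2) *\<^sub>R (X x + Z (Z x))"
      unfolding sqrt_iter.simps by (intro tendsto_intros ZZ)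
  qed
  have ZZeq: "Z (Z x) = 2 *\<^sub>R Z x - X x" for x
    using arg_cong[OF Zeq[of x], of "\<lambda>y. 2 *\<^sub>R y"] by (simp add: algebra_simps)
  define B where "B x = x - Z x" for x
  have "positive_op B"
    unfolding positive_op_def symmetric_op_def
  proof (intro conjI allI)
    show "bounded_linear B" unfolding B_def by (intro bounded_linear_sub bounded_linear_ident Zl)
    show "B x \<bullet> y = x \<bullet> B y" for x y
      by (simp add: B_def inner_diff_left inner_diff_right Zs)
    have "x \<bullet> Z x \<le> norm x * norm x" for x
      by (rule order_trans[OF norm_cauchy_schwarz]) (intro mult_left_mono Zn, simp)
    then show "0 \<le> x \<bullet> B x" for x
      by (simp add: B_def inner_diff_right dot_square_norm power2_eq_square)
  qed
  moreover have "B (B x) = A x" for x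
    by (simp add: B_def linear_simps[OF Zl] ZZeq X_def scaleR_2)
  moreover have "S (B x) = B (S x)" if S: "bounded_linear S" and c: "\<And>x. S (A x) = A (S x)" for S x
  proof -
    have "S (X x) = X (S x)" for x by (simp add: X_def linear_simps[OF S] c)
    then have "S (?Y n x) = ?Y n (S x)" for n x by (rule sqrt_iter_commute[OF S])
    then have "(\<lambda>n. ?Y n (S x)) \<longlonglongrightarrow> S (Z x)"
      using bounded_linear.tendsto[OF S Z[of x]] by simp
    then have "S (Z x) = Z (S x)" using Z[of "S x"] LIMSEQ_unique by blast
    then show ?thesis by (simp add: B_def linear_simps[OF S])
  qed
  ultimately show ?thesis by blast
qed

lemma positive_op_sqrt:
  fixes A :: "'a::{real_inner,complete_space} \<Rightarrow> 'a"
  assumes A: "positive_op A"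
  shows "\<exists>B. positive_op B \<and> (\<forall>x. B (B x) = A x) \<and>
    (\<forall>S. bounded_linear S \<longrightarrow> (\<forall>x. S (A x) = A (S x)) \<longrightarrow> (\<forall>x. S (B x) = B (S x)))"
proof -
  have Al: "bounded_linear A" and As: "\<And>x y. A x \<bullet> y = x \<bullet> A y" and Ap: "\<And>x. 0 \<le> x \<bullet> A x"
    using A by (auto simp: positive_op_def symmetric_op_def)
  obtain K where K: "K > 0" "\<And>x. norm (A x) \<le> norm x * K"
    using bounded_linear.pos_bounded[OF Al] by blast
  define C where "C x = (1/K) *\<^sub>R A x" for x
  have "positive_op C"
    unfolding positive_op_def symmetric_op_def C_def
    using Al As Ap K(1) by (auto intro: bounded_linear_const_scaleR)
  moreover have "norm (C x) \<le> norm x" for x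
    using K by (simp add: C_def field_simps)
  ultimately obtain B where B: "positive_op B" "\<And>x. B (B x) = C x"
    "\<And>S x. bounded_linear S \<Longrightarrow> (\<And>x. S (C x) = C (S x)) \<Longrightarrow> S (B x) = B (S x)"
    using positive_contraction_sqrt[of C] by metis
  have Bl: "bounded_linear B" using B(1) by (auto simp: positive_op_def symmetric_op_def)
  let ?B = "\<lambda>x. sqrt K *\<^sub>R B x"
  have "positive_op ?B"
    using B(1) K(1) by (auto simp: positive_op_def symmetric_op_def intro: bounded_linear_const_scaleR)
  moreover have "?B (?B x) = A x" for x
    using K(1) by (simp add: linear_simps[OF Bl] B(2) C_def)
  moreover have "S (?B x) = ?B (S x)" if S: "bounded_linear S" "\<And>x. S (A x) = A (S x)" for S x
    using B(3)[OF S(1), of x] S by (simp add: C_def linear_simps[OF S(1)])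
  ultimately show ?thesis by blast
qed

text \<open>With B the square root of A, x \<bullet> A (T x) = B x \<bullet> T (B x). Since E
  commutes with A it commutes with B, so B x is again fixed by E and positivity of T on the fixed
  vectors of E suffices.\<close>

lemma positive_op_commuting_product:
  fixes A T :: "'a::{real_inner,complete_space} \<Rightarrow> 'a"
  assumes A: "positive_op A" and T: "bounded_linear T" and c: "\<And>x. T (A x) = A (T x)"
    and E: "bounded_linear E" "\<And>x. E (A x) = A (E x)"
    and pos: "\<And>y. E y = y \<Longrightarrow> 0 \<le> y \<bullet> T y" and x: "E x = x"
  shows "0 \<le> x \<bullet> A (T x)"
proof -
  obtain B where B: "positive_op B" "\<And>x. B (B x) = A x"
    "\<And>S x. bounded_linear S \<Longrightarrow> (\<And>x. S (A x) = A (S x)) \<Longrightarrow> S (B x) = B (S x)"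
    using positive_op_sqrt[OF A] by metis
  have "E (B x) = B x" using B(3)[OF E] x by simp
  then have "0 \<le> B x \<bullet> T (B x)" by (rule pos)
  also have "\<dots> = B x \<bullet> B (T x)" using B(3)[OF T c] by simp
  also have "\<dots> = x \<bullet> A (T x)"
    using B(1,2) by (simp add: positive_op_def symmetric_op_def)
  finally show ?thesis .
qed

text \<open>The spectral projection of \<open>T\<close> for \<open>(-\<infinity>, 0]\<close> is the projection onto the kernel of
  \<open>\<bar>T\<bar> + T\<close>.\<close>

lemma symmetric_op_nonpos_projection:
  fixes T :: "'a::{real_inner,complete_space} \<Rightarrow> 'a"
  assumes T: "symmetric_op T"
  obtains P where "orthoproj P" "\<And>x. P x = x \<Longrightarrow> x \<bullet> T x \<le> 0"
    "\<And>x. P x = 0 \<Longrightarrow> x \<noteq> 0 \<Longrightarrow> 0 < x \<bullet> T x"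
    "\<And>S S' x. bounded_linear S \<Longrightarrow> bounded_linear S' \<Longrightarrow> (\<And>x y. S x \<bullet> y = x \<bullet> S' y) \<Longrightarrow>
       (\<And>x. S (T x) = T (S x)) \<Longrightarrow> (\<And>x. S' (T x) = T (S' x)) \<Longrightarrow> S (P x) = P (S x)"
proof -
  have Tl: "bounded_linear T" and Ts: "\<And>x y. T x \<bullet> y = x \<bullet> T y"
    using T by (auto simp: symmetric_op_def)
  have "positive_op (\<lambda>x. T (T x))"
    by (auto simp: positive_op_def symmetric_op_def Ts intro: bounded_linear_compose Tl)
       (metis Ts inner_ge_zero)
  then obtain B where B: "positive_op B" "\<And>x. B (B x) = T (T x)"
    "\<And>S x. bounded_linear S \<Longrightarrow> (\<And>x. S (T (T x)) = T (T (S x))) \<Longrightarrow> S (B x) = B (S x)"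
    using positive_op_sqrt[of "\<lambda>x. T (T x)"] by metis
  have Bl: "bounded_linear B" and Bs: "\<And>x y. B x \<bullet> y = x \<bullet> B y" and Bp: "\<And>x. 0 \<le> x \<bullet> B x"
    using B by (auto simp: positive_op_def symmetric_op_def)
  have BT: "T (B x) = B (T x)" for x by (rule B(3)[OF Tl]) simp
  define M where "M = {x. B x + T x = 0}"
  have Ml: "bounded_linear (\<lambda>x. B x + T x)" by (intro bounded_linear_add Bl Tl)
  have "subspace M"
    using Bl Tl by (auto simp: M_def subspace_def linear_simps) (metis add.assoc add.commute add.right_neutral, metis scaleR_right_distrib scaleR_zero_right)
  moreover have "closed M"
    unfolding M_def by (intro closed_Collect_eq bounded_linear.continuous_on[OF Ml] continuous_intros)
  ultimately obtain P where P: "orthoproj P" and PM: "range P = M"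
    using orthoproj_exists by blast
  have PMiff: "P x = x \<longleftrightarrow> x \<in> M" for x
    using PM orthoproj_idem[OF P] by (metis rangeE rangeI)
  have neg: "x \<bullet> T x \<le> 0" if "P x = x" for x
  proof -
    have "T x = - B x" using that by (simp add: PMiff M_def add_eq_0_iff)
    then show ?thesis using Bp[of x] by simp
  qed
  have perp: "x \<bullet> y = 0" if "P x = 0" "y \<in> M" for x y
    using orthoproj_sym[OF P, of x y] that PMiff[of y] by simp
  \<comment> \<open>(B + T) (B - T) = B B - T T = 0, since B and T commute.\<close>
  have diffM: "B x - T x \<in> M" for x
    by (simp add: M_def linear_simps[OF Bl] linear_simps[OF Tl] B(2) BT)
  have pos: "0 < x \<bullet> T x" if x: "P x = 0" "x \<noteq> 0" for x
  proof -
    \<comment> \<open>Orthogonality to M forces B x = T x, so x \<bullet> T x = x \<bullet> B x,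
      which vanishes only if B x = T x = 0, that is, if x lies in M as well.\<close>
    have "(B x - T x) \<bullet> (B x - T x) = x \<bullet> (B (B x - T x) - T (B x - T x))"
      by (simp add: inner_diff_left inner_diff_right Bs Ts linear_simps[OF Bl] linear_simps[OF Tl])
    also have "\<dots> = 0" by (rule perp[OF x(1) diffM])
    finally have TB: "T x = B x" by simp
    have "B x \<noteq> 0"
    proof
      assume "B x = 0"
      then have "x \<in> M" using TB by (simp add: M_def)
      then show False using x PMiff[of x] by simp
    qed
    then have "x \<bullet> B x \<noteq> 0" using positive_op_eq_0[OF B(1)] by blast
    then show ?thesis using TB Bp[of x] by simp
  qed
  have comm: "S (P x) = P (S x)"
    if S: "bounded_linear S" "bounded_linear S'" "\<And>x y. S x \<bullet> y = x \<bullet> S' y"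
      "\<And>x. S (T x) = T (S x)" "\<And>x. S' (T x) = T (S' x)" for S S' x
  proof -
    \<comment> \<open>S and its adjoint S' both commute with B and T, so both leave M invariant;
      invariance under S' makes S preserve the orthogonal complement of M.\<close>
    have SM: "S y \<in> M" "S' y \<in> M" if "y \<in> M" for y
    proof -
      have "S (B y + T y) = 0" "S' (B y + T y) = 0"
        using that S(1,2) by (simp_all add: M_def linear_simps)
      then show "S y \<in> M" "S' y \<in> M"
        using B(3)[OF S(1), of y] B(3)[OF S(2), of y] S(4,5)
        by (simp_all add: M_def linear_simps[OF S(1)] linear_simps[OF S(2)])
    qed
    have "P (S (P x)) = S (P x)" using SM(1) PM PMiff by blast
    moreover have "P (S (x - P x)) = 0"
    proof -
      have "P (S (x - P x)) \<bullet> P (S (x - P x)) = (x - P x) \<bullet> S' (P (S (x - P x)))"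
        using orthoproj_sym[OF P] orthoproj_idem[OF P] S(3) by (metis)
      also have "\<dots> = 0"
        by (rule perp) (use SM(2) PM P in
          \<open>auto simp: linear_simps[OF orthoproj_linear[OF P]] orthoproj_idem\<close>)
      finally show ?thesis by simp
    qed
    ultimately show ?thesis
      by (simp add: linear_simps[OF S(1)] linear_simps[OF orthoproj_linear[OF P]])
  qed
  show thesis by (rule that[OF P neg pos comm])
qed

section \<open>Stieltjes integrals\<close>

text \<open>Both G and the indefinite integral of \<phi> have increments between \<phi> x and \<phi>
  y times the increment of F. Their difference therefore changes by at most L (y - x) (F y - F x) on
  each step, and over n equal steps these errors sum to L (b - a) (F b - F a) / n. This evaluates
  spectral integrals once a candidate primitive is known.\<close>

lemma stieltjes_integral_eq:
  fixes F G \<phi> :: "real \<Rightarrow> real"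
  assumes mono: "\<And>x y. x \<le> y \<Longrightarrow> F x \<le> F y" and rc: "\<And>x. continuous (at_right x) F"
    and ab: "a \<le> b" and L: "0 \<le> L" and meas: "\<phi> \<in> borel_measurable borel"
    and \<phi>: "\<And>x y. a \<le> x \<Longrightarrow> x \<le> y \<Longrightarrow> y \<le> b \<Longrightarrow> \<phi> x \<le> \<phi> y \<and> \<phi> y \<le> \<phi> x + L * (y - x)"
    and G: "\<And>x y. a \<le> x \<Longrightarrow> x \<le> y \<Longrightarrow> y \<le> b \<Longrightarrow>
      \<phi> x * (F y - F x) \<le> G y - G x \<and> G y - G x \<le> \<phi> y * (F y - F x)"
  shows "set_integrable (interval_measure F) {a<..b} \<phi>"
    and "(LINT t:{a<..b}|interval_measure F. \<phi> t) = G b - G a"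
proof -
  let ?M = "interval_measure F"
  have em: "emeasure ?M {x<..y} = ennreal (F y - F x)" if "x \<le> y" for x y
    by (rule emeasure_interval_measure_Ioc[OF that mono rc])
  have me: "measure ?M {x<..y} = F y - F x" if "x \<le> y" for x y
    by (rule measure_eq_emeasure_eq_ennreal) (use em[OF that] mono[OF that] in auto)
  have const: "set_integrable ?M {x<..y} (\<lambda>t. k :: real)" if "x \<le> y" for x y k
    unfolding set_integrable_def using em[OF that] by auto
  have int: "set_integrable ?M {x<..y} \<phi>" if "a \<le> x" "x \<le> y" "y \<le> b" for x y
    unfolding set_integrable_def
  proof (rule Bochner_Integration.integrable_bound)
    show "integrable ?M (\<lambda>t. indicator {x<..y} t *\<^sub>R (\<bar>\<phi> a\<bar> + \<bar>\<phi> b\<bar>))"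
      using const[OF that(2)] by (simp only: set_integrable_def)
    show "(\<lambda>t. indicator {x<..y} t *\<^sub>R \<phi> t) \<in> borel_measurable ?M"
      using meas by (auto intro!: borel_measurable_scaleR)
    have "\<bar>\<phi> t\<bar> \<le> \<bar>\<phi> a\<bar> + \<bar>\<phi> b\<bar>" if "t \<in> {x<..y}" for t
      using \<phi>[of a t] \<phi>[of t b] that \<open>a \<le> x\<close> \<open>y \<le> b\<close> by auto
    then show "AE t in ?M. norm (indicator {x<..y} t *\<^sub>R \<phi> t)
        \<le> norm (indicator {x<..y} t *\<^sub>R (\<bar>\<phi> a\<bar> + \<bar>\<phi> b\<bar>))"
      by (auto simp: indicator_def)
  qed
  show "set_integrable ?M {a<..b} \<phi>" using int ab by simp
  define I where "I x y = (LINT t:{x<..y}|?M. \<phi> t)" for x y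
  have I_const: "(LINT t:{x<..y}|?M. k) = k * (F y - F x)" if "x \<le> y" for x y and k :: real
    unfolding set_lebesgue_integral_def using me[OF that] by simp
  have I_bounds: "\<phi> x * (F y - F x) \<le> I x y" "I x y \<le> \<phi> y * (F y - F x)"
    if "a \<le> x" "x \<le> y" "y \<le> b" for x y
  proof -
    have "(LINT t:{x<..y}|?M. \<phi> x) \<le> I x y"
      unfolding I_def using that \<phi>[of x] by (intro set_integral_mono const int) auto
    then show "\<phi> x * (F y - F x) \<le> I x y" using I_const that by simp
    have "I x y \<le> (LINT t:{x<..y}|?M. \<phi> y)"
      unfolding I_def using that \<phi>[of _ y] by (intro set_integral_mono const int) auto
    then show "I x y \<le> \<phi> y * (F y - F x)" using I_const that by simp
  qed
  define Z where "Z x = G x - I a x" for x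
  have I_add: "I a y = I a x + I x y" if "a \<le> x" "x \<le> y" "y \<le> b" for x y
  proof -
    have "{a<..y} = {a<..x} \<union> {x<..y}" using that by auto
    then show ?thesis
      unfolding I_def using that by (simp only:) (intro set_integral_Un int, auto)
  qed
  have Z_step: "\<bar>Z y - Z x\<bar> \<le> L * (y - x) * (F y - F x)" if "a \<le> x" "x \<le> y" "y \<le> b" for x y
  proof -
    have "\<phi> y * (F y - F x) \<le> (\<phi> x + L * (y - x)) * (F y - F x)"
      using \<phi>[of x y] mono[of x y] that by (intro mult_right_mono) auto
    then have "\<phi> y * (F y - F x) - \<phi> x * (F y - F x) \<le> L * (y - x) * (F y - F x)"
      by (simp add: algebra_simps)
    then show ?thesis
      unfolding Z_def using I_add[OF that] I_bounds[OF that] G[OF that] by linarith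
  qed
  have bound: "\<bar>Z b - Z a\<bar> \<le> (L * (b - a) * (F b - F a)) * inverse (real (Suc n))" for n
  proof -
    define d where "d = (b - a) / real (Suc n)"
    define p where "p k = a + d * real k" for k
    have d: "d \<ge> 0" using ab by (simp add: d_def)
    have pe: "p 0 = a" "p (Suc n) = b" by (auto simp: p_def d_def)
    have pm: "a \<le> p k" "p k \<le> p (Suc k)" for k using d by (auto simp: p_def algebra_simps)
    have pb: "p k \<le> b" if "k \<le> Suc n" for k
    proof -
      have "d * real k \<le> d * real (Suc n)" using d that by (intro mult_left_mono) auto
      also have "\<dots> = b - a" by (simp add: d_def)
      finally show ?thesis by (simp add: p_def)
    qed
    have "\<bar>Z (p k) - Z a\<bar> \<le> L * d * (F (p k) - F a)" if "k \<le> Suc n" for k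
      using that
    proof (induction k)
      case (Suc k)
      have "\<bar>Z (p (Suc k)) - Z (p k)\<bar> \<le> L * (p (Suc k) - p k) * (F (p (Suc k)) - F (p k))"
        using Suc.prems by (intro Z_step pm pb)
      also have "p (Suc k) - p k = d" by (simp add: p_def algebra_simps)
      finally have "\<bar>Z (p (Suc k)) - Z a\<bar> \<le>
          L * d * (F (p (Suc k)) - F (p k)) + L * d * (F (p k) - F a)"
        using Suc.IH Suc.prems by linarith
      then show ?case by (simp add: algebra_simps)
    qed (simp add: pe)
    from this[of "Suc n"] show ?thesis by (simp add: pe d_def divide_inverse mult_ac)
  qed
  have "\<bar>Z b - Z a\<bar> \<le> (L * (b - a) * (F b - F a)) * 0"
    by (rule LIMSEQ_le_const[OF tendsto_mult[OF tendsto_const LIMSEQ_inverse_real_of_nat]])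
       (use bound in auto)
  moreover have "I a a = 0" by (simp add: I_def set_lebesgue_integral_def)
  ultimately show "(LINT t:{a<..b}|?M. \<phi> t) = G b - G a"
    by (simp add: Z_def I_def)
qed

lemma finite_measure_interval_measure:
  fixes F :: "real \<Rightarrow> real"
  assumes mono: "\<And>x y. x \<le> y \<Longrightarrow> F x \<le> F y" and rc: "\<And>x. continuous (at_right x) F"
    and bd: "\<And>x. \<bar>F x\<bar> \<le> C"
  shows "finite_measure (interval_measure F)"
proof
  let ?M = "interval_measure F"
  have "(\<Union>n. {- real n<..real n}) = UNIV"
  proof -
    have "\<exists>n. x \<in> {- real n<..real n}" for x
    proof -
      obtain n where "\<bar>x\<bar> < real n" using reals_Archimedean2 by blast
      then show ?thesis by (intro exI[of _ n]) auto
    qed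
    then show ?thesis by blast
  qed
  then have "emeasure ?M (space ?M) = emeasure ?M (\<Union>n. {- real n<..real n})" by simp
  also have "\<dots> = (SUP n. emeasure ?M {- real n<..real n})"
    by (rule SUP_emeasure_incseq[symmetric]) (auto simp: incseq_def)
  also have "\<dots> \<le> ennreal (2 * C)"
  proof (rule SUP_least)
    fix n
    have "F (real n) - F (- real n) \<le> 2 * C" using bd[of "real n"] bd[of "- real n"] by linarith
    then show "emeasure ?M {- real n<..real n} \<le> ennreal (2 * C)"
      by (simp add: emeasure_interval_measure_Ioc mono rc ennreal_leI)
  qed
  finally show "emeasure ?M (space ?M) \<noteq> \<infinity>" by (auto simp: top_unique)
qed

lemma interval_measure_AE_greater:
  fixes F :: "real \<Rightarrow> real"
  assumes mono: "\<And>x y. x \<le> y \<Longrightarrow> F x \<le> F y" and rc: "\<And>x. continuous (at_right x) F"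
    and const: "\<And>x. x \<le> a \<Longrightarrow> F x = F a"
  shows "AE t in interval_measure F. a < t"
proof -
  have "emeasure (interval_measure F) {a - real n<..a} = 0" for n
    using const[of "a - real n"] by (subst emeasure_interval_measure_Ioc) (auto simp: mono rc)
  then have "(\<Union>n. {a - real n<..a}) \<in> null_sets (interval_measure F)"
    by (intro null_sets_UN) (auto intro: null_setsI)
  then show ?thesis
  proof (rule AE_I')
    have "t \<in> (\<Union>n. {a - real n<..a})" if "t \<le> a" for t
    proof -
      obtain n where "a - t < real n" using reals_Archimedean2 by blast
      then show ?thesis using that by (intro UN_I[of n]) auto
    qed
    then show "{t \<in> space (interval_measure F). \<not> a < t} \<subseteq> (\<Union>n. {a - real n<..a})" by auto
  qed
qed

lemma interval_measure_AE_le: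
  fixes F :: "real \<Rightarrow> real"
  assumes mono: "\<And>x y. x \<le> y \<Longrightarrow> F x \<le> F y" and rc: "\<And>x. continuous (at_right x) F"
    and const: "\<And>x. b \<le> x \<Longrightarrow> F x = F b"
  shows "AE t in interval_measure F. t \<le> b"
proof -
  have "emeasure (interval_measure F) {b<..b + real n} = 0" for n
    using const[of "b + real n"] by (subst emeasure_interval_measure_Ioc) (auto simp: mono rc)
  then have "(\<Union>n. {b<..b + real n}) \<in> null_sets (interval_measure F)"
    by (intro null_sets_UN) (auto intro: null_setsI)
  then show ?thesis
  proof (rule AE_I')
    have "t \<in> (\<Union>n. {b<..b + real n})" if "b < t" for t
    proof -
      obtain n where "t - b < real n" using reals_Archimedean2 by blast
      then show ?thesis using that by (intro UN_I[of n]) auto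
    qed
    then show "{t \<in> space (interval_measure F). \<not> t \<le> b} \<subseteq> (\<Union>n. {b<..b + real n})" by auto
  qed
qed

section \<open>Monotone families of projections\<close>

text \<open>Common to the family built from a resolvent and to the resolution picked by
  \<open>spectral_proj\<close>, so that increments and measures are treated once.\<close>

locale projection_family =
  fixes E :: "real \<Rightarrow> 'a::real_inner \<Rightarrow> 'a"
  assumes orthoproj: "\<And>t. orthoproj (E t)"
    and absorb: "\<And>s t x. s \<le> t \<Longrightarrow> E s (E t x) = E s x"
begin

lemmas E_linear = orthoproj_linear[OF orthoproj]
lemmas E_simps = linear_simps[OF E_linear]
lemmas E_idem = orthoproj_idem[OF orthoproj]
lemmas E_sym = orthoproj_sym[OF orthoproj]
lemmas E_norm_le = orthoproj_norm_le[OF orthoproj]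
lemmas E_inner = orthoproj_inner[OF orthoproj]

text \<open>This is the adjoint of the identity \<open>absorb\<close>.\<close>

lemma absorb': "s \<le> t \<Longrightarrow> E t (E s x) = E s x"
proof -
  assume st: "s \<le> t"
  have "(E t (E s x) - E s x) \<bullet> z = 0" for z
    using absorb[OF st, of z] by (simp add: inner_diff_left E_sym)
  then show ?thesis by (metis eq_iff_diff_eq_0 inner_eq_zero_iff)
qed

lemma E_increment:
  assumes "s \<le> t"
  shows "(norm (E t x - E s x))\<^sup>2 = (norm (E t x))\<^sup>2 - (norm (E s x))\<^sup>2"
  using absorb'[OF assms, of x] E_inner[of x s] E_sym[of t x "E s x"]
  by (simp add: power2_norm_eq_inner inner_diff_left inner_diff_right inner_commute)

lemma E_norm_mono: "s \<le> t \<Longrightarrow> (norm (E s x))\<^sup>2 \<le> (norm (E t x))\<^sup>2"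
  using E_increment[of s t x] zero_le_power2[of "norm (E t x - E s x)"] by linarith

lemma E_norm_mono': "s \<le> t \<Longrightarrow> norm (E s x) \<le> norm (E t x)"
  using power2_le_imp_le[OF E_norm_mono] by simp

lemma E_norm_sq_le: "(norm (E t x))\<^sup>2 \<le> (norm x)\<^sup>2"
  using E_norm_le by (intro power_mono) auto

end

locale right_continuous_projection_family = projection_family +
  assumes at_right: "\<And>t x. ((\<lambda>s. E s x) \<longlongrightarrow> E t x) (at_right t)"
begin

abbreviation F :: "'a \<Rightarrow> real \<Rightarrow> real" where
  "F x t \<equiv> (norm (E t x))\<^sup>2"

text \<open>The measure of \<open>spectral_measure_at\<close>, available here without a complex
  structure.\<close>

abbreviation M :: "'a \<Rightarrow> real measure" where
  "M x \<equiv> interval_measure (F x)"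

lemma F_right_continuous: "continuous (at_right t) (F x)"
  unfolding continuous_within by (intro tendsto_intros at_right)

lemma finite_measure_M: "finite_measure (M x)"
  by (rule finite_measure_interval_measure[OF E_norm_mono F_right_continuous,
        where C = "(norm x)\<^sup>2"]) (simp_all add: E_norm_sq_le)

end

section \<open>The spectral family of an operator with positive injective resolvent\<close>

text \<open>\<open>R\<close> plays the role of \<open>(H + c)\<^sup>-\<^sup>1\<close>, so that \<open>H \<le> t\<close> corresponds to \<open>1 - (t + c) R \<le> 0\<close>.\<close>

locale resolvent_op =
  fixes R :: "'a::{real_inner,complete_space} \<Rightarrow> 'a" and c :: real
  assumes R: "positive_op R" and inj: "\<And>x. R x = 0 \<Longrightarrow> x = 0"
begin

lemma R_linear: "bounded_linear R" and R_sym: "R x \<bullet> y = x \<bullet> R y" and R_nonneg: "0 \<le> x \<bullet> R x"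
  using R by (auto simp: positive_op_def symmetric_op_def)

lemmas R_simps = linear_simps[OF R_linear]

text \<open>The inequalities express H \<le> t on the range and H > t on the kernel in terms of R.
  The commutation clause relates the choices for different t, which are made independently; it
  mentions an adjoint because S commutes with a projection when S and S' both leave its range
  invariant.\<close>

definition spectral_cut :: "real \<Rightarrow> ('a \<Rightarrow> 'a) \<Rightarrow> bool" where
  "spectral_cut t P \<longleftrightarrow> orthoproj P \<and> (\<forall>x. P x = x \<longrightarrow> x \<bullet> x \<le> (t + c) * (x \<bullet> R x)) \<and>
    (\<forall>x. P x = 0 \<longrightarrow> x \<noteq> 0 \<longrightarrow> (t + c) * (x \<bullet> R x) < x \<bullet> x) \<and>
    (\<forall>S S' x. bounded_linear S \<longrightarrow> bounded_linear S' \<longrightarrow> (\<forall>x y. S x \<bullet> y = x \<bullet> S' y) \<longrightarrow>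
       (\<forall>x. S (R x) = R (S x)) \<longrightarrow> (\<forall>x. S' (R x) = R (S' x)) \<longrightarrow> S (P x) = P (S x))"

definition E :: "real \<Rightarrow> 'a \<Rightarrow> 'a" where
  "E t = (SOME P. spectral_cut t P)"

lemma E_cut: "spectral_cut t (E t)"
proof -
  define T where "T x = x - (t + c) *\<^sub>R R x" for x
  have "symmetric_op T"
    unfolding symmetric_op_def T_def
    by (auto intro!: bounded_linear_sub bounded_linear_const_scaleR R_linear bounded_linear_ident
        simp: inner_diff_left inner_diff_right R_sym)
  then obtain P where P: "orthoproj P"
    "\<And>x. P x = x \<Longrightarrow> x \<bullet> T x \<le> 0" "\<And>x. P x = 0 \<Longrightarrow> x \<noteq> 0 \<Longrightarrow> 0 < x \<bullet> T x"
    "\<And>S S' x. bounded_linear S \<Longrightarrow> bounded_linear S' \<Longrightarrow> (\<And>x y. S x \<bullet> y = x \<bullet> S' y) \<Longrightarrow>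
       (\<And>x. S (T x) = T (S x)) \<Longrightarrow> (\<And>x. S' (T x) = T (S' x)) \<Longrightarrow> S (P x) = P (S x)"
    using symmetric_op_nonpos_projection by blast
  have "spectral_cut t P"
    unfolding spectral_cut_def
  proof (intro conjI allI impI P(1))
    fix x
    show "P x = x \<Longrightarrow> x \<bullet> x \<le> (t + c) * (x \<bullet> R x)"
      using P(2)[of x] by (simp add: T_def inner_diff_right)
    show "P x = 0 \<Longrightarrow> x \<noteq> 0 \<Longrightarrow> (t + c) * (x \<bullet> R x) < x \<bullet> x"
      using P(3)[of x] by (simp add: T_def inner_diff_right)
  next
    fix S S' x
    assume S: "bounded_linear S" "bounded_linear S'" "\<forall>x y. S x \<bullet> y = x \<bullet> S' y"
      "\<forall>x. S (R x) = R (S x)" "\<forall>x. S' (R x) = R (S' x)"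
    show "S (P x) = P (S x)"
      by (rule P(4)[OF S(1,2)])
         (use S(3-5) in \<open>simp_all add: T_def linear_simps[OF S(1)] linear_simps[OF S(2)]\<close>)
  qed
  then show ?thesis unfolding E_def by (rule someI[of "spectral_cut t"])
qed

lemma E_orthoproj: "orthoproj (E t)"
  and E_upper: "E t x = x \<Longrightarrow> x \<bullet> x \<le> (t + c) * (x \<bullet> R x)"
  and E_lower_strict: "E t x = 0 \<Longrightarrow> x \<noteq> 0 \<Longrightarrow> (t + c) * (x \<bullet> R x) < x \<bullet> x"
  using E_cut[of t] unfolding spectral_cut_def by blast+

lemma E_commute:
  assumes "bounded_linear S" "bounded_linear S'" "\<And>x y. S x \<bullet> y = x \<bullet> S' y"
    "\<And>x. S (R x) = R (S x)" "\<And>x. S' (R x) = R (S' x)"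
  shows "S (E t x) = E t (S x)"
  using E_cut[of t] assms unfolding spectral_cut_def by blast

lemma E_lower: "E t x = 0 \<Longrightarrow> (t + c) * (x \<bullet> R x) \<le> x \<bullet> x"
  using E_lower_strict[of t x] by (cases "x = 0") (auto simp: less_imp_le)

lemma E_bounded_linear: "bounded_linear (E t)"
  by (rule orthoproj_linear[OF E_orthoproj])

lemma R_E: "R (E t x) = E t (R x)"
  by (rule E_commute[OF R_linear R_linear]) (auto simp: R_sym)

lemma E_E_commute: "E s (E t x) = E t (E s x)"
  by (rule E_commute[OF E_bounded_linear E_bounded_linear]) (auto simp: orthoproj_sym[OF E_orthoproj] R_E)

text \<open>A nonzero vector in the range of E s and in the kernel of E t would satisfy the upper
  inequality at s and the strict lower inequality at t, which exclude each other when s \<le>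
  t.\<close>

lemma E_mono:
  assumes "s \<le> t"
  shows "E s (E t x) = E s x"
proof (rule ccontr)
  assume ne: "E s (E t x) \<noteq> E s x"
  define y where "y = E s x - E s (E t x)"
  have y: "y \<noteq> 0" "E s y = y" "E t y = 0"
    using ne by (auto simp: y_def linear_simps[OF E_bounded_linear] orthoproj_idem[OF E_orthoproj] E_E_commute[of t s])
  have "y \<bullet> y \<le> (s + c) * (y \<bullet> R y)" by (rule E_upper[OF y(2)])
  also have "\<dots> \<le> (t + c) * (y \<bullet> R y)" using assms R_nonneg by (intro mult_right_mono) auto
  also have "\<dots> < y \<bullet> y" by (rule E_lower_strict[OF y(3,1)])
  finally show False by simp
qed

sublocale projection_family E
  by unfold_locales (fact E_orthoproj, fact E_mono)

lemma E_below: "t + c \<le> 0 \<Longrightarrow> E t x = 0"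
proof -
  assume t: "t + c \<le> 0"
  have "E t x \<bullet> E t x \<le> (t + c) * (E t x \<bullet> R (E t x))" by (rule E_upper[OF E_idem])
  also have "\<dots> \<le> 0" using t R_nonneg by (simp add: mult_nonpos_nonneg)
  finally have "(norm (E t x))\<^sup>2 \<le> 0" by (simp add: power2_norm_eq_inner)
  then show ?thesis by simp
qed

text \<open>The jump y at t lies in the kernel of E t and in the range of every E (s n). The upper
  inequalities at s n pass to the limit t and contradict the strict lower inequality at t unless y =
  0. Monotonicity extends the convergence from the sequence to all arguments.\<close>

lemma E_at_right: "((\<lambda>s. E s x) \<longlongrightarrow> E t x) (at_right t)"
proof -
  define s where "s n = t + inverse (real (Suc n))" for n
  have st: "t < s n" for n by (simp add: s_def)
  have sm: "s m \<le> s n" if "n \<le> m" for m n using that by (auto simp: s_def intro: le_imp_inverse_le)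
  \<comment> \<open>The minus sign turns the decreasing norms into an increasing sequence; the half
    matches \<open>convergent_of_square_increments\<close>.\<close>
  define a where "a n = - (norm (E (s n) x))\<^sup>2 / 2" for n
  have "convergent a"
  proof (intro Bseq_monoseq_convergent BseqI'[of _ "(norm x)\<^sup>2 / 2"] monoI1)
    show "norm (a n) \<le> (norm x)\<^sup>2 / 2" for n using E_norm_sq_le by (simp add: a_def)
    show "\<forall>m. \<forall>n\<ge>m. a m \<le> a n" using E_norm_mono[OF sm] by (auto simp: a_def)
  qed
  then have "convergent (\<lambda>n. E (s n) x)"
  proof (rule convergent_of_square_increments)
    fix m n :: nat assume "n \<le> m"
    from E_increment[OF sm[OF this], of x]
    show "(norm (E (s m) x - E (s n) x))\<^sup>2 \<le> 2 * (a m - a n)"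
      by (simp add: a_def norm_minus_commute)
  qed
  then obtain u where u: "(\<lambda>n. E (s n) x) \<longlonglongrightarrow> u" by (auto simp: convergent_def)
  define y where "y = u - E t x"
  have y: "(\<lambda>n. E (s n) x - E t x) \<longlonglongrightarrow> y" unfolding y_def by (intro tendsto_intros u)
  have "E t y = 0"
  proof (rule LIMSEQ_unique)
    show "(\<lambda>n. E t (E (s n) x - E t x)) \<longlonglongrightarrow> E t y" by (rule bounded_linear.tendsto[OF E_linear y])
    have "E t (E (s n) x - E t x) = 0" for n
      using E_mono[of t "s n" x] st[of n] by (simp add: E_simps E_idem)
    then show "(\<lambda>n. E t (E (s n) x - E t x)) \<longlonglongrightarrow> 0" by simp
  qed
  have Es: "E (s k) y = y" for k
  proof (rule LIMSEQ_unique)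
    show "(\<lambda>n. E (s k) (E (s n) x - E t x)) \<longlonglongrightarrow> E (s k) y"
      by (rule bounded_linear.tendsto[OF E_linear y])
    have "\<forall>\<^sub>F n in sequentially. E (s k) (E (s n) x - E t x) = E (s n) x - E t x"
      using eventually_ge_at_top[of k]
      by eventually_elim (use st[of k] in \<open>simp add: E_simps absorb' sm\<close>)
    then show "(\<lambda>n. E (s k) (E (s n) x - E t x)) \<longlonglongrightarrow> y"
      using y by (simp add: filterlim_cong)
  qed
  have "y \<bullet> y \<le> (t + c) * (y \<bullet> R y)"
  proof (rule LIMSEQ_le_const)
    have "s \<longlonglongrightarrow> t + 0" unfolding s_def by (intro tendsto_intros LIMSEQ_inverse_real_of_nat)
    then show "(\<lambda>n. (s n + c) * (y \<bullet> R y)) \<longlonglongrightarrow> (t + c) * (y \<bullet> R y)"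
      by (auto intro!: tendsto_intros)
    show "\<exists>N. \<forall>n\<ge>N. y \<bullet> y \<le> (s n + c) * (y \<bullet> R y)" using E_upper[OF Es] by blast
  qed
  with E_lower_strict[OF \<open>E t y = 0\<close>] have y0: "y = 0" by force
  show ?thesis
  proof (rule tendstoI)
    fix e :: real assume "e > 0"
    then obtain n where n: "norm (E (s n) x - E t x) < e"
      using tendstoD[OF y, of e] y0 by (auto simp: eventually_sequentially)
    have "dist (E r x) (E t x) < e" if "t < r" "r < s n" for r
    proof -
      have "(norm (E r x - E t x))\<^sup>2 \<le> (norm (E (s n) x - E t x))\<^sup>2"
        using E_increment[of t r x] E_increment[of t "s n" x] E_norm_mono[of r "s n" x] that st[of n]
        by simp
      then have "norm (E r x - E t x) \<le> norm (E (s n) x - E t x)"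
        by (rule power2_le_imp_le) simp
      then show ?thesis using n by (simp add: dist_norm)
    qed
    then show "\<forall>\<^sub>F r in at_right t. dist (E r x) (E t x) < e"
      unfolding eventually_at_right_field using st[of n] by blast
  qed
qed

sublocale right_continuous_projection_family E
  by unfold_locales (fact E_at_right)

lemma E_at_bot: "((\<lambda>t. E t x) \<longlongrightarrow> 0) at_bot"
proof -
  have "\<forall>\<^sub>F t in at_bot. E t x = 0"
    unfolding eventually_at_bot_linorder by (intro exI[of _ "- c"]) (auto intro: E_below)
  then show ?thesis by (simp add: tendsto_eventually)
qed

text \<open>The part y of x that is never reached is annihilated by every E k, so (k + c) (y
  \<bullet> R y) \<le> y \<bullet> y for all k. This forces y \<bullet> R y = 0, and injectivity of
  R gives y = 0.\<close>

lemma E_at_top: "((\<lambda>t. E t x) \<longlongrightarrow> x) at_top"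
proof -
  define a where "a n = (norm (E (real n) x))\<^sup>2 / 2" for n
  have "convergent a"
  proof (intro Bseq_monoseq_convergent BseqI'[of _ "(norm x)\<^sup>2 / 2"] monoI1)
    show "norm (a n) \<le> (norm x)\<^sup>2 / 2" for n using E_norm_sq_le by (simp add: a_def)
    show "\<forall>m. \<forall>n\<ge>m. a m \<le> a n" using E_norm_mono by (auto simp: a_def)
  qed
  then have "convergent (\<lambda>n. E (real n) x)"
  proof (rule convergent_of_square_increments)
    fix m n :: nat assume "n \<le> m"
    then show "(norm (E (real m) x - E (real n) x))\<^sup>2 \<le> 2 * (a m - a n)"
      using E_increment[of "real n" "real m" x] by (simp add: a_def)
  qed
  then obtain u where u: "(\<lambda>n. E (real n) x) \<longlonglongrightarrow> u" by (auto simp: convergent_def)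
  define y where "y = x - u"
  have Ey: "E (real k) y = 0" for k
  proof -
    have "E (real k) u = E (real k) x"
    proof (rule LIMSEQ_unique)
      show "(\<lambda>n. E (real k) (E (real n) x)) \<longlonglongrightarrow> E (real k) u"
        by (rule bounded_linear.tendsto[OF E_linear u])
      have "\<forall>\<^sub>F n in sequentially. E (real k) (E (real n) x) = E (real k) x"
        using eventually_ge_at_top[of k] by eventually_elim (simp add: E_mono)
      then show "(\<lambda>n. E (real k) (E (real n) x)) \<longlonglongrightarrow> E (real k) x"
        by (simp add: tendsto_eventually)
    qed
    then show ?thesis by (simp add: y_def E_simps)
  qed
  have "y \<bullet> R y = 0"
  proof (rule ccontr)
    assume "y \<bullet> R y \<noteq> 0"
    then have p: "0 < y \<bullet> R y" using R_nonneg[of y] by simp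
    obtain n where "(y \<bullet> y) / (y \<bullet> R y) - c < real n" using reals_Archimedean2 by blast
    then have "y \<bullet> y < (real n + c) * (y \<bullet> R y)" using p by (simp add: field_simps)
    then show False using E_lower[OF Ey, of n] by simp
  qed
  then have "y = 0" by (rule inj[OF positive_op_eq_0[OF R]])
  then have y0: "x = u" by (simp add: y_def)
  show ?thesis
  proof (rule tendstoI)
    fix e :: real assume "e > 0"
    then obtain n where n: "norm (x - E (real n) x) < e"
      using tendstoD[OF u, of e] y0 by (auto simp: eventually_sequentially dist_norm norm_minus_commute)
    have "dist (E r x) x < e" if "real n \<le> r" for r
    proof -
      have "(norm (x - E r x))\<^sup>2 \<le> (norm (x - E (real n) x))\<^sup>2"
        using orthoproj_pythagoras[OF E_orthoproj, of x r]
          orthoproj_pythagoras[OF E_orthoproj, of x "real n"] E_norm_mono[OF that, of x] by linarith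
      then have "norm (x - E r x) \<le> norm (x - E (real n) x)"
        by (rule power2_le_imp_le) simp
      then show ?thesis using n by (simp add: dist_norm norm_minus_commute)
    qed
    then show "\<forall>\<^sub>F r in at_top. dist (E r x) x < e"
      unfolding eventually_at_top_linorder by blast
  qed
qed

text \<open>On the range of E t the form x \<bullet> R y is coercive with constant 1 / (t + c), so
  Riesz representation solves R g = f weakly. The defect R g - f lies in the same range and may be
  used as test vector, so the solution is a strong one.\<close>

lemma E_range_subset_range_R:
  assumes f: "E t f = f"
  shows "\<exists>g. E t g = g \<and> R g = f"
proof (cases "t + c \<le> 0")
  case True
  then have "f = 0" using E_below f by metis
  then show ?thesis by (intro exI[of _ 0]) (simp add: E_simps R_simps)
next
  case False
  let ?D = "{x. E t x = x}"
  interpret psd_form ?D "\<lambda>x y. x \<bullet> R y"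
    by unfold_locales
       (auto simp: subspace_def E_simps R_simps inner_add_right R_nonneg, metis R_sym inner_commute)
  have "\<exists>g\<in>?D. \<forall>k\<in>?D. k \<bullet> R g = k \<bullet> f"
  proof (rule riesz_representation[where \<delta> = "1 / (t + c)"])
    show "0 < 1 / (t + c)" using False by simp
    show "1 / (t + c) * (norm x)\<^sup>2 \<le> x \<bullet> R x" if "x \<in> ?D" for x
      using E_upper[of t x] that False by (simp add: power2_norm_eq_inner field_simps)
    fix X :: "nat \<Rightarrow> 'a" and g assume X: "\<And>n. X n \<in> ?D" "X \<longlonglongrightarrow> g"
    have "(\<lambda>n. E t (X n)) \<longlonglongrightarrow> E t g" by (rule bounded_linear.tendsto[OF E_linear X(2)])
    then have "g \<in> ?D" using X LIMSEQ_unique by auto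
    moreover have "(\<lambda>n. (X n - g) \<bullet> R (X n - g)) \<longlonglongrightarrow> (g - g) \<bullet> R (g - g)"
      by (intro tendsto_intros X bounded_linear.tendsto[OF R_linear])
    ultimately show "g \<in> ?D \<and> (\<lambda>n. (X n - g) \<bullet> R (X n - g)) \<longlonglongrightarrow> 0" by simp
  qed (rule complete_UNIV)
  then obtain g where g: "E t g = g" and *: "\<And>k. E t k = k \<Longrightarrow> k \<bullet> R g = k \<bullet> f" by auto
  have "E t (R g - f) = R g - f" using R_E[of t g] by (simp add: E_simps f g)
  then have "(R g - f) \<bullet> (R g - f) = 0" using * by (simp add: inner_diff_right)
  then show ?thesis using g by (intro exI[of _ g]) auto
qed

text \<open>The inequality 1 \<le> (t + c) R on the range of E t is multiplied by the commuting
  positive operator R. For f = R y and y = (H + c) f the result reads f \<bullet> H f \<le> t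
  |f|^2.\<close>

lemma R_upper:
  assumes "E t y = y"
  shows "y \<bullet> R y \<le> (t + c) * (norm (R y))\<^sup>2"
proof -
  have "0 \<le> y \<bullet> R ((t + c) *\<^sub>R R y - y)"
    by (rule positive_op_commuting_product[OF R _ _ E_linear _ _ assms])
       (auto simp: R_simps R_E inner_diff_right E_upper
         intro!: bounded_linear_sub bounded_linear_const_scaleR R_linear bounded_linear_ident)
  then show ?thesis
    by (simp add: R_simps inner_diff_right power2_norm_eq_inner R_sym)
qed

lemma R_lower:
  assumes "E t y = 0"
  shows "(t + c) * (norm (R y))\<^sup>2 \<le> y \<bullet> R y"
proof -
  \<comment> \<open>The complementary projection has the kernel of E t as its fixed vectors.\<close>
  have "0 \<le> y \<bullet> R (y - (t + c) *\<^sub>R R y)"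
    by (rule positive_op_commuting_product[OF R, where E = "\<lambda>x. x - E t x"])
       (auto simp: assms R_simps R_E inner_diff_right E_lower
         intro!: bounded_linear_sub bounded_linear_const_scaleR R_linear E_linear bounded_linear_ident)
  then show ?thesis
    by (simp add: R_simps inner_diff_right power2_norm_eq_inner R_sym)
qed

lemma M_AE_lower: "AE t in M x. - c < t"
  by (rule interval_measure_AE_greater[OF E_norm_mono F_right_continuous]) (simp_all add: E_below)

text \<open>For f = R g the vector g - c R g is H f. Over (s, t] the increments of |E f|^2, |E g|^2
  and E f \<bullet> H f are expressed through the single vector y, which lies in the range of E t
  and in the kernel of E s, so that all bounds on R apply to it.\<close>

lemma increments:
  fixes g :: 'a and s t :: real
  assumes "s \<le> t"
  defines "y \<equiv> E t g - E s g"
  shows "F (R g) t - F (R g) s = (norm (R y))\<^sup>2" "F g t - F g s = (norm y)\<^sup>2"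
    "E t (R g) \<bullet> (g - c *\<^sub>R R g) - E s (R g) \<bullet> (g - c *\<^sub>R R g) = y \<bullet> R y - c * (norm (R y))\<^sup>2"
    "E t y = y" "E s y = 0"
proof -
  have Ry: "R y = E t (R g) - E s (R g)" by (simp add: y_def R_simps R_E)
  show "E t y = y" "E s y = 0"
    using assms by (auto simp: y_def E_simps E_idem E_mono absorb')
  then have P: "E t (R y) - E s (R y) = R y" by (simp flip: R_E add: R_simps)
  show "F (R g) t - F (R g) s = (norm (R y))\<^sup>2" "F g t - F g s = (norm y)\<^sup>2"
    using E_increment[OF assms(1)] by (auto simp: Ry) (simp add: y_def)
  have "E t (R g) \<bullet> h - E s (R g) \<bullet> h = R y \<bullet> (E t h - E s h)" for h
    using arg_cong[OF P, of "\<lambda>z. z \<bullet> h"]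
    by (simp add: Ry[symmetric] inner_diff_left[symmetric]) (simp add: inner_diff_left inner_diff_right E_sym)
  from this[of "g - c *\<^sub>R R g"]
  show "E t (R g) \<bullet> (g - c *\<^sub>R R g) - E s (R g) \<bullet> (g - c *\<^sub>R R g) = y \<bullet> R y - c * (norm (R y))\<^sup>2"
    by (simp add: E_simps inner_diff_right power2_norm_eq_inner y_def R_simps R_E R_sym
        inner_commute algebra_simps)
qed

text \<open>The primitive is E t f \<bullet> H f with f = R g: \<open>R_upper\<close> and
  \<open>R_lower\<close>, applied to the increment over (x, y], sandwich its growth between x and y
  times that of |E f|^2.\<close>

lemma set_integral_id:
  assumes "a \<le> b"
  shows "set_integrable (M (R g)) {a<..b} (\<lambda>t. t)"
    and "(LINT t:{a<..b}|M (R g). t)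
      = E b (R g) \<bullet> (g - c *\<^sub>R R g) - E a (R g) \<bullet> (g - c *\<^sub>R R g)"
proof -
  have "x * (F (R g) y - F (R g) x)
        \<le> E y (R g) \<bullet> (g - c *\<^sub>R R g) - E x (R g) \<bullet> (g - c *\<^sub>R R g)
      \<and> E y (R g) \<bullet> (g - c *\<^sub>R R g) - E x (R g) \<bullet> (g - c *\<^sub>R R g)
        \<le> y * (F (R g) y - F (R g) x)" if "x \<le> y" for x y
    using R_upper[OF increments(4)[OF that, of g]] R_lower[OF increments(5)[OF that, of g]]
    unfolding increments(1,3)[OF that] by (simp add: algebra_simps)
  note * = this
  show "set_integrable (M (R g)) {a<..b} (\<lambda>t. t)"
    by (rule stieltjes_integral_eq(1)[where L = 1 and
          G = "\<lambda>t. E t (R g) \<bullet> (g - c *\<^sub>R R g)"])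
       (use assms * E_norm_mono' F_right_continuous in auto)
  show "(LINT t:{a<..b}|M (R g). t)
      = E b (R g) \<bullet> (g - c *\<^sub>R R g) - E a (R g) \<bullet> (g - c *\<^sub>R R g)"
    by (rule stieltjes_integral_eq(2)[where L = 1 and
          G = "\<lambda>t. E t (R g) \<bullet> (g - c *\<^sub>R R g)"])
       (use assms * E_norm_mono' F_right_continuous in auto)
qed

text \<open>|E t g|^2 is a primitive of (t + c)^2 because g = (H + c) (R g). The vector x has to
  agree with R g only below b, so that the lemma also serves for x not yet known to lie in the range
  of R, with g a preimage of a truncation of x.\<close>

lemma set_integral_square:
  assumes b: "- c \<le> b" and Rg: "\<And>t. t \<le> b \<Longrightarrow> E t (R g) = E t x"
  shows "set_integrable (M x) {- c<..b} (\<lambda>t. (t + c)\<^sup>2)"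
    and "(LINT t:{- c<..b}|M x. (t + c)\<^sup>2) = F g b"
proof -
  have *: "(s + c)\<^sup>2 * (F x t - F x s) \<le> F g t - F g s \<and> F g t - F g s \<le> (t + c)\<^sup>2 * (F x t - F x s)"
    if "- c \<le> s" "s \<le> t" "t \<le> b" for s t
  proof -
    define y where "y = E t g - E s g"
    note inc = increments[OF that(2), of g, folded y_def]
    have F: "F x t - F x s = (norm (R y))\<^sup>2" using inc(1) Rg that by simp
    have "(s + c) * norm (R y) * norm (R y) \<le> y \<bullet> R y"
      using R_lower[OF inc(5)] by (simp add: power2_eq_square)
    also have "\<dots> \<le> norm y * norm (R y)" by (rule norm_cauchy_schwarz)
    finally have 1: "(s + c) * norm (R y) \<le> norm y"
      by (cases "R y = 0") (auto simp: mult_le_cancel_right)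
    have "norm y * norm y \<le> (t + c) * (y \<bullet> R y)"
      using E_upper[OF inc(4)] by (simp add: power2_norm_eq_inner flip: power2_eq_square)
    also have "\<dots> \<le> (t + c) * (norm y * norm (R y))"
      using that by (intro mult_left_mono norm_cauchy_schwarz) auto
    finally have "norm y * norm y \<le> ((t + c) * norm (R y)) * norm y" by (simp add: mult_ac)
    then have 2: "norm y \<le> (t + c) * norm (R y)"
      using that by (cases "y = 0") (auto simp: mult_le_cancel_right)
    show ?thesis
      unfolding F inc(2) power_mult_distrib[symmetric]
      using 1 2 that by (auto intro!: power_mono)
  qed
  \<comment> \<open>Starting at -c keeps (t + c)^2 monotone; 2 (b + c) is a Lipschitz constant up to
    b.\<close>
  have \<phi>: "(s + c)\<^sup>2 \<le> (t + c)\<^sup>2 \<and> (t + c)\<^sup>2 \<le> (s + c)\<^sup>2 + (2 * (b + c)) * (t - s)"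
    if "- c \<le> s" "s \<le> t" "t \<le> b" for s t
  proof
    show "(s + c)\<^sup>2 \<le> (t + c)\<^sup>2" using that by (intro power_mono) auto
    have "(t + c)\<^sup>2 - (s + c)\<^sup>2 = (t + s + 2 * c) * (t - s)" by (simp add: power2_eq_square algebra_simps)
    also have "\<dots> \<le> (2 * (b + c)) * (t - s)" using that by (intro mult_right_mono) auto
    finally show "(t + c)\<^sup>2 \<le> (s + c)\<^sup>2 + (2 * (b + c)) * (t - s)" by simp
  qed
  show "set_integrable (M x) {- c<..b} (\<lambda>t. (t + c)\<^sup>2)"
    by (rule stieltjes_integral_eq(1)[where L = "2 * (b + c)" and G = "F g"])
       (use b * \<phi> E_norm_mono' F_right_continuous in auto)
  have "(LINT t:{- c<..b}|M x. (t + c)\<^sup>2) = F g b - F g (- c)"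
    by (rule stieltjes_integral_eq(2)[where L = "2 * (b + c)" and G = "F g"])
       (use b * \<phi> E_norm_mono' F_right_continuous in auto)
  then show "(LINT t:{- c<..b}|M x. (t + c)\<^sup>2) = F g b" by (simp add: E_below)
qed

lemma integrable_shift:
  "integrable (M x) (\<lambda>t. (t + a)\<^sup>2) \<Longrightarrow> integrable (M x) (\<lambda>t. (t + b)\<^sup>2)"
proof (rule Bochner_Integration.integrable_bound)
  interpret finite_measure "M x" by (rule finite_measure_M)
  assume "integrable (M x) (\<lambda>t. (t + a)\<^sup>2)"
  then show "integrable (M x) (\<lambda>t. 2 * (t + a)\<^sup>2 + 2 * (b - a)\<^sup>2)" by auto
  have "(t + b)\<^sup>2 \<le> 2 * (t + a)\<^sup>2 + 2 * (b - a)\<^sup>2" for t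
    using zero_le_power2[of "(t + a) - (b - a)"] by (simp add: power2_eq_square algebra_simps)
  then show "AE t in M x. norm ((t + b)\<^sup>2) \<le> norm (2 * (t + a)\<^sup>2 + 2 * (b - a)\<^sup>2)" by auto
qed auto

text \<open>The truncated integrals of (t + c)^2 equal |E g|^2 and tend to |g|^2, so monotone
  convergence yields integrability.\<close>

lemma integrable_square:
  "integrable (M (R g)) (\<lambda>t. t\<^sup>2)"
proof -
  let ?f = "\<lambda>n t. indicator {- c<..- c + real n} t *\<^sub>R (t + c)\<^sup>2"
  have int: "integrable (M (R g)) (?f n)" and eq: "integral\<^sup>L (M (R g)) (?f n) = F g (- c + real n)" for n
    using set_integral_square[of "- c + real n" g "R g"]
    by (auto simp: set_integrable_def set_lebesgue_integral_def)
  have "integrable (M (R g)) (\<lambda>t. (t + c)\<^sup>2)"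
  proof (rule integrable_monotone_convergence[OF int])
    show "AE t in M (R g). mono (\<lambda>n. ?f n t)"
      by (auto simp: mono_def indicator_def)
    show "AE t in M (R g). (\<lambda>n. ?f n t) \<longlonglongrightarrow> (t + c)\<^sup>2"
      using M_AE_lower
    proof eventually_elim
      case (elim t)
      obtain N where N: "t + c < real N" using reals_Archimedean2 by blast
      have "\<forall>\<^sub>F n in sequentially. ?f n t = (t + c)\<^sup>2"
        using eventually_ge_at_top[of N] by eventually_elim (use elim N in auto)
      then show ?case by (rule tendsto_eventually)
    qed
    have "filterlim (\<lambda>n. - c + real n) at_top sequentially"
      by (intro filterlim_tendsto_add_at_top[OF tendsto_const] filterlim_real_sequentially)
    then show "(\<lambda>n. integral\<^sup>L (M (R g)) (?f n)) \<longlonglongrightarrow> (norm g)\<^sup>2"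
      unfolding eq by (intro tendsto_intros filterlim_compose[OF E_at_top])
  qed auto
  from integrable_shift[OF this, of 0] show ?thesis by simp
qed

lemma integral_id:
  "(\<integral>t. t \<partial>M (R g)) = R g \<bullet> (g - c *\<^sub>R R g)"
proof (rule LIMSEQ_unique)
  let ?f = "\<lambda>n t. indicator {- c<..- c + real n} t *\<^sub>R t"
  have eq: "integral\<^sup>L (M (R g)) (?f n) = E (- c + real n) (R g) \<bullet> (g - c *\<^sub>R R g)" for n
    using set_integral_id(2)[of "- c" "- c + real n" g]
    by (auto simp: set_integrable_def set_lebesgue_integral_def E_below)
  interpret finite_measure "M (R g)" by (rule finite_measure_M)
  show "(\<lambda>n. integral\<^sup>L (M (R g)) (?f n)) \<longlonglongrightarrow> (\<integral>t. t \<partial>M (R g))"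
  proof (rule integral_dominated_convergence)
    show "integrable (M (R g)) (\<lambda>t. 1 + t\<^sup>2)" using integrable_square by auto
    show "AE t in M (R g). (\<lambda>n. ?f n t) \<longlonglongrightarrow> t"
      using M_AE_lower
    proof eventually_elim
      case (elim t)
      obtain N where N: "t + c < real N" using reals_Archimedean2 by blast
      have "\<forall>\<^sub>F n in sequentially. ?f n t = t"
        using eventually_ge_at_top[of N] by eventually_elim (use elim N in auto)
      then show ?case by (rule tendsto_eventually)
    qed
    have "\<bar>t\<bar> \<le> 1 + t\<^sup>2" for t :: real
      using zero_le_power2[of "\<bar>t\<bar> - 1"] by (simp add: power2_diff) 
    then show "AE t in M (R g). norm (?f n t) \<le> 1 + t\<^sup>2" for n
      by (auto simp: indicator_def)
  qed auto
  have "filterlim (\<lambda>n. - c + real n) at_top sequentially"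
    by (intro filterlim_tendsto_add_at_top[OF tendsto_const] filterlim_real_sequentially)
  then show "(\<lambda>n. integral\<^sup>L (M (R g)) (?f n)) \<longlonglongrightarrow> R g \<bullet> (g - c *\<^sub>R R g)"
    unfolding eq by (intro tendsto_intros filterlim_compose[OF E_at_top])
qed

text \<open>Each truncation E (N n) x has a preimage g n under R. These are compatible, g n = E (N
  n) (g m) for n \<le> m, and their norms are bounded by the integral of (t + c)^2, so they
  converge; continuity of R carries the limit to x.\<close>

lemma range_R_of_integrable_square:
  assumes x: "integrable (M x) (\<lambda>t. t\<^sup>2)"
  shows "x \<in> range R"
proof -
  define N where "N n = - c + real n" for n
  have "\<exists>g. E (N n) g = g \<and> R g = E (N n) x" for n
    by (rule E_range_subset_range_R) (rule E_idem)
  then obtain g where Eg: "\<And>n. E (N n) (g n) = g n" and Rg: "\<And>n. R (g n) = E (N n) x" by metis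
  have N: "N n \<le> N m" if "n \<le> m" for n m using that by (simp add: N_def)
  have gg: "g n = E (N n) (g m)" if "n \<le> m" for n m
  proof -
    have "R (E (N n) (g m) - g n) = 0"
      using E_mono[OF N[OF that], of x] by (simp add: R_simps R_E Rg)
    from inj[OF this] show ?thesis by simp
  qed
  have int: "integrable (M x) (\<lambda>t. (t + c)\<^sup>2)"
    using integrable_shift[of x 0 c] x by simp
  have bound: "(norm (g n))\<^sup>2 \<le> (\<integral>t. (t + c)\<^sup>2 \<partial>M x)" for n
  proof -
    have *: "E t (R (g n)) = E t x" if "t \<le> N n" for t by (simp add: Rg E_mono that)
    have "(norm (g n))\<^sup>2 = (LINT t:{- c<..N n}|M x. (t + c)\<^sup>2)"
      using set_integral_square(2)[of "N n" "g n" x, OF _ *] Eg[of n] by (simp add: N_def)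
    also have "\<dots> \<le> (\<integral>t. (t + c)\<^sup>2 \<partial>M x)"
      unfolding set_lebesgue_integral_def
    proof (rule integral_mono)
      show "integrable (M x) (\<lambda>t. indicator {- c<..N n} t *\<^sub>R (t + c)\<^sup>2)"
        using set_integral_square(1)[of "N n" "g n" x, OF _ *] by (simp add: N_def set_integrable_def)
    qed (auto simp: int indicator_def)
    finally show ?thesis .
  qed
  define a where "a n = (norm (g n))\<^sup>2 / 2" for n
  have inc: "(norm (g m - g n))\<^sup>2 = (norm (g m))\<^sup>2 - (norm (g n))\<^sup>2" if "n \<le> m" for m n
    using E_increment[OF N[OF that], of "g m"] gg[OF that] Eg[of m] by simp
  have "convergent a"
  proof (intro Bseq_monoseq_convergent BseqI'[of _ "(\<integral>t. (t + c)\<^sup>2 \<partial>M x) / 2"] monoI1)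
    show "norm (a n) \<le> (\<integral>t. (t + c)\<^sup>2 \<partial>M x) / 2" for n using bound by (simp add: a_def)
    show "\<forall>m. \<forall>n\<ge>m. a m \<le> a n"
      using inc zero_le_power2 unfolding a_def by (metis diff_ge_0_iff_ge divide_right_mono zero_le_numeral)
  qed
  then have "convergent g"
    by (rule convergent_of_square_increments) (simp add: inc a_def)
  then obtain u where u: "g \<longlonglongrightarrow> u" by (auto simp: convergent_def)
  have "R u = x"
  proof (rule LIMSEQ_unique)
    show "(\<lambda>n. R (g n)) \<longlonglongrightarrow> R u" by (rule bounded_linear.tendsto[OF R_linear u])
    have "filterlim N at_top sequentially"
      unfolding N_def by (intro filterlim_tendsto_add_at_top[OF tendsto_const] filterlim_real_sequentially)
    then show "(\<lambda>n. R (g n)) \<longlonglongrightarrow> x"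
      unfolding Rg by (rule filterlim_compose[OF E_at_top])
  qed
  then show ?thesis by blast
qed

end

section \<open>Complex inner products\<close>

lemma cinner_scaleC_left: "cinner (c *\<^sub>C x) y = cnj c * cinner x y"
  by (metis cinner_commute cinner_scaleC_right complex_cnj_mult)

lemma scaleC_minus_one: "(- 1) *\<^sub>C x = - x"
  using scaleR_scaleC[of "- 1" x] by simp

text \<open>The first argument is conjugate linear, so \<i> comes out as -\<i> and moves the
  imaginary part to the real one. Complex identities thereby reduce to real ones for x and for \<i>
  x.\<close>

lemma Im_cinner: "Im (cinner x y) = \<i> *\<^sub>C x \<bullet> y"
  by (simp add: inner_eq_Re_cinner cinner_scaleC_left)

lemma cinner_eqI: "x \<bullet> y = u \<bullet> v \<Longrightarrow> \<i> *\<^sub>C x \<bullet> y = \<i> *\<^sub>C u \<bullet> v \<Longrightarrow> cinner x y = cinner u v"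
  by (rule complex_eqI) (simp_all only: inner_eq_Re_cinner[symmetric] Im_cinner)

lemma cinner_self: "cinner x x = complex_of_real ((norm x)\<^sup>2)"
  using cinner_commute[of x x]
  by (intro complex_eqI) (simp_all add: power2_norm_eq_inner inner_eq_Re_cinner complex_eq_iff
      del: of_real_power)

lemma inner_scaleC: "c *\<^sub>C x \<bullet> y = x \<bullet> cnj c *\<^sub>C y"
  by (simp add: inner_eq_Re_cinner cinner_scaleC_left cinner_scaleC_right)

lemma norm_scaleC: "norm (c *\<^sub>C x) = cmod c * norm x"
proof -
  have "(norm (c *\<^sub>C x))\<^sup>2 = Re (cnj c * c * cinner x x)"
    by (simp add: power2_norm_eq_inner inner_eq_Re_cinner cinner_scaleC_left cinner_scaleC_right)
       (simp add: algebra_simps)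
  also have "cnj c * c = complex_of_real ((cmod c)\<^sup>2)"
    using complex_norm_square[of c] by (simp only: mult.commute)
  also have "Re (complex_of_real ((cmod c)\<^sup>2) * cinner x x) = (cmod c * norm x)\<^sup>2"
    by (simp only: cinner_self of_real_mult[symmetric] Re_complex_of_real power_mult_distrib)
  finally show ?thesis by (simp add: power2_eq_iff_nonneg)
qed

lemma bounded_linear_scaleC: "bounded_linear ((*\<^sub>C) c)"
  by (rule bounded_linear_intro[where K = "cmod c"])
     (simp_all add: scaleC_add_right scaleR_scaleC scaleC_scaleC norm_scaleC mult_ac)

lemma csubspace_imp_subspace: "complex_vector.subspace D \<Longrightarrow> subspace D"
  by (auto simp: complex_vector.subspace_def subspace_def scaleR_scaleC)

section \<open>Spectral resolutions\<close>

text \<open>Boundedness comes from |P x|^2 = x \<bullet> P x and Cauchy-Schwarz.\<close>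

lemma orth_projection_orthoproj:
  assumes "orth_projection P"
  shows "orthoproj P"
proof -
  have lin: "Vector_Spaces.linear scaleC scaleC P" and idem: "\<And>x. P (P x) = P x"
    and sym: "\<And>x y. cinner (P x) y = cinner x (P y)"
    using assms by (auto simp: orth_projection_def)
  interpret Vector_Spaces.linear scaleC scaleC P by (rule lin)
  have sym': "P x \<bullet> y = x \<bullet> P y" for x y by (simp add: inner_eq_Re_cinner sym)
  have le: "norm (P x) \<le> norm x" for x
  proof -
    have "norm (P x) * norm (P x) = x \<bullet> P x"
      using sym'[of x "P x"] idem by (simp add: power2_norm_eq_inner flip: power2_eq_square)
    also have "\<dots> \<le> norm x * norm (P x)" by (rule norm_cauchy_schwarz)
    finally show ?thesis by (cases "P x = 0") (auto simp: mult_le_cancel_right)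
  qed
  have "bounded_linear P"
    by (rule bounded_linear_intro[where K = 1]) (simp_all add: add scaleR_scaleC scale le)
  then show ?thesis using idem sym' by (auto simp: orthoproj_def symmetric_op_def)
qed

lemma orth_projection_subspace:
  assumes "orth_projection P"
  shows "complex_vector.subspace (range P)"
proof -
  interpret Vector_Spaces.linear scaleC scaleC P
    using assms by (simp add: orth_projection_def)
  show ?thesis by (rule subspace_image) (rule complex_vector.subspace_UNIV)
qed

locale resolved_operator =
  fixes H :: "('a::complex_inner \<times> 'a) set" and P :: "real \<Rightarrow> 'a \<Rightarrow> 'a"
  assumes resolution: "spectral_resolution H P"
begin

lemma family: "spectral_family P"
  and domain: "f \<in> Domain H \<longleftrightarrow> integrable (spectral_measure_at P f) (\<lambda>t. t\<^sup>2)"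
  and form: "(f, h) \<in> H \<Longrightarrow> cinner f h = complex_of_real (\<integral>t. t \<partial>spectral_measure_at P f)"
  using resolution by (auto simp: spectral_resolution_def)

lemma P_orth: "orth_projection (P t)"
  using family by (simp add: spectral_family_def)

sublocale right_continuous_projection_family P
proof
  show "orthoproj (P t)" for t by (rule orth_projection_orthoproj[OF P_orth])
qed (use family in \<open>auto simp: spectral_family_def\<close>)

lemma at_bot: "((\<lambda>t. P t x) \<longlongrightarrow> 0) at_bot"
  and at_top: "((\<lambda>t. P t x) \<longlongrightarrow> x) at_top"
  using family by (auto simp: spectral_family_def)

lemma P_fixed_mono: "P a f = f \<Longrightarrow> a \<le> b \<Longrightarrow> P b f = f"
  using absorb'[of a b f] by simp

lemma P_zero_mono: "P b f = 0 \<Longrightarrow> a \<le> b \<Longrightarrow> P a f = 0"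
  using absorb[of a b f] by (simp add: E_simps)

text \<open>The distribution function of f is 0 up to a and constant from b on. The two equations on
  f stand for membership in the range of P b - P a.\<close>

lemma AE_window:
  assumes f: "P b f = f" "P a f = 0"
  shows "AE t in M f. a < t \<and> t \<le> b"
proof -
  have "AE t in M f. a < t"
    by (rule interval_measure_AE_greater[OF E_norm_mono F_right_continuous])
       (simp_all add: f P_zero_mono[OF f(2)])
  moreover have "AE t in M f. t \<le> b"
    by (rule interval_measure_AE_le[OF E_norm_mono F_right_continuous])
       (simp_all add: f P_fixed_mono[OF f(1)])
  ultimately show ?thesis by eventually_elim simp
qed

lemma window_domain:
  assumes f: "P b f = f" "P a f = 0"
  shows "f \<in> Domain H"
proof -
  interpret finite_measure "M f" by (rule finite_measure_M)
  have "integrable (M f) (\<lambda>t. t\<^sup>2)"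
  proof (rule integrable_const_bound[where B = "(\<bar>a\<bar> + \<bar>b\<bar>)\<^sup>2"])
    show "AE t in M f. norm (t\<^sup>2) \<le> (\<bar>a\<bar> + \<bar>b\<bar>)\<^sup>2"
      using AE_window[OF f]
    proof eventually_elim
      case (elim t)
      then have "\<bar>t\<bar> \<le> \<bar>a\<bar> + \<bar>b\<bar>" by linarith
      then have "\<bar>t\<bar>\<^sup>2 \<le> (\<bar>a\<bar> + \<bar>b\<bar>)\<^sup>2" by (intro power_mono) auto
      then show ?case by simp
    qed
  qed auto
  then show ?thesis by (simp add: domain spectral_measure_at_def)
qed

lemma integral_window:
  assumes f: "P b f = f" "P a f = 0"
  shows "(LINT t:{a<..b}|M f. t) = (\<integral>t. t \<partial>M f)"
  unfolding set_lebesgue_integral_def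
  by (rule integral_cong_AE) (use AE_window[OF f] in \<open>auto simp: indicator_def\<close>)

lemma integral_subwindow:
  assumes "x \<le> y"
  shows "set_integrable (M f) {x<..y} (\<lambda>t. t)"
    and "x * (F f y - F f x) \<le> (LINT t:{x<..y}|M f. t)"
    and "(LINT t:{x<..y}|M f. t) \<le> y * (F f y - F f x)"
proof -
  interpret finite_measure "M f" by (rule finite_measure_M)
  have const: "set_integrable (M f) {x<..y} (\<lambda>t. k :: real)" for k
    unfolding set_integrable_def
    by (rule integrable_const_bound[where B = "\<bar>k\<bar>"]) (auto simp: indicator_def)
  show int: "set_integrable (M f) {x<..y} (\<lambda>t. t)"
    unfolding set_integrable_def
    by (rule integrable_const_bound[where B = "\<bar>x\<bar> + \<bar>y\<bar>"]) (auto simp: indicator_def)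
  have "measure (M f) {x<..y} = F f y - F f x"
    by (rule measure_eq_emeasure_eq_ennreal)
       (use emeasure_interval_measure_Ioc[OF assms E_norm_mono F_right_continuous]
          E_norm_mono[OF assms] in auto)
  then have c: "(LINT t:{x<..y}|M f. k) = k * (F f y - F f x)" for k :: real
    unfolding set_lebesgue_integral_def by simp
  show "x * (F f y - F f x) \<le> (LINT t:{x<..y}|M f. t)"
    unfolding c[symmetric] by (intro set_integral_mono const int) auto
  show "(LINT t:{x<..y}|M f. t) \<le> y * (F f y - F f x)"
    unfolding c[symmetric] by (intro set_integral_mono const int) auto
qed

lemma window_bounds:
  assumes f: "P b f = f" "P a f = 0" and ab: "a \<le> b" and h: "(f, h) \<in> H"
  shows "a * (norm f)\<^sup>2 \<le> Re (cinner f h)" and "Re (cinner f h) \<le> b * (norm f)\<^sup>2"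
  using integral_subwindow(2,3)[OF ab, of f] integral_window[OF f] form[OF h]
  by (simp_all add: f spectral_measure_at_def)

text \<open>This replaces the commutation of \<open>H\<close> with its spectral projections.\<close>

lemma integral_orthogonal_sum:
  assumes g: "P n g = g" "P a g = 0" and k: "P m k = k" "P n k = 0" and an: "a \<le> n" "n \<le> m"
  shows "(\<integral>t. t \<partial>M (g + k)) = (\<integral>t. t \<partial>M g) + (\<integral>t. t \<partial>M k)"
proof -
  have gm: "P m g = g" "P a k = 0" using P_fixed_mono[OF g(1)] P_zero_mono[OF k(2)] an by auto
  \<comment> \<open>For t \<le> n the vector P t k vanishes; for t > n the vector g = P n g only
    sees P n (P t k) = P n k = 0.\<close>
  have "P t g \<bullet> P t k = 0" for t
  proof (cases "t \<le> n")
    case True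
    then show ?thesis using P_zero_mono[OF k(2)] by simp
  next
    case False
    then have "P t g = g" by (intro P_fixed_mono[OF g(1)]) simp
    moreover have "g \<bullet> P t k = P n g \<bullet> P t k" by (simp add: g)
    moreover have "\<dots> = g \<bullet> P n (P t k)" by (rule E_sym)
    moreover have "P n (P t k) = 0" using False absorb[of n t k] k by simp
    ultimately show ?thesis by simp
  qed
  then have F_add: "F (g + k) t = F g t + F k t" for t
    by (simp add: E_simps power2_norm_eq_inner inner_add_left inner_add_right inner_commute)
  have am: "a \<le> m" using an by simp
  \<comment> \<open>The squared norms add, so the sandwiches for g and for k add up to one for g +
    k, with G as primitive.\<close>
  define G where "G t = (LINT s:{a<..t}|M g. s) + (LINT s:{a<..t}|M k. s)" for t
  have add: "(LINT s:{a<..y}|M f. s) = (LINT s:{a<..x}|M f. s) + (LINT s:{x<..y}|M f. s)"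
    if "a \<le> x" "x \<le> y" for x y f
  proof -
    have "{a<..y} = {a<..x} \<union> {x<..y}" using that by auto
    then show ?thesis
      using that by (simp only:) (intro set_integral_Un integral_subwindow, auto)
  qed
  have "(LINT t:{a<..m}|M (g + k). t) = G m - G a"
  proof (rule stieltjes_integral_eq(2)[OF E_norm_mono F_right_continuous am, where L = 1])
    fix x y assume xy: "a \<le> x" "x \<le> y" "y \<le> m"
    show "x * (F (g + k) y - F (g + k) x) \<le> G y - G x \<and>
        G y - G x \<le> y * (F (g + k) y - F (g + k) x)"
      using integral_subwindow(2,3)[OF xy(2), of g] integral_subwindow(2,3)[OF xy(2), of k]
      unfolding F_add G_def add[OF xy(1,2)] by (simp add: algebra_simps)
  qed auto
  also have "G a = 0" by (simp add: G_def set_lebesgue_integral_def)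
  finally show ?thesis
    using integral_window[of m "g + k" a] integral_window[of m g a] integral_window[of m k a] g k gm
    by (simp add: G_def E_simps)
qed

end

section \<open>Operators of closed semibounded forms\<close>

text \<open>Density of D is stated as triviality of the orthogonal complement, the shape in which it
  yields injectivity of the resolvent.\<close>

locale closed_complex_form =
  fixes D :: "'a::{complex_inner,complete_space} set" and q :: "'a \<Rightarrow> 'a \<Rightarrow> complex"
  assumes csubspace: "complex_vector.subspace D"
    and add_right: "\<And>x y z. x \<in> D \<Longrightarrow> y \<in> D \<Longrightarrow> z \<in> D \<Longrightarrow> q x (y + z) = q x y + q x z"
    and scale_right: "\<And>c x y. x \<in> D \<Longrightarrow> y \<in> D \<Longrightarrow> q x (c *\<^sub>C y) = c * q x y"
    and hermitian: "\<And>x y. x \<in> D \<Longrightarrow> y \<in> D \<Longrightarrow> q x y = cnj (q y x)"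
    and semibounded: "semibounded_form D q"
    and closed: "closed_form D q"
    and dense: "\<And>x. (\<And>k. k \<in> D \<Longrightarrow> cinner k x = 0) \<Longrightarrow> x = 0"
begin

abbreviation H :: "('a \<times> 'a) set" where
  "H \<equiv> form_operator D q"

lemma subspace: "subspace D"
  by (rule csubspace_imp_subspace[OF csubspace])

lemmas mem = subspace_add[OF subspace] subspace_diff[OF subspace] subspace_scale[OF subspace]
  complex_vector.subspace_scale[OF csubspace]

lemma add_left: "x \<in> D \<Longrightarrow> y \<in> D \<Longrightarrow> z \<in> D \<Longrightarrow> q (x + y) z = q x z + q y z"
  using hermitian[of "x + y" z] hermitian[of x z] hermitian[of y z] add_right[of z x y] mem by simp

lemma scale_left: "x \<in> D \<Longrightarrow> y \<in> D \<Longrightarrow> q (c *\<^sub>C x) y = cnj c * q x y"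
  using hermitian[of "c *\<^sub>C x" y] hermitian[of x y] scale_right[of y x c] mem by simp

lemma Im_diag: "x \<in> D \<Longrightarrow> Im (q x x) = 0"
  using hermitian[of x x] by (simp add: complex_eq_iff)

lemma H_domain: "(f, h) \<in> H \<Longrightarrow> f \<in> D"
  and H_form: "(f, h) \<in> H \<Longrightarrow> g \<in> D \<Longrightarrow> q g f = cinner g h"
  by (auto simp: form_operator_def)

definition lower_bound :: real where
  "lower_bound = (SOME c. \<forall>f\<in>D. c * (norm f)\<^sup>2 \<le> Re (q f f))"

lemma lower_bound: "f \<in> D \<Longrightarrow> lower_bound * (norm f)\<^sup>2 \<le> Re (q f f)"
  using someI_ex[OF semibounded[unfolded semibounded_form_def]] unfolding lower_bound_def by blast

text \<open>The summand 1 makes the shifted form dominate the squared norm.\<close>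

definition shift :: real where
  "shift = 1 - lower_bound"

definition shifted :: "'a \<Rightarrow> 'a \<Rightarrow> real" where
  "shifted x y = Re (q x y) + shift * (x \<bullet> y)"

lemma shifted_coercive: "x \<in> D \<Longrightarrow> (norm x)\<^sup>2 \<le> shifted x x"
  using lower_bound[of x] by (simp add: shifted_def shift_def power2_norm_eq_inner algebra_simps)

sublocale shifted: psd_form D shifted
proof
  fix x y z r
  show "x \<in> D \<Longrightarrow> y \<in> D \<Longrightarrow> z \<in> D \<Longrightarrow> shifted x (y + z) = shifted x y + shifted x z"
    by (simp add: shifted_def add_right inner_add_right algebra_simps)
  show "x \<in> D \<Longrightarrow> y \<in> D \<Longrightarrow> shifted x (r *\<^sub>R y) = r * shifted x y"
    using scale_right[of x y "complex_of_real r"]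
    by (simp add: shifted_def scaleR_scaleC[symmetric] algebra_simps)
  show "x \<in> D \<Longrightarrow> y \<in> D \<Longrightarrow> shifted x y = shifted y x"
    using hermitian[of x y] by (simp add: shifted_def inner_commute)
  show "x \<in> D \<Longrightarrow> 0 \<le> shifted x x"
    using shifted_coercive[of x] zero_le_power2[of "norm x"] by linarith
qed (rule subspace)

text \<open>Coercivity controls the term \<open>shift\<close> |x|^2, so a sequence that is Cauchy
  for the shifted form is Cauchy for q, whose closedness is assumed.\<close>

lemma shifted_closed:
  assumes XD: "\<And>n. X n \<in> D" and X: "X \<longlonglongrightarrow> f"
    and C: "\<And>e. e > 0 \<Longrightarrow> \<exists>N. \<forall>m\<ge>N. \<forall>n\<ge>N. shifted (X m - X n) (X m - X n) < e"
  shows "f \<in> D \<and> (\<lambda>n. shifted (X n - f) (X n - f)) \<longlonglongrightarrow> 0"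
proof -
  have "\<exists>N. \<forall>m\<ge>N. \<forall>n\<ge>N. cmod (q (X m - X n) (X m - X n)) < e" if e: "e > 0" for e
  proof -
    \<comment> \<open>Chosen so that d + |shift| d < e.\<close>
    define d where "d = min (e / 2) (e / (2 * (\<bar>shift\<bar> + 1)))"
    have d: "d > 0" using e by (simp add: d_def)
    have d1: "d \<le> e / 2" unfolding d_def by (rule min.cobounded1)
    have d2: "\<bar>shift\<bar> * d < e / 2"
    proof -
      have "(\<bar>shift\<bar> + 1) * d \<le> (\<bar>shift\<bar> + 1) * (e / (2 * (\<bar>shift\<bar> + 1)))"
        by (intro mult_left_mono) (auto simp: d_def)
      also have "\<dots> = e / 2" by (simp add: field_simps)
      finally show ?thesis using d by (simp add: algebra_simps)
    qed
    obtain N where N: "\<And>m n. m \<ge> N \<Longrightarrow> n \<ge> N \<Longrightarrow> shifted (X m - X n) (X m - X n) < d"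
      using C[OF d] by blast
    have "cmod (q (X m - X n) (X m - X n)) < e" if mn: "m \<ge> N" "n \<ge> N" for m n
    proof -
      let ?x = "X m - X n"
      have x: "?x \<in> D" by (rule mem(2)[OF XD XD])
      have s: "shifted ?x ?x < d" "(norm ?x)\<^sup>2 < d" using N[OF mn] shifted_coercive[OF x] by auto
      have "cmod (q ?x ?x) = \<bar>Re (q ?x ?x)\<bar>" using Im_diag[OF x] by (simp add: cmod_eq_Re)
      also have "\<dots> = \<bar>shifted ?x ?x - shift * (norm ?x)\<^sup>2\<bar>"
        by (simp add: shifted_def power2_norm_eq_inner)
      also have "\<dots> \<le> \<bar>shifted ?x ?x\<bar> + \<bar>shift\<bar> * (norm ?x)\<^sup>2"
        by (rule order_trans[OF abs_triangle_ineq4]) (simp add: abs_mult)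
      also have "\<dots> \<le> d + \<bar>shift\<bar> * d"
        using s shifted.nonneg[OF x] by (intro add_mono mult_left_mono) auto
      also have "\<dots> < e / 2 + e / 2"
        using d2 by (intro add_le_less_mono d1)
      finally show ?thesis by simp
    qed
    then show ?thesis by blast
  qed
  then have f: "f \<in> D" and lim: "(\<lambda>n. q (X n - f) (X n - f)) \<longlonglongrightarrow> 0"
    using closed XD X unfolding closed_form_def by blast+
  have "(\<lambda>n. Re (q (X n - f) (X n - f)) + shift * ((X n - f) \<bullet> (X n - f)))
      \<longlonglongrightarrow> Re 0 + shift * ((f - f) \<bullet> (f - f))"
    by (intro tendsto_intros lim X)
  then show ?thesis using f by (simp add: shifted_def)
qed

lemma resolvent_exists: "\<exists>R. \<forall>g. R g \<in> D \<and> (\<forall>k\<in>D. shifted k (R g) = k \<bullet> g)"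
proof -
  have "\<exists>f\<in>D. \<forall>k\<in>D. shifted k f = k \<bullet> g" for g
  proof (rule shifted.riesz_representation[where \<delta> = 1])
    show "f \<in> D \<and> (\<lambda>n. shifted (X n - f) (X n - f)) \<longlonglongrightarrow> 0"
      if "\<And>n. X n \<in> D" "X \<longlonglongrightarrow> f"
        "\<And>e. e > 0 \<Longrightarrow> \<exists>N. \<forall>m\<ge>N. \<forall>n\<ge>N. shifted (X m - X n) (X m - X n) < e" for X f
      by (rule shifted_closed[OF that])
  qed (simp_all add: complete_UNIV shifted_coercive)
  then show ?thesis by metis
qed

text \<open>The vector representing g with respect to the shifted form, that is, the value of (H +
  shift)^-1 at g.\<close>

definition R :: "'a \<Rightarrow> 'a" where
  "R = (SOME R. \<forall>g. R g \<in> D \<and> (\<forall>k\<in>D. shifted k (R g) = k \<bullet> g))"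

lemma R_mem: "R g \<in> D" and R_shifted: "k \<in> D \<Longrightarrow> shifted k (R g) = k \<bullet> g"
  using someI_ex[OF resolvent_exists] unfolding R_def[symmetric] by auto

lemma R_unique:
  assumes f: "f \<in> D" and "\<And>k. k \<in> D \<Longrightarrow> shifted k f = k \<bullet> g"
  shows "f = R g"
proof -
  have d: "f - R g \<in> D" by (rule mem(2)[OF f R_mem])
  have "shifted (f - R g) (f - R g) = 0"
    using shifted.diff_right[OF d f R_mem] assms(2)[OF d] R_shifted[OF d] by simp
  then have "(norm (f - R g))\<^sup>2 \<le> 0" using shifted_coercive[OF d] by simp
  then show ?thesis by simp
qed

lemma R_form_operator: "(R g, g - shift *\<^sub>R R g) \<in> H"
  unfolding form_operator_def
proof (clarify, intro conjI ballI R_mem)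
  fix k assume k: "k \<in> D"
  have Re: "Re (q k (R g)) = k \<bullet> (g - shift *\<^sub>R R g)" if "k \<in> D" for k
    using R_shifted[OF that, of g] by (simp add: shifted_def inner_diff_right)
  \<comment> \<open>Riesz representation controls real parts only; testing with \<i> k gives the
    imaginary part.\<close>
  have "Re (q (\<i> *\<^sub>C k) (R g)) = \<i> *\<^sub>C k \<bullet> (g - shift *\<^sub>R R g)"
    using k by (intro Re mem)
  then have "Im (q k (R g)) = \<i> *\<^sub>C k \<bullet> (g - shift *\<^sub>R R g)"
    using scale_left[OF k R_mem, of \<i> g] by simp
  with Re[OF k] show "q k (R g) = cinner k (g - shift *\<^sub>R R g)"
    by (intro complex_eqI) (simp_all only: inner_eq_Re_cinner[symmetric] Im_cinner)
qed

lemma form_operator_R: "(f, h) \<in> H \<Longrightarrow> f = R (h + shift *\<^sub>R f)"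
  by (rule R_unique) (auto simp: form_operator_def shifted_def inner_eq_Re_cinner[symmetric]
      inner_add_right)

text \<open>The scalar moves to the test vector as its conjugate. As a consequence multiplication by
  c and its adjoint commute with R, hence with the spectral projections.\<close>

lemma R_scaleC: "R (c *\<^sub>C g) = c *\<^sub>C R g"
proof -
  have "shifted k (c *\<^sub>C R g) = k \<bullet> c *\<^sub>C g" if k: "k \<in> D" for k
  proof -
    have "shifted k (c *\<^sub>C R g) = shifted (cnj c *\<^sub>C k) (R g)"
      using k R_mem by (simp add: shifted_def scale_left scale_right inner_scaleC mem)
    also have "\<dots> = cnj c *\<^sub>C k \<bullet> g" using k by (intro R_shifted mem)
    finally show ?thesis by (simp add: inner_scaleC)
  qed
  then show ?thesis using R_unique[of "c *\<^sub>C R g" "c *\<^sub>C g"] R_mem mem by simp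
qed

sublocale resolvent: resolvent_op R shift
proof
  have add: "R (x + y) = R x + R y" for x y
    by (rule R_unique[symmetric])
       (auto simp: R_mem mem shifted.add_right R_shifted inner_add_right)
  have scale: "R (r *\<^sub>R x) = r *\<^sub>R R x" for r x
    by (rule R_unique[symmetric]) (auto simp: R_mem mem shifted.scale_right R_shifted)
  have sym: "R x \<bullet> y = x \<bullet> R y" for x y
    using R_shifted[OF R_mem, of x y] R_shifted[OF R_mem, of y x] shifted.sym[OF R_mem R_mem]
    by (metis inner_commute)
  have le: "norm (R x) \<le> norm x" for x
  proof -
    have "norm (R x) * norm (R x) \<le> R x \<bullet> x"
      using shifted_coercive[OF R_mem, of x] R_shifted[OF R_mem, of x x]
      by (simp add: power2_eq_square)
    also have "\<dots> \<le> norm x * norm (R x)" using norm_cauchy_schwarz[of "R x" x] by (simp add: mult.commute)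
    finally show ?thesis by (cases "R x = 0") (auto simp: mult_le_cancel_right)
  qed
  have "bounded_linear R" by (rule bounded_linear_intro[where K = 1]) (simp_all add: add scale le)
  moreover have "0 \<le> x \<bullet> R x" for x
    using R_shifted[OF R_mem, of x x] shifted.nonneg[OF R_mem, of x] by (simp add: inner_commute)
  ultimately show "positive_op R" using sym by (auto simp: positive_op_def symmetric_op_def)
  fix x assume R0: "R x = 0"
  \<comment> \<open>R x = 0 makes x orthogonal to D, so density applies; \<i> k again supplies the
    imaginary part.\<close>
  have orth: "k \<bullet> x = 0" if "k \<in> D" for k
    using R_shifted[OF that, of x] shifted.diff_right[OF that R_mem R_mem, of x x] by (simp add: R0)
  show "x = 0"
  proof (rule dense)
    fix k assume k: "k \<in> D"
    show "cinner k x = 0"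
      by (rule complex_eqI) (use orth[OF k] orth[OF mem(4)[OF k, of \<i>]] in
        \<open>simp_all add: inner_eq_Re_cinner cinner_scaleC_left\<close>)
  qed
qed

text \<open>The family of the resolvent serves. The domain of H is the range of R, which square
  integrability of t characterizes, and for f = R g the vector h is g - shift f. The imaginary part
  of \<open>cinner f h\<close> vanishes because q is hermitian.\<close>

theorem spectral_resolution_exists: "\<exists>P. spectral_resolution H P"
proof
  let ?E = resolvent.E
  have C: "?E t (a *\<^sub>C x) = a *\<^sub>C ?E t x" for t a x
    by (rule resolvent.E_commute[OF bounded_linear_scaleC bounded_linear_scaleC[of "cnj a"], symmetric])
       (simp_all add: inner_scaleC R_scaleC)
  have "orth_projection (?E t)" for t
    unfolding orth_projection_def
  proof (intro conjI allI)
    show "Vector_Spaces.linear (*\<^sub>C) (*\<^sub>C) (?E t)"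
      by unfold_locales (simp_all add: C resolvent.E_simps)
    show "cinner (?E t f) g = cinner f (?E t g)" for f g
      by (rule cinner_eqI) (simp_all add: resolvent.E_sym flip: C)
  qed (rule resolvent.E_idem)
  then have "spectral_family ?E"
    unfolding spectral_family_def
    using resolvent.absorb resolvent.E_at_right resolvent.E_at_bot resolvent.E_at_top by auto
  moreover have "Domain H = range R"
    using R_form_operator form_operator_R by (auto simp: Domain_iff)
  moreover have "f \<in> range R \<longleftrightarrow> integrable (spectral_measure_at ?E f) (\<lambda>t. t\<^sup>2)" for f
    using resolvent.integrable_square resolvent.range_R_of_integrable_square
    by (auto simp: spectral_measure_at_def)
  moreover have "cinner f h = complex_of_real (\<integral>t. t \<partial>spectral_measure_at ?E f)"
    if "(f, h) \<in> H" for f h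
  proof -
    define g where "g = h + shift *\<^sub>R f"
    have f: "f = R g" "h = g - shift *\<^sub>R f"
      using form_operator_R[OF that] by (simp_all add: g_def)
    have "Im (cinner f h) = 0"
      using H_form[OF that H_domain[OF that]] Im_diag[OF H_domain[OF that]] by simp
    moreover have "Re (cinner f h) = (\<integral>t. t \<partial>spectral_measure_at ?E f)"
      using resolvent.integral_id[of g] f by (simp add: spectral_measure_at_def inner_eq_Re_cinner)
    ultimately show ?thesis by (intro complex_eqI) simp_all
  qed
  ultimately show "spectral_resolution H ?E"
    unfolding spectral_resolution_def by auto
qed

sublocale resolved: resolved_operator H "spectral_proj H"
  by unfold_locales (use someI_ex[OF spectral_resolution_exists] in \<open>simp add: spectral_proj_def\<close>)

abbreviation P :: "real \<Rightarrow> 'a \<Rightarrow> 'a" where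
  "P \<equiv> spectral_proj H"

lemma H_diag: "(f, h) \<in> H \<Longrightarrow> Re (q f f) = Re (cinner f h)"
  using H_form H_domain by metis

text \<open>A vector P b x - P a x with a \<le> b would have form at most b |f|^2 by its spectral
  window and at least \<open>lower_bound\<close> |f|^2, so it is 0. Hence P is constant up to b and
  equal to its limit at -\<infinity>.\<close>

lemma P_below:
  assumes b: "b < lower_bound"
  shows "P b x = 0"
proof (rule tendsto_unique[OF _ _ resolved.at_bot])
  have "P a x = P b x" if ab: "a \<le> b" for a
  proof -
    define f where "f = P b x - P a x"
    have f: "P b f = f" "P a f = 0"
      using ab by (auto simp: f_def resolved.E_simps resolved.E_idem resolved.absorb resolved.absorb')
    obtain h where h: "(f, h) \<in> H" using resolved.window_domain[OF f] by blast
    have "lower_bound * (norm f)\<^sup>2 \<le> b * (norm f)\<^sup>2"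
      using lower_bound[OF H_domain[OF h]] H_diag[OF h] resolved.window_bounds(2)[OF f ab h] by simp
    then have "f = 0" using b by (simp add: mult_le_cancel_right)
    then show ?thesis by (simp add: f_def)
  qed
  then have "\<forall>\<^sub>F a in at_bot. P a x = P b x"
    unfolding eventually_at_bot_linorder by blast
  then show "((\<lambda>a. P a x) \<longlongrightarrow> P b x) at_bot" by (rule tendsto_eventually)
qed simp

lemma P_range_form:
  assumes f: "P t f = f"
  shows "f \<in> D" and "Re (q f f) \<le> t * (norm f)\<^sup>2" and "f \<in> Domain H"
proof -
  \<comment> \<open>Subtracting 1 puts a strictly below \<open>lower_bound\<close>, where P
    vanishes, and below t, so that f has a bounded spectral window.\<close>
  define a where "a = min t lower_bound - 1"
  have a: "P a f = 0" "a \<le> t" by (auto simp: a_def intro: P_below)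
  show fD: "f \<in> Domain H" by (rule resolved.window_domain[OF f a(1)])
  then obtain h where h: "(f, h) \<in> H" by blast
  show "f \<in> D" by (rule H_domain[OF h])
  show "Re (q f f) \<le> t * (norm f)\<^sup>2"
    unfolding H_diag[OF h] by (rule resolved.window_bounds(2)[OF f a h])
qed

text \<open>The diagonal integrals of g and k add up to that of g + k, so the cross term 2 Re (q k
  g) in the expansion of the form must vanish.\<close>

lemma form_orthogonal:
  assumes g: "P n g = g" and k: "P m k = k" "P n k = 0" and nm: "n \<le> m"
  shows "Re (q k g) = 0"
proof -
  define a where "a = min n lower_bound - 1"
  have a: "P a g = 0" "a \<le> n" by (auto simp: a_def intro: P_below)
  have gm: "P m g = g" using resolved.P_fixed_mono[OF g nm] .
  have sum: "P m (g + k) = g + k" using gm k by (simp add: resolved.E_simps)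
  have val: "Re (q v v) = (\<integral>t. t \<partial>resolved.M v)" if v: "P m v = v" for v
  proof -
    obtain h where "(v, h) \<in> H" using P_range_form(3)[OF v] by blast
    then show ?thesis using H_diag resolved.form by (simp add: spectral_measure_at_def)
  qed
  have D: "g \<in> D" "k \<in> D" using P_range_form(1) g k by blast+
  have "Re (q (g + k) (g + k)) = Re (q g g) + Re (q k k)"
    unfolding val[OF sum] val[OF gm] val[OF k(1)]
    by (rule resolved.integral_orthogonal_sum[OF g a(1) k a(2) nm])
  moreover have "Re (q (g + k) (g + k)) = Re (q g g) + Re (q k k) + 2 * Re (q k g)"
    using D hermitian[of g k] by (simp add: add_left add_right mem)
  ultimately show ?thesis by simp
qed

text \<open>\<open>P n f\<close> approximates \<open>f\<close> in the form norm, so the bound on the operator domain extends to the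
  form domain.\<close>

lemma form_lower_bound_of_P_zero:
  assumes f: "f \<in> D" and s: "P s f = 0"
  shows "s * (norm f)\<^sup>2 \<le> Re (q f f)"
proof -
  define N where "N n = max s (lower_bound) + real n" for n
  have lim: "(\<lambda>n. P (N n) f) \<longlonglongrightarrow> f"
    unfolding N_def
    by (intro filterlim_compose[OF resolved.at_top]
        filterlim_tendsto_add_at_top[OF tendsto_const] filterlim_real_sequentially)
  \<comment> \<open>Split f into g = P (N n) f and f - g. The cross term vanishes, g is bounded
    below by s on its window, and the remainder, bounded below by \<open>lower_bound\<close> only,
    is negligible in the limit.\<close>
  have step: "s * (norm (P (N n) f))\<^sup>2 + lower_bound * (norm (f - P (N n) f))\<^sup>2 \<le> Re (q f f)" for n
  proof -
    define g where "g = P (N n) f"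
    have g: "P (N n) g = g" "P s g = 0"
      using s resolved.absorb[of s "N n" f] by (auto simp: g_def resolved.E_idem N_def)
    have gD: "g \<in> D" by (rule P_range_form(1)[OF g(1)])
    obtain h where h: "(g, h) \<in> H" using P_range_form(3)[OF g(1)] by blast
    have d: "f - g \<in> D" by (rule mem(2)[OF f gD])
    \<comment> \<open>The form at (f - g, g) equals the pairing with h, which is continuous in the
      ambient norm. Hence f may be replaced by its spectral truncations, where
      \<open>form_orthogonal\<close> applies.\<close>
    have "(f - g) \<bullet> h = 0"
    proof (rule LIMSEQ_unique)
      show "(\<lambda>m. (P (N (n + m)) f - g) \<bullet> h) \<longlonglongrightarrow> (f - g) \<bullet> h"
        using LIMSEQ_ignore_initial_segment[OF lim, of n]
        by (intro tendsto_intros) (simp add: add.commute)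
      have "(P (N (n + m)) f - g) \<bullet> h = 0" for m
      proof -
        let ?k = "P (N (n + m)) f - g"
        have NN: "N n \<le> N (n + m)" by (simp add: N_def)
        have k: "P (N (n + m)) ?k = ?k" "P (N n) ?k = 0"
          using NN resolved.P_fixed_mono[OF g(1) NN]
          by (auto simp: g_def resolved.E_simps resolved.E_idem resolved.absorb)
        then show ?thesis
          using form_orthogonal[OF g(1) k NN] H_form[OF h P_range_form(1)[OF k(1)]]
          by (simp add: inner_eq_Re_cinner)
      qed
      then show "(\<lambda>m. (P (N (n + m)) f - g) \<bullet> h) \<longlonglongrightarrow> 0" by simp
    qed
    then have "Re (q (f - g) g) = 0" using H_form[OF h d] by (simp add: inner_eq_Re_cinner)
    then have "Re (q f f) = Re (q g g) + Re (q (f - g) (f - g))"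
      using add_left[OF d gD, of f] add_right[OF d d gD] add_right[OF gD d gD] hermitian[OF gD d] f
      by simp
    moreover have "s * (norm g)\<^sup>2 \<le> Re (q g g)"
      unfolding H_diag[OF h] by (rule resolved.window_bounds(1)[OF g _ h]) (simp add: N_def)
    ultimately show ?thesis using lower_bound[OF d] by (simp add: g_def)
  qed
  have "(\<lambda>n. s * (norm (P (N n) f))\<^sup>2 + lower_bound * (norm (f - P (N n) f))\<^sup>2)
      \<longlonglongrightarrow> s * (norm f)\<^sup>2 + lower_bound * (norm (f - f))\<^sup>2"
    by (intro tendsto_intros lim)
  then show ?thesis using LIMSEQ_le_const2 step by fastforce
qed

section \<open>Glazman's lemma and comparison of moments\<close>

lemma glazman_upper:
  assumes "dim_at_least (range (P t)) j"
  obtains B where "B \<subseteq> D" "finite B" "card B = j" "complex_vector.independent B"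
    "\<And>v. v \<in> complex_vector.span B \<Longrightarrow> Re (q v v) \<le> t * (norm v)\<^sup>2"
proof -
  obtain B where B: "B \<subseteq> range (P t)" "finite B" "card B = j" "complex_vector.independent B"
    using assms by (auto simp: dim_at_least_def)
  have fixed: "P t v = v" if "v \<in> range (P t)" for v using that resolved.E_idem by auto
  have "complex_vector.span B \<subseteq> range (P t)"
    using B(1) by (rule complex_vector.span_minimal[OF _ orth_projection_subspace[OF resolved.P_orth]])
  then have "Re (q v v) \<le> t * (norm v)\<^sup>2" if "v \<in> complex_vector.span B" for v
    using P_range_form(2)[OF fixed] that by blast
  moreover have "B \<subseteq> D" using P_range_form(1)[OF fixed] B(1) by blast
  ultimately show thesis using that B by blast
qed

text \<open>P s is injective on the span of B: a vector v in its kernel satisfies s |v|^2 \<le> q v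
  v \<le> t |v|^2, and t < s gives v = 0. The gap between t and s is needed since the lower bound on
  the kernel is not strict.\<close>

lemma glazman_lower:
  assumes B: "B \<subseteq> D" "finite B" "card B = j" "complex_vector.independent B"
    and q: "\<And>v. v \<in> complex_vector.span B \<Longrightarrow> Re (q v v) \<le> t * (norm v)\<^sup>2" and st: "t < s"
  shows "dim_at_least (range (P s)) j"
proof -
  interpret P: Vector_Spaces.linear scaleC scaleC "P s"
    using resolved.P_orth by (simp add: orth_projection_def)
  have sp: "complex_vector.span B \<subseteq> D"
    by (rule complex_vector.span_minimal[OF B(1) csubspace])
  have inj: "inj_on (P s) (complex_vector.span B)"
  proof (rule inj_onI)
    fix x y assume xy: "x \<in> complex_vector.span B" "y \<in> complex_vector.span B" "P s x = P s y"
    have v: "x - y \<in> complex_vector.span B" using xy by (simp add: complex_vector.span_diff)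
    have "s * (norm (x - y))\<^sup>2 \<le> t * (norm (x - y))\<^sup>2"
      using form_lower_bound_of_P_zero[of "x - y" s] q[OF v] v sp xy(3)
      by (auto simp: resolved.E_simps)
    then show "x = y" using st by (simp add: mult_le_cancel_right)
  qed
  have "complex_vector.independent (P s ` B)"
    by (rule P.independent_injective_image[OF B(4) inj])
  moreover have "card (P s ` B) = j"
    using card_image[OF inj_on_subset[OF inj complex_vector.span_superset]] B(3) by simp
  ultimately show ?thesis
    unfolding dim_at_least_def using B(2) by (intro exI[of _ "P s ` B"]) auto
qed

text \<open>Keeps the infimum in \<open>eigenvalue\<close> away from -\<infinity>, where
  \<open>real_of_ereal\<close> would not respect the order.\<close>

lemma dim_at_least_imp_lower_bound:
  assumes "dim_at_least (range (P t)) j" "0 < j"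
  shows "lower_bound \<le> t"
proof (rule ccontr)
  assume "\<not> lower_bound \<le> t"
  then have "P t x = 0" for x by (intro P_below) simp
  then have zero: "range (P t) \<subseteq> {0}" by auto
  obtain B where B: "B \<subseteq> range (P t)" "card B = j" "complex_vector.independent B"
    using assms(1) unfolding dim_at_least_def by blast
  obtain x where x: "x \<in> B" using B(2) assms(2) by fastforce
  have "x \<in> {0}" by (rule subsetD[OF subset_trans[OF B(1) zero] x])
  then have "0 \<in> B" using x by simp
  then show False using complex_vector.dependent_zero B(3) by blast
qed

end

text \<open>U carries a trial space for q' at level t to a trial space of the same dimension for q
  at the same level, so each eigenvalue for q lies below the one for q'. Levels t < 0 suffice
  because eigenvalues are cut off at 0; all of them being nonpositive, the order of absolute values
  is the reverse.\<close>

lemma moment_le: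
  fixes U :: "'b::{complex_inner,complete_space} \<Rightarrow> 'a::{complex_inner,complete_space}"
  assumes "closed_complex_form D q" "closed_complex_form D' q'"
    and U: "Vector_Spaces.linear scaleC scaleC U" "inj U" "\<And>v. v \<in> D' \<Longrightarrow> U v \<in> D"
    and q: "\<And>t v. t < 0 \<Longrightarrow> v \<in> D' \<Longrightarrow> Re (q' v v) \<le> t * (norm v)\<^sup>2 \<Longrightarrow>
      Re (q (U v) (U v)) \<le> t * (norm (U v))\<^sup>2"
    and \<gamma>: "\<gamma> > 0"
  shows "moment \<gamma> (form_operator D' q') \<le> moment \<gamma> (form_operator D q)"
proof -
  interpret A: closed_complex_form D q by fact
  interpret B: closed_complex_form D' q' by fact
  interpret U: Vector_Spaces.linear scaleC scaleC U by (rule U(1))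
  have "\<bar>eigenvalue B.H (Suc j)\<bar> \<le> \<bar>eigenvalue A.H (Suc j)\<bar>" for j
  proof -
    let ?SA = "{t. dim_at_least (range (A.P t)) (Suc j)}"
    let ?SB = "{t. dim_at_least (range (B.P t)) (Suc j)}"
    define a where "a = min 0 (INF t\<in>?SA. ereal t)"
    define b where "b = min 0 (INF t\<in>?SB. ereal t)"
    have "min 0 (ereal A.lower_bound) \<le> a"
      using A.dim_at_least_imp_lower_bound
      by (auto simp: a_def intro!: min.coboundedI2 INF_greatest)
    then have afin: "a \<noteq> - \<infinity>" by (cases "ereal A.lower_bound" "0::ereal" rule: linorder_cases) auto
    have "a \<le> ereal t" if t: "t < 0" "dim_at_least (range (B.P t)) (Suc j)" for t
    proof -
      obtain C where C: "C \<subseteq> D'" "finite C" "card C = Suc j" "complex_vector.independent C"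
        "\<And>v. v \<in> complex_vector.span C \<Longrightarrow> Re (q' v v) \<le> t * (norm v)\<^sup>2"
        using B.glazman_upper[OF t(2)] by blast
      have sp: "complex_vector.span C \<subseteq> D'"
        by (rule complex_vector.span_minimal[OF C(1) B.csubspace])
      have "dim_at_least (range (A.P s)) (Suc j)" if "t < s" for s
      proof (rule A.glazman_lower[of "U ` C", OF _ _ _ _ _ that])
        show "U ` C \<subseteq> D" using C(1) U(3) by blast
        show "card (U ` C) = Suc j" using C(3) card_image[OF inj_on_subset[OF U(2)]] by simp
        show "complex_vector.independent (U ` C)"
          by (rule U.independent_injective_image[OF C(4)]) (rule inj_on_subset[OF U(2)], simp)
        fix w assume "w \<in> complex_vector.span (U ` C)"
        then obtain v where v: "w = U v" "v \<in> complex_vector.span C" by (auto simp: U.span_image)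
        then show "Re (q w w) \<le> t * (norm w)\<^sup>2" using q[OF t(1) _ C(5)] sp by auto
      qed (simp add: C)
      then have "(INF t\<in>?SA. ereal t) \<le> ereal s" if "t < s" for s
        using that by (intro INF_lower) auto
      note le = this
      \<comment> \<open>The lower half of Glazman's lemma reaches only levels above t; the infimum
        closes this gap.\<close>
      have "(INF t\<in>?SA. ereal t) \<le> ereal t"
      proof (rule ereal_le_epsilon2)
        fix e :: real assume "0 < e"
        then show "(INF t\<in>?SA. ereal t) \<le> ereal t + ereal e" using le[of "t + e"] by simp
      qed
      then show ?thesis unfolding a_def by (rule min.coboundedI2)
    qed
    then have ab: "a \<le> b"
      unfolding b_def
    proof (intro min.boundedI INF_greatest)
      fix t assume *: "\<And>t. t < 0 \<Longrightarrow> dim_at_least (range (B.P t)) (Suc j) \<Longrightarrow> a \<le> ereal t" "t \<in> ?SB"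
      show "a \<le> ereal t"
      proof (cases "t < 0")
        case False
        have "a \<le> 0" by (simp add: a_def)
        also have "0 \<le> ereal t" using False by simp
        finally show ?thesis .
      qed (use * in simp)
    qed (simp add: a_def)
    have "b \<le> 0" by (simp add: b_def)
    then obtain a' b' where "a = ereal a'" "b = ereal b'" "a' \<le> b'" "b' \<le> 0"
      using ab afin by (cases a; cases b) auto
    then show ?thesis unfolding eigenvalue_def a_def[symmetric] b_def[symmetric] by simp
  qed
  then show ?thesis
    unfolding moment_def using \<gamma>
    by (intro suminf_le summableI ennreal_leI powr_mono2) auto
qed

section \<open>The space of square integrable functions\<close>

lemma rep_L2: "square_integrable (rep_L2 F)"
  using Quotient_rep_reflp[OF Quotient_L2, of F] by (simp add: L2_rel_def)

lemma rep_abs_L2: "square_integrable f \<Longrightarrow> AE x in lebesgue. rep_L2 (abs_L2 f) x = f x"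
  using Quotient_rep_abs[OF Quotient_L2, of f] by (simp add: L2_rel_def)

lemma rep_L2_measurable [measurable]: "rep_L2 F \<in> borel_measurable lebesgue"
  and rep_L2_integrable: "integrable lebesgue (\<lambda>x. (cmod (rep_L2 F x))\<^sup>2)"
  using rep_L2[of F] by (auto simp: square_integrable_def)

lemma L2_eqI:
  assumes "AE x in lebesgue. rep_L2 F x = rep_L2 G x"
  shows "F = G"
proof -
  have "L2_rel (rep_L2 F) (rep_L2 G)" using assms by (simp add: L2_rel_def rep_L2)
  then show ?thesis by (rule Quotient_rel_rep[OF Quotient_L2, THEN iffD1])
qed

lemma rep_add_L2: "AE x in lebesgue. rep_L2 (F + G) x = rep_L2 F x + rep_L2 G x"
proof -
  have "F + G = abs_L2 (\<lambda>x. rep_L2 F x + rep_L2 G x)" by (simp add: plus_L2_def)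
  then show ?thesis using rep_abs_L2[OF square_integrable_add[OF rep_L2 rep_L2]] by simp
qed

lemma rep_scaleC_L2: "AE x in lebesgue. rep_L2 (c *\<^sub>C F) x = c * rep_L2 F x"
proof -
  have "c *\<^sub>C F = abs_L2 (\<lambda>x. c * rep_L2 F x)" by (simp add: scaleC_L2_def)
  then show ?thesis using rep_abs_L2[OF square_integrable_scale[OF rep_L2]] by simp
qed

lemma rep_diff_L2: "AE x in lebesgue. rep_L2 (F - G) x = rep_L2 F x - rep_L2 G x"
  using rep_add_L2[of F "(- 1) *\<^sub>C G"] rep_scaleC_L2[of "- 1" G]
  by eventually_elim (simp add: scaleC_minus_one)

lemma cinner_L2_eq: "cinner F G = (\<integral>x. cnj (rep_L2 F x) * rep_L2 G x \<partial>lebesgue)"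
  by (simp add: cinner_L2_def)

lemma norm_L2_square: "(norm F)\<^sup>2 = (\<integral>x. (cmod (rep_L2 F x))\<^sup>2 \<partial>lebesgue)"
proof -
  have "complex_of_real ((norm F)\<^sup>2) = (\<integral>x. complex_of_real ((cmod (rep_L2 F x))\<^sup>2) \<partial>lebesgue)"
    unfolding cinner_self[symmetric] cinner_L2_eq
    by (simp only: complex_norm_square mult.commute)
  then show ?thesis by (simp only: integral_complex_of_real of_real_eq_iff)
qed

lemma nn_integral_rep_L2:
  "(\<integral>\<^sup>+x. ennreal ((cmod (rep_L2 F x))\<^sup>2) \<partial>lebesgue) = ennreal ((norm F)\<^sup>2)"
  by (simp add: norm_L2_square nn_integral_eq_integral[OF rep_L2_integrable])

text \<open>The rate (1/4)^k lets the squared increments be weighted by 2^k and still have a finite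
  total integral. Hence the weighted sum is finite almost everywhere, and this makes the increments
  themselves absolutely summable there.\<close>

lemma L2_Cauchy_subsequence_limit:
  fixes Y :: "nat \<Rightarrow> 'n::finite L2"
  assumes Y: "\<And>k. norm (Y (Suc k) - Y k) \<le> (1/4) ^ k"
  shows "\<exists>f. f \<in> borel_measurable lebesgue \<and> (AE x in lebesgue. (\<lambda>k. rep_L2 (Y k) x) \<longlonglongrightarrow> f x)"
proof -
  let ?f = "\<lambda>k. rep_L2 (Y k)"
  let ?d = "\<lambda>k x. rep_L2 (Y (Suc k) - Y k) x"
  have "(\<integral>\<^sup>+x. (\<Sum>k. ennreal (2 ^ k * (cmod (?d k x))\<^sup>2)) \<partial>lebesgue)
      = (\<Sum>k. \<integral>\<^sup>+x. ennreal (2 ^ k * (cmod (?d k x))\<^sup>2) \<partial>lebesgue)"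
    by (rule nn_integral_suminf) measurable
  also have "\<dots> \<le> (\<Sum>k. ennreal ((1/2) ^ k))"
  proof (intro suminf_le summableI)
    fix k
    have "(\<integral>\<^sup>+x. ennreal (2 ^ k * (cmod (?d k x))\<^sup>2) \<partial>lebesgue)
        = ennreal (2 ^ k) * ennreal ((norm (Y (Suc k) - Y k))\<^sup>2)"
      by (simp add: ennreal_mult nn_integral_cmult nn_integral_rep_L2)
    also have "\<dots> = ennreal (2 ^ k * (norm (Y (Suc k) - Y k))\<^sup>2)"
      by (simp add: ennreal_mult)
    also have "\<dots> \<le> ennreal ((1/2) ^ k)"
    proof (rule ennreal_leI)
      have "(norm (Y (Suc k) - Y k))\<^sup>2 \<le> ((1/4) ^ k)\<^sup>2" by (intro power_mono Y) simp
      also have "\<dots> \<le> (1/4) ^ k"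
        by (simp add: power2_eq_square mult_left_le power_le_one)
      finally have "2 ^ k * (norm (Y (Suc k) - Y k))\<^sup>2 \<le> 2 ^ k * (1/4) ^ k" by (intro mult_left_mono) auto
      also have "(2::real) ^ k * (1/4) ^ k = (1/2) ^ k" by (simp flip: power_mult_distrib)
      finally show "2 ^ k * (norm (Y (Suc k) - Y k))\<^sup>2 \<le> (1/2) ^ k" .
    qed
    finally show "(\<integral>\<^sup>+x. ennreal (2 ^ k * (cmod (?d k x))\<^sup>2) \<partial>lebesgue) \<le> ennreal ((1/2) ^ k)" .
  qed
  also have "\<dots> < \<infinity>" by (simp add: suminf_ennreal_eq[OF _ geometric_sums])
  finally have "(\<integral>\<^sup>+x. (\<Sum>k. ennreal (2 ^ k * (cmod (?d k x))\<^sup>2)) \<partial>lebesgue) \<noteq> \<infinity>" by simp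
  then have "AE x in lebesgue. (\<Sum>k. ennreal (2 ^ k * (cmod (?d k x))\<^sup>2)) \<noteq> \<infinity>"
    by (intro nn_integral_PInf_AE) measurable
  moreover have "AE x in lebesgue. \<forall>k. ?d k x = ?f (Suc k) x - ?f k x"
    unfolding AE_all_countable by (intro allI rep_diff_L2)
  ultimately have conv: "AE x in lebesgue. convergent (\<lambda>k. ?f k x)"
  proof eventually_elim
    case (elim x)
    have s1: "summable (\<lambda>k. 2 ^ k * (cmod (?d k x))\<^sup>2)"
      by (rule summable_suminf_not_top) (use elim in auto)
    have s2: "summable (\<lambda>k. (1/2 :: real) ^ k)" by (simp add: summable_geometric)
    have "summable (\<lambda>k. ?d k x)"
    proof (rule summable_comparison_test')
      show "summable (\<lambda>k. (1/2) ^ k + 2 ^ k * (cmod (?d k x))\<^sup>2)" by (rule summable_add[OF s2 s1])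
      fix k
      define e where "e = (1/2 :: real) ^ k"
      have e: "e > 0" "2 ^ k = 1 / e" by (simp_all add: e_def power_one_over)
      define a where "a = cmod (?d k x)"
      \<comment> \<open>The elementary inequality a \<le> e + a^2 / e with e = (1/2)^k passes from
        weighted squares to the increments.\<close>
      have "0 \<le> (e - a)\<^sup>2 + a * e" using e by (simp add: a_def)
      then have "a * e \<le> e * e + a\<^sup>2" by (simp add: power2_eq_square algebra_simps)
      then have "a \<le> e + a\<^sup>2 / e" using e(1) by (simp add: field_simps)
      then show "norm (?d k x) \<le> (1/2) ^ k + 2 ^ k * (cmod (?d k x))\<^sup>2"
        unfolding e(2) by (simp add: a_def e_def)
    qed
    then have "(\<lambda>n. \<Sum>k<n. ?f (Suc k) x - ?f k x) \<longlonglongrightarrow> (\<Sum>k. ?d k x)"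
      using elim summable_LIMSEQ by fastforce
    then have "(\<lambda>n. ?f n x - ?f 0 x) \<longlonglongrightarrow> (\<Sum>k. ?d k x)" 
      by (simp only: sum_lessThan_telescope[of "\<lambda>k. ?f k x"])
    from tendsto_add[OF this tendsto_const[of "?f 0 x"]]
    show ?case by (auto simp: convergent_def)
  qed
  show ?thesis
  proof (intro exI conjI)
    show "(\<lambda>x. lim (\<lambda>k. ?f k x)) \<in> borel_measurable lebesgue"
      by (rule borel_measurable_lim_metric) measurable
    show "AE x in lebesgue. (\<lambda>k. ?f k x) \<longlonglongrightarrow> lim (\<lambda>k. ?f k x)"
      using conv by eventually_elim (simp add: convergent_LIMSEQ_iff)
  qed
qed

text \<open>The Riesz-Fischer argument: a fast subsequence converges almost everywhere, and Fatou's
  lemma bounds the distance of its pointwise limit to X n, which gives both square integrability and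
  convergence.\<close>

instance L2 :: (finite) complete_space
proof
  fix X :: "nat \<Rightarrow> 'a L2"
  assume C: "Cauchy X"
  have "\<exists>N. \<forall>m\<ge>N. \<forall>n\<ge>N. norm (X m - X n) < (1/4) ^ k" for k
    using CauchyD[OF C, of "(1/4) ^ k"] by simp
  then obtain N where N: "\<And>k m n. m \<ge> N k \<Longrightarrow> n \<ge> N k \<Longrightarrow> norm (X m - X n) < (1/4) ^ k" by metis
  \<comment> \<open>Summing the N i makes r exceed every N k, and adding k makes it strictly
    increasing.\<close>
  define r where "r k = (\<Sum>i\<le>k. N i) + k" for k
  have rN: "N k \<le> r k" for k using member_le_sum[of k "{..k}" N] by (simp add: r_def)
  have rmono: "strict_mono r" by (rule strict_monoI_Suc) (simp add: r_def)
  define Y where "Y k = X (r k)" for k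
  have "norm (Y (Suc k) - Y k) \<le> (1/4) ^ k" for k
    using N[of k "r (Suc k)" "r k"] rN[of k] strict_monoD[OF rmono, of k "Suc k"] by (simp add: Y_def)
  from L2_Cauchy_subsequence_limit[OF this] obtain f where
    f: "f \<in> borel_measurable lebesgue" "AE x in lebesgue. (\<lambda>k. rep_L2 (Y k) x) \<longlonglongrightarrow> f x" by blast
  note [measurable] = f(1)
  have fatou: "(\<integral>\<^sup>+x. ennreal ((cmod (f x - rep_L2 (X n) x))\<^sup>2) \<partial>lebesgue) \<le> ennreal ((e)\<^sup>2)"
    if e: "\<And>m. m \<ge> M \<Longrightarrow> norm (X m - X n) \<le> e" for n M e
  proof -
    have "AE x in lebesgue. \<forall>k. rep_L2 (Y k - X n) x = rep_L2 (Y k) x - rep_L2 (X n) x"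
      unfolding AE_all_countable by (intro allI rep_diff_L2)
    with f(2) have "AE x in lebesgue. ennreal ((cmod (f x - rep_L2 (X n) x))\<^sup>2)
        = liminf (\<lambda>k. ennreal ((cmod (rep_L2 (Y k - X n) x))\<^sup>2))"
    proof eventually_elim
      case (elim x)
      have "(\<lambda>k. ennreal ((cmod (rep_L2 (Y k) x - rep_L2 (X n) x))\<^sup>2))
          \<longlonglongrightarrow> ennreal ((cmod (f x - rep_L2 (X n) x))\<^sup>2)"
        by (intro tendsto_intros elim(1))
      from lim_imp_Liminf[OF _ this] show ?case using elim(2) by simp
    qed
    then have "(\<integral>\<^sup>+x. ennreal ((cmod (f x - rep_L2 (X n) x))\<^sup>2) \<partial>lebesgue)
        = (\<integral>\<^sup>+x. liminf (\<lambda>k. ennreal ((cmod (rep_L2 (Y k - X n) x))\<^sup>2)) \<partial>lebesgue)"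
      by (rule nn_integral_cong_AE)
    also have "\<dots> \<le> liminf (\<lambda>k. \<integral>\<^sup>+x. ennreal ((cmod (rep_L2 (Y k - X n) x))\<^sup>2) \<partial>lebesgue)"
      by (rule nn_integral_liminf) measurable
    also have "\<dots> = liminf (\<lambda>k. ennreal ((norm (Y k - X n))\<^sup>2))" by (simp only: nn_integral_rep_L2)
    also have "\<dots> \<le> ennreal (e\<^sup>2)"
    proof -
      have "\<forall>\<^sub>F k in sequentially. ennreal ((norm (Y k - X n))\<^sup>2) \<le> ennreal (e\<^sup>2)"
        using eventually_ge_at_top[of M]
      proof eventually_elim
        case (elim k)
        then have "M \<le> r k" using seq_suble[OF rmono, of k] by simp
        then show ?case by (intro ennreal_leI power_mono) (simp_all add: Y_def e)
      qed
      then have "liminf (\<lambda>k. ennreal ((norm (Y k - X n))\<^sup>2)) \<le> liminf (\<lambda>k::nat. ennreal (e\<^sup>2))"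
        by (rule Liminf_mono)
      then show ?thesis by (simp add: Liminf_const)
    qed
    finally show ?thesis .
  qed
  have diff: "square_integrable (\<lambda>x. f x - rep_L2 (X n) x)"
    if "\<And>m. m \<ge> M \<Longrightarrow> norm (X m - X n) \<le> e" for n M e
    unfolding square_integrable_def
  proof
    show "integrable lebesgue (\<lambda>x. (cmod (f x - rep_L2 (X n) x))\<^sup>2)"
      by (rule integrableI_nonneg) (use le_less_trans[OF fatou[OF that]] in simp_all)
  qed measurable
  have sq: "square_integrable f"
  proof -
    have "norm (X m - X (N 0)) \<le> 1" if "m \<ge> N 0" for m using N[of 0 m "N 0"] that by simp
    from square_integrable_add[OF diff[OF this] rep_L2[of "X (N 0)"]] show ?thesis by simp
  qed
  have "X \<longlonglongrightarrow> abs_L2 f"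
  proof (rule metric_LIMSEQ_I)
    fix e :: real assume "0 < e"
    then obtain K where K: "\<And>m n. m \<ge> K \<Longrightarrow> n \<ge> K \<Longrightarrow> norm (X m - X n) < e / 2"
      using CauchyD[OF C, of "e / 2"] by auto
    have "dist (X n) (abs_L2 f) < e" if n: "n \<ge> K" for n
    proof -
      have le: "\<And>m. m \<ge> K \<Longrightarrow> norm (X m - X n) \<le> e / 2" using K n by (simp add: less_imp_le)
      have "AE x in lebesgue. (cmod (rep_L2 (abs_L2 f - X n) x))\<^sup>2 = (cmod (f x - rep_L2 (X n) x))\<^sup>2"
        using rep_diff_L2[of "abs_L2 f" "X n"] rep_abs_L2[OF sq] by eventually_elim simp
      then have "ennreal ((norm (abs_L2 f - X n))\<^sup>2)
          = (\<integral>\<^sup>+x. ennreal ((cmod (f x - rep_L2 (X n) x))\<^sup>2) \<partial>lebesgue)"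
        unfolding nn_integral_rep_L2[symmetric] by (intro nn_integral_cong_AE) auto
      also have "\<dots> \<le> ennreal ((e / 2)\<^sup>2)" by (rule fatou[OF le])
      finally have "(norm (abs_L2 f - X n))\<^sup>2 \<le> (e / 2)\<^sup>2" by (simp add: ennreal_le_iff)
      then have "norm (abs_L2 f - X n) \<le> e / 2" by (rule power2_le_imp_le) (use \<open>0 < e\<close> in simp)
      then show ?thesis using \<open>0 < e\<close> by (simp add: dist_norm norm_minus_commute)
    qed
    then show "\<exists>K. \<forall>n\<ge>K. dist (X n) (abs_L2 f) < e" by blast
  qed
  then show "convergent X" by (auto simp: convergent_def)
qed

section \<open>Smooth approximations of indicator functions\<close>

text \<open>The family is indexed by polynomials because it is then closed under differentiation,
  with all derivatives at 0 equal to 0.\<close>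

definition bump :: "real poly \<Rightarrow> real \<Rightarrow> real" where
  "bump p x = (if 0 < x then poly p (1 / x) * exp (- (1 / x)) else 0)"

lemma tendsto_poly_div_exp_0: "((\<lambda>x::real. poly p x * exp (- x)) \<longlongrightarrow> 0) at_top"
proof -
  have "((\<lambda>x::real. \<Sum>i\<le>degree p. coeff p i * (x ^ i / exp x)) \<longlongrightarrow> (\<Sum>i\<le>degree p. coeff p i * 0)) at_top"
    by (intro tendsto_intros tendsto_power_div_exp_0)
  then show ?thesis
    by (simp add: poly_altdef sum_distrib_right exp_minus divide_inverse mult.assoc)
qed

lemma bump_tendsto_0: "(bump p \<longlongrightarrow> 0) (at 0)"
proof -
  have "((\<lambda>x. poly p (1 / x) * exp (- (1 / x))) \<longlongrightarrow> 0) (at_right 0)"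
    using filterlim_compose[OF tendsto_poly_div_exp_0 filterlim_inverse_at_top_right]
    by (simp add: inverse_eq_divide)
  then have r: "(bump p \<longlongrightarrow> 0) (at_right 0)"
    by (rule Lim_transform_eventually)
       (auto simp: eventually_at_right_field bump_def intro!: exI[of _ 1])
  have l: "(bump p \<longlongrightarrow> 0) (at_left 0)"
    by (rule tendsto_eventually) (auto simp: eventually_at_left_field bump_def intro!: exI[of _ "- 1"])
  show "(bump p \<longlongrightarrow> 0) (at 0)" using l r by (rule filterlim_split_at)
qed

text \<open>For x > 0 differentiation replaces p by p - p' and produces a factor 1 / x^2, which is
  the polynomial \<open>[:0, 0, 1:]\<close> evaluated at 1 / x.\<close>

lemma bump_derivative:
  "(bump p has_real_derivative bump ([:0, 0, 1:] * (p - pderiv p)) x) (at x)"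
proof (cases x "0 :: real" rule: linorder_cases)
  case less
  have "((\<lambda>x. 0) has_real_derivative 0) (at x)" by simp
  then have "(bump p has_real_derivative 0) (at x)"
    by (rule has_field_derivative_transform_within_open[where S = "{..<0}"])
       (use less in \<open>auto simp: bump_def\<close>)
  then show ?thesis using less by (simp add: bump_def)
next
  case equal
  \<comment> \<open>The difference quotient at 0 divides by h, which multiplies the polynomial by
    its variable; it is again a bump.\<close>
  have "((\<lambda>h. bump ([:0, 1:] * p) h) \<longlongrightarrow> 0) (at 0)" by (rule bump_tendsto_0)
  then have "((\<lambda>h. (bump p (0 + h) - bump p 0) / h) \<longlongrightarrow> 0) (at 0)"
    by (rule Lim_transform_eventually)
       (auto simp: bump_def eventually_at_filter)
  then show ?thesis using equal by (simp add: DERIV_def bump_def)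
next
  case greater
  have "((\<lambda>x. poly p (1 / x) * exp (- (1 / x))) has_real_derivative
      poly p (1 / x) * (exp (- (1 / x)) * (1 / x\<^sup>2)) + poly (pderiv p) (1 / x) * (- (1 / x\<^sup>2)) * exp (- (1 / x))) (at x)"
    using greater
    by (auto intro!: derivative_eq_intros DERIV_chain2[OF poly_DERIV] simp: power2_eq_square divide_simps)
  then have "(bump p has_real_derivative
      poly p (1 / x) * (exp (- (1 / x)) * (1 / x\<^sup>2)) + poly (pderiv p) (1 / x) * (- (1 / x\<^sup>2)) * exp (- (1 / x))) (at x)"
    by (rule has_field_derivative_transform_within_open[where S = "{0<..}"])
       (use greater in \<open>auto simp: bump_def\<close>)
  then show ?thesis using greater by (simp add: bump_def algebra_simps power2_eq_square)
qed

text \<open>A class of differentiable functions stable under all partial derivatives, so that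
  smoothness in the sense of \<open>test_function\<close> follows by induction on the list of
  indices.\<close>

inductive_set bump_algebra :: "(real ^ 'n::finite \<Rightarrow> real) set" where
  const: "(\<lambda>x. k) \<in> bump_algebra"
| bump: "(\<lambda>x. bump p (\<alpha> * x $ i + \<gamma>)) \<in> bump_algebra"
| add: "f \<in> bump_algebra \<Longrightarrow> g \<in> bump_algebra \<Longrightarrow> (\<lambda>x. f x + g x) \<in> bump_algebra"
| mult: "f \<in> bump_algebra \<Longrightarrow> g \<in> bump_algebra \<Longrightarrow> (\<lambda>x. f x * g x) \<in> bump_algebra"

lemma partial_eq: "(f has_derivative f') (at x) \<Longrightarrow> partial j f x = f' (axis j 1)"
  unfolding partial_def by (drule frechet_derivative_at) simp

lemma bump_algebra_smooth:
  fixes f :: "real ^ 'n::finite \<Rightarrow> real"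
  assumes "f \<in> bump_algebra"
  shows "f differentiable (at x)" and "partial j f \<in> bump_algebra"
proof -
  have "(\<forall>x. f differentiable (at x)) \<and> (\<forall>j. partial j f \<in> bump_algebra)"
    using assms
  proof (induction f rule: bump_algebra.induct)
    case (const k)
    have eq: "partial j (\<lambda>x. k) = (\<lambda>x::real^'n. 0)" for j
      by (rule ext) (rule partial_eq[OF has_derivative_const])
    have "partial j (\<lambda>x. k) \<in> (bump_algebra :: (real^'n \<Rightarrow> real) set)" for j
      by (subst eq) (rule bump_algebra.const)
    then show ?case by simp
  next
    case (bump p \<alpha> i \<gamma>)
    let ?q = "[:0, 0, 1:] * (p - pderiv p)"
    have "((\<lambda>x::real^'n. \<alpha> * x $ i + \<gamma>) has_derivative (\<lambda>h. \<alpha> * h $ i)) (at x)" for x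
      by (auto intro!: derivative_eq_intros bounded_linear_imp_has_derivative bounded_linear_vec_nth)
    from has_derivative_compose[OF this bump_derivative[unfolded has_field_derivative_def]]
    have d: "((\<lambda>x::real^'n. bump p (\<alpha> * x $ i + \<gamma>)) has_derivative
       (\<lambda>h. bump ?q (\<alpha> * x $ i + \<gamma>) * (\<alpha> * h $ i))) (at x)" for x .
    have "partial j (\<lambda>x::real^'n. bump p (\<alpha> * x $ i + \<gamma>))
        = (\<lambda>x. bump ?q (\<alpha> * x $ i + \<gamma>) * (\<alpha> * axis j 1 $ i))" for j
      by (rule ext) (rule partial_eq[OF d])
    then show ?case
      using d by (auto simp: differentiable_def intro!: bump_algebra.intros)
  next
    case (add f g)
    have df: "(f has_derivative frechet_derivative f (at x)) (at x)"
      and dg: "(g has_derivative frechet_derivative g (at x)) (at x)" for x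
      using add by (auto simp: frechet_derivative_works)
    have "partial j (\<lambda>x. f x + g x) = (\<lambda>x. partial j f x + partial j g x)" for j
      by (rule ext) (simp add: partial_eq[OF has_derivative_add[OF df dg]] partial_def)
    then show ?case using add by (auto intro: bump_algebra.intros)
  next
    case (mult f g)
    have df: "(f has_derivative frechet_derivative f (at x)) (at x)"
      and dg: "(g has_derivative frechet_derivative g (at x)) (at x)" for x
      using mult by (auto simp: frechet_derivative_works)
    have "partial j (\<lambda>x. f x * g x) = (\<lambda>x. f x * partial j g x + partial j f x * g x)" for j
      by (rule ext) (simp add: partial_eq[OF has_derivative_mult[OF df dg]] partial_def)
    moreover have "(\<lambda>x. f x * partial j g x + partial j f x * g x) \<in> bump_algebra" for j
      by (rule bump_algebra.add; rule bump_algebra.mult) (use mult in auto)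
    ultimately show ?case using mult by auto
  qed
  then show "f differentiable (at x)" "partial j f \<in> bump_algebra" by blast+
qed

lemma bump_algebra_foldr: "f \<in> bump_algebra \<Longrightarrow> foldr partial is f \<in> bump_algebra"
  by (induction "is") (auto intro: bump_algebra_smooth)

lemma bump_algebra_prod:
  "finite I \<Longrightarrow> (\<And>i. i \<in> I \<Longrightarrow> f i \<in> bump_algebra) \<Longrightarrow> (\<lambda>x. \<Prod>i\<in>I. f i x) \<in> bump_algebra"
  by (induction I rule: finite_induct) (auto intro: bump_algebra.intros)

text \<open>Each factor tends to 1 where its argument is positive and vanishes elsewhere, so for
  large m the product approximates the indicator of the open box from below.\<close>

definition box_bump :: "real ^ 'n::finite \<Rightarrow> real ^ 'n \<Rightarrow> nat \<Rightarrow> real ^ 'n \<Rightarrow> real" where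
  "box_bump a b m x = (\<Prod>i\<in>UNIV. bump 1 (real m * (x $ i - a $ i)) * bump 1 (real m * (b $ i - x $ i)))"

lemma box_bump_bump_algebra: "box_bump a b m \<in> bump_algebra"
proof -
  have "(\<lambda>x. bump 1 (real m * x $ i + (- real m * a $ i)) * bump 1 (- real m * x $ i + real m * b $ i))
      \<in> bump_algebra" for i
    by (intro bump_algebra.intros)
  then have "(\<lambda>x. \<Prod>i\<in>UNIV. bump 1 (real m * x $ i + (- real m * a $ i)) *
      bump 1 (- real m * x $ i + real m * b $ i)) \<in> bump_algebra"
    by (intro bump_algebra_prod) auto
  also have "(\<lambda>x. \<Prod>i\<in>UNIV. bump 1 (real m * x $ i + (- real m * a $ i)) *
      bump 1 (- real m * x $ i + real m * b $ i)) = box_bump a b m"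
    by (rule ext) (simp add: box_bump_def algebra_simps)
  finally show ?thesis .
qed

lemma bump_1_bounds: "0 \<le> bump 1 x" "bump 1 x \<le> 1"
  by (auto simp: bump_def)

lemma box_bump_bounds: "0 \<le> box_bump a b m x" "box_bump a b m x \<le> 1"
  unfolding box_bump_def
  by (auto intro!: prod_nonneg prod_le_1 mult_nonneg_nonneg mult_le_one bump_1_bounds)

lemma box_bump_outside:
  assumes "x \<notin> box a b"
  shows "box_bump a b m x = 0"
proof -
  obtain i where "x $ i \<le> a $ i \<or> b $ i \<le> x $ i"
    using assms by (auto simp: mem_box_cart not_less)
  then have "bump 1 (real m * (x $ i - a $ i)) * bump 1 (real m * (b $ i - x $ i)) = 0"
    by (auto simp: bump_def mult_nonneg_nonpos not_less zero_less_mult_iff)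
  then show ?thesis unfolding box_bump_def by (intro prod_zero) auto
qed

lemma test_function_box_bump: "test_function (box_bump a b m)"
  unfolding test_function_def
proof
  show "\<forall>is x. foldr partial is (box_bump a b m) differentiable at x"
    using bump_algebra_smooth(1)[OF bump_algebra_foldr[OF box_bump_bump_algebra]] by blast
  have "{x. box_bump a b m x \<noteq> 0} \<subseteq> box a b" using box_bump_outside by blast
  then have "bounded {x. box_bump a b m x \<noteq> 0}" using bounded_box bounded_subset by blast
  then show "compact (closure {x. box_bump a b m x \<noteq> 0})" by (simp add: compact_closure)
qed

lemma bump_1_tendsto: "0 < s \<Longrightarrow> (\<lambda>m. bump 1 (real m * s)) \<longlonglongrightarrow> 1"
proof -
  assume s: "0 < s"
  have "(\<lambda>m. exp (- (inverse (real m) * (1 / s)))) \<longlonglongrightarrow> exp (- (0 * (1 / s)))"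
    by (intro tendsto_intros lim_inverse_n)
  then have "(\<lambda>m. exp (- (inverse (real m) * (1 / s)))) \<longlonglongrightarrow> 1" by simp
  moreover have "\<forall>\<^sub>F m in sequentially. exp (- (inverse (real m) * (1 / s))) = bump 1 (real m * s)"
    using eventually_gt_at_top[of 0]
    by eventually_elim (use s in \<open>simp add: bump_def field_simps\<close>)
  ultimately show ?thesis by (rule Lim_transform_eventually)
qed

lemma box_bump_tendsto: "(\<lambda>m. box_bump a b m x) \<longlonglongrightarrow> indicator (box a b) x"
proof (cases "x \<in> box a b")
  case True
  then have "(\<lambda>m. \<Prod>i\<in>UNIV. bump 1 (real m * (x $ i - a $ i)) * bump 1 (real m * (b $ i - x $ i)))
      \<longlonglongrightarrow> (\<Prod>i\<in>(UNIV::'a set). 1 * 1)"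
    by (intro tendsto_prod tendsto_mult bump_1_tendsto) (auto simp: mem_box_cart)
  then show ?thesis using True by (simp add: box_bump_def)
qed (simp add: box_bump_outside)

section \<open>Continuity and support of test functions\<close>

lemma test_function_differentiable: "test_function \<phi> \<Longrightarrow> \<phi> differentiable (at x)"
  unfolding test_function_def by (metis foldr.simps(1) id_apply)

lemma test_function_partial_differentiable: "test_function \<phi> \<Longrightarrow> partial i \<phi> differentiable (at x)"
proof -
  assume "test_function \<phi>"
  then have "foldr partial [i] \<phi> differentiable (at x)" unfolding test_function_def by blast
  then show ?thesis by simp
qed

lemma continuous_on_differentiable_at: "(\<And>x. f differentiable (at x)) \<Longrightarrow> continuous_on UNIV f"
  by (simp add: continuous_on_eq_continuous_within differentiable_imp_continuous_within)

lemma test_function_continuous: "test_function \<phi> \<Longrightarrow> continuous_on UNIV \<phi>"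
  and test_function_partial_continuous: "test_function \<phi> \<Longrightarrow> continuous_on UNIV (partial i \<phi>)"
  by (auto intro: continuous_on_differentiable_at test_function_differentiable
      test_function_partial_differentiable)

lemma test_function_support:
  assumes "test_function \<phi>"
  obtains r where "\<And>x. r \<le> norm x \<Longrightarrow> \<phi> x = 0"
proof -
  have "bounded {x. \<phi> x \<noteq> 0}"
    using assms unfolding test_function_def by (metis bounded_subset closure_subset compact_imp_bounded)
  then obtain r where "\<And>x. \<phi> x \<noteq> 0 \<Longrightarrow> norm x \<le> r" by (auto simp: bounded_iff)
  \<comment> \<open>Passing to r + 1 includes the sphere of that radius in the region where the
    function vanishes.\<close>
  then show thesis by (intro that[of "r + 1"]) force
qed

lemma partial_eq_0_outside:
  assumes "\<And>x. r \<le> norm x \<Longrightarrow> \<phi> x = 0" "r < norm x"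
  shows "partial i \<phi> x = 0"
proof -
  have "(\<phi> has_derivative (\<lambda>h. 0)) (at x)"
    by (rule has_derivative_transform_within_open[OF has_derivative_const[of 0], where s = "{x. r < norm x}"])
       (use assms in \<open>auto simp: open_Collect_less continuous_on_norm_id intro: open_Collect_less continuous_intros\<close>)
  then show ?thesis by (simp add: partial_eq)
qed

lemma continuous_on_UNIV_lebesgue_measurable:
  fixes f :: "real ^ 'n::finite \<Rightarrow> 'b::topological_space"
  assumes "continuous_on UNIV f"
  shows "f \<in> borel_measurable lebesgue"
proof -
  have "f \<in> borel_measurable lborel" using borel_measurable_continuous_onI[OF assms] by simp
  then show ?thesis by (rule measurable_completion)
qed

lemma locally_integrable_mult_continuous:
  fixes g :: "real ^ 'n::finite \<Rightarrow> 'b::{banach, second_countable_topology}"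
  assumes g: "locally_integrable g" and c: "continuous_on UNIV c" and s: "\<And>x. r < norm x \<Longrightarrow> c x = 0"
  shows "integrable lebesgue (\<lambda>x. c x *\<^sub>R g x)"
proof -
  have "compact (c ` cball 0 r)"
    using c by (intro compact_continuous_image) (auto intro: continuous_on_subset)
  then obtain B where B: "\<And>x. x \<in> cball 0 r \<Longrightarrow> \<bar>c x\<bar> \<le> B"
    using compact_imp_bounded by (force simp: bounded_iff)
  have si: "integrable lebesgue (\<lambda>x. indicator (cball 0 r) x *\<^sub>R g x)"
    using g by (auto simp: locally_integrable_def set_integrable_def)
  have c': "c \<in> borel_measurable lebesgue"
    by (rule continuous_on_UNIV_lebesgue_measurable[OF c])
  have "integrable lebesgue (\<lambda>x. c x *\<^sub>R (indicator (cball 0 r) x *\<^sub>R g x))"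
  proof (rule Bochner_Integration.integrable_bound)
    show "integrable lebesgue (\<lambda>x. B *\<^sub>R (indicator (cball 0 r) x *\<^sub>R g x))"
      by (rule integrable_scaleR_right) (rule si)
    show "(\<lambda>x. c x *\<^sub>R (indicator (cball 0 r) x *\<^sub>R g x)) \<in> borel_measurable lebesgue"
      using c' borel_measurable_integrable[OF si] by (rule borel_measurable_scaleR)
    have "\<bar>c x\<bar> * norm (g x) \<le> \<bar>B\<bar> * norm (g x)" if "x \<in> cball 0 r" for x
      using B[OF that] by (intro mult_right_mono) auto
    then show "AE x in lebesgue. norm (c x *\<^sub>R (indicator (cball 0 r) x *\<^sub>R g x))
        \<le> norm (B *\<^sub>R (indicator (cball 0 r) x *\<^sub>R g x))"
      by (auto simp: indicator_def)
  qed
  also have "(\<lambda>x. c x *\<^sub>R (indicator (cball 0 r) x *\<^sub>R g x)) = (\<lambda>x. c x *\<^sub>R g x)"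
  proof
    fix x
    show "c x *\<^sub>R (indicator (cball 0 r) x *\<^sub>R g x) = c x *\<^sub>R g x"
      using s[of x] by (cases "norm x \<le> r") simp_all
  qed
  finally show ?thesis .
qed

lemma locally_integrable_continuous:
  fixes c :: "real ^ 'n::finite \<Rightarrow> 'b::{banach, second_countable_topology}"
  assumes "continuous_on UNIV c"
  shows "locally_integrable c"
  unfolding locally_integrable_def
proof (intro allI impI)
  fix K :: "(real ^ 'n) set" assume K: "compact K"
  have "integrable lborel (\<lambda>x. indicator K x *\<^sub>R c x)"
    by (rule borel_integrable_compact[OF K]) (rule continuous_on_subset[OF assms], simp)
  then show "set_integrable lebesgue K c"
    unfolding set_integrable_def by (intro integrable_completion[THEN iffD2]) auto
qed

section \<open>Vanishing of functions and weak gradients\<close>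

lemma sigma_finite_lebesgue: "sigma_finite_measure (lebesgue :: (real ^ 'n::finite) measure)"
proof
  obtain A :: "(real ^ 'n) set set" where
    "countable A" "A \<subseteq> sets lborel" "\<Union>A = space lborel" "\<forall>a\<in>A. emeasure lborel a \<noteq> \<infinity>"
    using lborel.sigma_finite_countable by blast
  then show "\<exists>A. countable A \<and> A \<subseteq> sets lebesgue \<and> \<Union>A = space lebesgue \<and>
      (\<forall>a\<in>A. emeasure (lebesgue :: (real ^ 'n) measure) a \<noteq> \<infinity>)"
    by (intro exI[of _ A]) auto
qed

abbreviation cube :: "nat \<Rightarrow> (real ^ 'n::finite) set" where
  "cube n \<equiv> box (- real n *\<^sub>R One) (real n *\<^sub>R One)"

text \<open>Boxes are stable under intersection and generate the Borel sets. The complement step of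
  the induction uses the integral over the whole space, which cubes exhaust; Lebesgue sets differ
  from Borel sets by null sets.\<close>

lemma AE_eq_0_of_box_integrals:
  fixes f :: "real ^ 'n::finite \<Rightarrow> 'b::{banach, second_countable_topology}"
  assumes f: "integrable lebesgue f"
    and box: "\<And>a b. (LINT x:box a b|lebesgue. f x) = 0"
  shows "AE x in lebesgue. f x = 0"
proof (rule sigma_finite_measure.density_zero[OF sigma_finite_lebesgue f])
  have si: "set_integrable lebesgue A f" if "A \<in> sets lebesgue" for A
    unfolding set_integrable_def by (rule integrable_mult_indicator[OF that f])
  have cubes: "(\<Union>n. cube n) = (UNIV :: (real^'n) set)"
    using UN_box_eq_UNIV[where 'a = "real ^ 'n"] by simp
  have whole: "(LINT x|lebesgue. f x) = 0"
  proof (rule LIMSEQ_unique)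
    show "(\<lambda>n. LINT x:cube n|lebesgue. f x)
        \<longlonglongrightarrow> (LINT x|lebesgue. f x)"
      unfolding set_lebesgue_integral_def
    proof (rule integral_dominated_convergence[where w = "\<lambda>x. norm (f x)"])
      show "AE x in lebesgue. (\<lambda>n. indicator (cube n) x *\<^sub>R f x) \<longlonglongrightarrow> f x"
      proof (rule AE_I2)
        fix x :: "real ^ 'n"
        obtain N where N: "x \<in> cube N" using cubes by blast
        have "x \<in> cube n" if "n \<ge> N" for n
          using N that by (force simp: mem_box)
        then have "\<forall>\<^sub>F n in sequentially. indicator (cube n) x *\<^sub>R f x = f x"
          unfolding eventually_sequentially by (intro exI[of _ N]) auto
        then show "(\<lambda>n. indicator (cube n) x *\<^sub>R f x) \<longlonglongrightarrow> f x"
          by (rule tendsto_eventually)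
      qed
      show "integrable lebesgue (\<lambda>x. norm (f x))" using f by auto
      show "AE x in lebesgue. norm (indicator (cube n) x *\<^sub>R f x) \<le> norm (f x)" for n
        by (auto simp: indicator_def)
    qed (use f in \<open>auto intro!: borel_measurable_scaleR borel_measurable_indicator\<close>)
    show "(\<lambda>n. LINT x:cube n|lebesgue. f x) \<longlonglongrightarrow> 0"
      by (simp only: box tendsto_const)
  qed
  have borel: "(LINT x:A|lebesgue. f x) = 0" if "A \<in> sets borel" for A :: "(real ^ 'n) set"
  proof -
    let ?G = "range (\<lambda>(a, b). box a b) :: (real ^ 'n) set set"
    have sub: "sigma_sets UNIV ?G = sets borel" by (simp add: borel_eq_box)
    have int: "Int_stable ?G" by (auto simp: Int_stable_def box_Int_box)
    have pow: "?G \<subseteq> Pow UNIV" by simp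
    have "A \<in> sigma_sets UNIV ?G" using that sub by simp
    with int pow show ?thesis
    proof (induction rule: sigma_sets_induct_disjoint)
      case (compl A)
      have A: "A \<in> sets lebesgue" using compl(1) sub by auto
      have A': "UNIV - A \<in> sets lebesgue" using sets.compl_sets[OF A] by simp
      have "(LINT x:A \<union> (UNIV - A)|lebesgue. f x) = (LINT x:A|lebesgue. f x) + (LINT x:UNIV - A|lebesgue. f x)"
        by (rule set_integral_Un[OF _ si[OF A] si[OF A']]) auto
      moreover have "A \<union> (UNIV - A) = UNIV" by auto
      ultimately show ?case using compl(2) whole by (simp add: set_lebesgue_integral_def)
    next
      case (union A)
      have A: "A i \<in> sets lebesgue" for i using union(2) sub by auto
      have "(LINT x:(\<Union>i. A i)|lebesgue. f x) = (\<Sum>i. LINT x:A i|lebesgue. f x)"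
        by (rule lebesgue_integral_countable_add)
           (use A si union(1) in \<open>auto simp: disjoint_family_on_def\<close>)
      then show ?case using union(3) by simp
    qed (auto simp: box, simp add: set_lebesgue_integral_def)
  qed
  fix A :: "(real ^ 'n) set" assume "A \<in> sets lebesgue"
  then obtain S N N' where A: "A = S \<union> N" "N \<subseteq> N'" "N' \<in> null_sets lborel" "S \<in> sets lborel"
    by (rule sets_completionE)
  have "AE x in lebesgue. x \<notin> N'" using AE_completion[OF AE_not_in[OF A(3)]] .
  then have "AE x in lebesgue. indicator A x *\<^sub>R f x = indicator S x *\<^sub>R f x"
    by eventually_elim (use A in \<open>auto simp: indicator_def\<close>)
  then have "(LINT x:A|lebesgue. f x) = (LINT x:S|lebesgue. f x)"
    unfolding set_lebesgue_integral_def
    using \<open>A \<in> sets lebesgue\<close> A(4) f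
    by (intro integral_cong_AE borel_measurable_scaleR borel_measurable_indicator) auto
  then show "set_lebesgue_integral lebesgue A f = 0" using borel A(4) by simp
qed

lemma norm_scaleR_le:
  fixes v :: "'a::real_normed_vector"
  assumes "0 \<le> k" "k \<le> 1"
  shows "norm (k *\<^sub>R v) \<le> norm v"
  using assms by (simp add: mult_left_le_one_le)

text \<open>The bumps converge boundedly to indicators of boxes, so the integrals of g over boxes
  vanish. This is the fundamental lemma of the calculus of variations, with concrete test
  functions.\<close>

lemma AE_eq_0_of_box_bump_integrals:
  fixes g :: "real ^ 'n::finite \<Rightarrow> 'b::{banach, second_countable_topology}"
  assumes g: "locally_integrable g"
    and 0: "\<And>a b m. (\<integral>x. box_bump a b m x *\<^sub>R g x \<partial>lebesgue) = 0"
  shows "AE x in lebesgue. g x = 0"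
proof -
  have si: "integrable lebesgue (\<lambda>x. indicator (box a b) x *\<^sub>R g x)" for a b
  proof -
    have "set_integrable lebesgue (cbox a b) g" using g by (auto simp: locally_integrable_def)
    then show ?thesis
      using set_integrable_subset[of lebesgue "cbox a b" g "box a b"] box_subset_cbox
      by (auto simp: set_integrable_def)
  qed
  have box: "(\<integral>x. indicator (box a b) x *\<^sub>R g x \<partial>lebesgue) = 0" for a b
  proof (rule LIMSEQ_unique)
    have eq: "box_bump a b m x *\<^sub>R g x = box_bump a b m x *\<^sub>R (indicator (box a b) x *\<^sub>R g x)" for m x
      by (cases "x \<in> box a b") (auto simp: box_bump_outside)
    show "(\<lambda>m. \<integral>x. box_bump a b m x *\<^sub>R g x \<partial>lebesgue)
        \<longlonglongrightarrow> (\<integral>x. indicator (box a b) x *\<^sub>R g x \<partial>lebesgue)"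
      unfolding eq
    proof (rule integral_dominated_convergence[where w = "\<lambda>x. norm (indicator (box a b) x *\<^sub>R g x)"])
      have "box_bump a b m \<in> borel_measurable lebesgue" for m
        by (rule continuous_on_UNIV_lebesgue_measurable)
           (rule test_function_continuous[OF test_function_box_bump])
      then show "(\<lambda>x. box_bump a b m x *\<^sub>R (indicator (box a b) x *\<^sub>R g x)) \<in> borel_measurable lebesgue" for m
        using borel_measurable_integrable[OF si] by (rule borel_measurable_scaleR)
      show "AE x in lebesgue. (\<lambda>m. box_bump a b m x *\<^sub>R (indicator (box a b) x *\<^sub>R g x))
          \<longlonglongrightarrow> indicator (box a b) x *\<^sub>R g x"
      proof (rule AE_I2)
        fix x
        have "(\<lambda>m. box_bump a b m x *\<^sub>R (indicator (box a b) x *\<^sub>R g x))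
          \<longlonglongrightarrow> indicator (box a b) x *\<^sub>R (indicator (box a b) x *\<^sub>R g x)"
          by (intro tendsto_intros box_bump_tendsto)
        then show "(\<lambda>m. box_bump a b m x *\<^sub>R (indicator (box a b) x *\<^sub>R g x))
          \<longlonglongrightarrow> indicator (box a b) x *\<^sub>R g x" by (cases "x \<in> box a b") simp_all
      qed
      show "integrable lebesgue (\<lambda>x. norm (indicator (box a b) x *\<^sub>R g x))"
        by (rule integrable_norm[OF si])
      show "AE x in lebesgue. norm (box_bump a b m x *\<^sub>R (indicator (box a b) x *\<^sub>R g x))
          \<le> norm (indicator (box a b) x *\<^sub>R g x)" for m
        by (rule AE_I2)
           (rule norm_scaleR_le[OF box_bump_bounds])
    qed (rule borel_measurable_integrable[OF si])
    show "(\<lambda>m. \<integral>x. box_bump a b m x *\<^sub>R g x \<partial>lebesgue) \<longlonglongrightarrow> 0" by (simp add: 0)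
  qed
  \<comment> \<open>g is only locally integrable and is cut off to cubes; a box meets a cube in a
    box again.\<close>
  have "AE x in lebesgue. indicator (cube n) x *\<^sub>R g x = 0" for n
  proof (rule AE_eq_0_of_box_integrals[OF si])
    fix a b :: "real ^ 'n"
    obtain c d where cd: "box a b \<inter> cube n = box c d"
      using box_Int_box[of a b "- real n *\<^sub>R One" "real n *\<^sub>R One"] that by blast
    have "(LINT x:box a b|lebesgue. indicator (cube n) x *\<^sub>R g x)
        = (\<integral>x. indicator (box c d) x *\<^sub>R g x \<partial>lebesgue)"
      unfolding set_lebesgue_integral_def cd[symmetric] indicator_inter_arith
      by (simp only: scaleR_scaleR)
    then show "(LINT x:box a b|lebesgue. indicator (cube n) x *\<^sub>R g x) = 0"
      by (simp only: box)
  qed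
  then have "AE x in lebesgue. \<forall>n. indicator (cube n) x *\<^sub>R g x = 0"
    unfolding AE_all_countable by blast
  then show ?thesis
  proof eventually_elim
    case (elim x)
    obtain N where "x \<in> cube N"
      using UN_box_eq_UNIV[where 'a = "real ^ 'n"] by auto
    then show ?case using elim[rule_format, of N] by simp
  qed
qed

text \<open>By translation invariance the integral of a difference quotient vanishes.\<close>

lemma integral_partial_eq_0:
  fixes u :: "real ^ 'n::finite \<Rightarrow> real"
  assumes d: "\<And>x. u differentiable (at x)" and c: "continuous_on UNIV (partial i u)"
    and s: "\<And>x. r \<le> norm x \<Longrightarrow> u x = 0"
  shows "(\<integral>x. partial i u x \<partial>lebesgue) = 0"
proof -
  let ?e = "axis i 1 :: real ^ 'n"
  have cc: "continuous_on UNIV u" by (rule continuous_on_differentiable_at[OF d])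
  have b: "u \<in> borel_measurable borel" "partial i u \<in> borel_measurable borel"
    by (intro borel_measurable_continuous_onI cc c)+
  have int: "integrable lborel u"
  proof -
    have "integrable lborel (\<lambda>x. indicator (cball 0 r) x *\<^sub>R u x)"
      by (rule borel_integrable_compact) (auto intro: continuous_on_subset[OF cc])
    also have "(\<lambda>x. indicator (cball 0 r) x *\<^sub>R u x) = u"
      using s by (auto simp: indicator_def intro!: ext)
    finally show ?thesis .
  qed
  have "compact (partial i u ` cball 0 r)"
    using c by (intro compact_continuous_image) (auto intro: continuous_on_subset)
  then obtain B0 where B0: "\<And>x. x \<in> cball 0 r \<Longrightarrow> \<bar>partial i u x\<bar> \<le> B0"
    using compact_imp_bounded by (force simp: bounded_iff)
  define B where "B = max 0 B0"
  have B: "\<bar>partial i u x\<bar> \<le> B" for x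
  proof (cases "norm x \<le> r")
    case True
    then show ?thesis using B0[of x] by (auto simp: B_def)
  next
    case False
    then show ?thesis using partial_eq_0_outside[of r u x i] s by (auto simp: B_def)
  qed
  have line: "((\<lambda>h. u (x + h *\<^sub>R ?e)) has_real_derivative partial i u (x + h *\<^sub>R ?e)) (at h)" for x h
  proof -
    have "((\<lambda>h. x + h *\<^sub>R ?e) has_derivative (\<lambda>k. k *\<^sub>R ?e)) (at h)"
      by (auto intro!: derivative_eq_intros)
    moreover have D: "(u has_derivative frechet_derivative u (at (x + h *\<^sub>R ?e))) (at (x + h *\<^sub>R ?e))"
      using d by (simp add: frechet_derivative_works[symmetric])
    ultimately have "((\<lambda>h. u (x + h *\<^sub>R ?e)) has_derivative
        (\<lambda>k. frechet_derivative u (at (x + h *\<^sub>R ?e)) (k *\<^sub>R ?e))) (at h)"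
      by (rule has_derivative_compose)
    then show ?thesis
      unfolding has_field_derivative_def partial_def
      by (rule has_derivative_eq_rhs)
         (rule ext, simp add: linear_simps[OF has_derivative_bounded_linear[OF D]])
  qed
  define h where "h n = inverse (real (Suc n))" for n
  have h: "0 < h n" "h n \<le> 1" for n by (auto simp: h_def intro: inverse_le_1_iff[THEN iffD2])
  have h0: "h \<longlonglongrightarrow> 0" unfolding h_def by (rule LIMSEQ_inverse_real_of_nat)
  define Q where "Q n x = (u (x + h n *\<^sub>R ?e) - u x) / h n" for n x
  have Q0: "(\<integral>x. Q n x \<partial>lborel) = 0" for n
  proof -
    have tr: "integrable (distr lborel borel ((+) (h n *\<^sub>R ?e))) u"
      by (simp add: lborel_distr_plus int)
    have i: "integrable lborel (\<lambda>x. u (x + h n *\<^sub>R ?e))"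
      using integrable_distr[OF _ tr] by (simp add: add.commute)
    have "(\<integral>x. u x \<partial>lborel) = (\<integral>x. u x \<partial>distr lborel borel ((+) (h n *\<^sub>R ?e)))"
      by (simp add: lborel_distr_plus)
    also have "\<dots> = (\<integral>x. u (x + h n *\<^sub>R ?e) \<partial>lborel)"
      by (subst integral_distr) (simp_all add: b add.commute)
    finally show ?thesis using i int by (simp add: Q_def)
  qed
  have "(\<lambda>n. \<integral>x. Q n x \<partial>lborel) \<longlonglongrightarrow> (\<integral>x. partial i u x \<partial>lborel)"
  \<comment> \<open>Increments h n \<le> 1 keep the supports inside the ball of radius r + 1, and
    the mean value theorem bounds the quotients by B.\<close>
  proof (rule integral_dominated_convergence[where w = "\<lambda>x. B * indicator (cball 0 (r + 1)) x"])
    show "integrable lborel (\<lambda>x::real^'n. B * indicator (cball 0 (r + 1)) x)"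
      using emeasure_bounded_finite[of "cball 0 (r + 1) :: (real^'n) set"]
      by (intro integrable_mult_right integrable_real_indicator) auto
    show "Q n \<in> borel_measurable lborel" for n
      unfolding Q_def using b by measurable
    show "AE x in lborel. (\<lambda>n. Q n x) \<longlonglongrightarrow> partial i u x"
    proof (rule AE_I2)
      fix x
      have "((\<lambda>k. (u (x + (0 + k) *\<^sub>R ?e) - u (x + 0 *\<^sub>R ?e)) / k) \<longlongrightarrow> partial i u (x + 0 *\<^sub>R ?e)) (at 0)"
        using line[of x 0] by (simp only: DERIV_def)
      moreover have "filterlim h (at 0) sequentially"
        using h0 h(1) by (auto simp: filterlim_at less_imp_neq intro!: always_eventually) (metis less_irrefl)
      ultimately show "(\<lambda>n. Q n x) \<longlonglongrightarrow> partial i u x"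
        unfolding Q_def by (simp add: filterlim_compose[where g = "\<lambda>k. (u (x + k *\<^sub>R ?e) - u x) / k"])
    qed
    show "AE x in lborel. norm (Q n x) \<le> B * indicator (cball 0 (r + 1)) x" for n
    proof (rule AE_I2)
      fix x :: "real ^ 'n"
      show "norm (Q n x) \<le> B * indicator (cball 0 (r + 1)) x"
      proof (cases "norm x \<le> r + 1")
        case True
        obtain z where "u (x + h n *\<^sub>R ?e) - u (x + 0 *\<^sub>R ?e) = (h n - 0) * partial i u (x + z *\<^sub>R ?e)"
          using MVT2[OF h(1)[of n], of "\<lambda>h. u (x + h *\<^sub>R ?e)" "\<lambda>h. partial i u (x + h *\<^sub>R ?e)"] line by blast
        then have "Q n x = partial i u (x + z *\<^sub>R ?e)" using h(1)[of n] by (simp add: Q_def)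
        then show ?thesis using B True by (simp add: indicator_def)
      next
        case False
        have "norm x - norm (h n *\<^sub>R ?e) \<le> norm (x + h n *\<^sub>R ?e)" by (rule norm_diff_ineq)
        then have "r \<le> norm (x + h n *\<^sub>R ?e)" using False h[of n] by (simp add: norm_axis_1)
        then have "Q n x = 0" using False s[of x] s[of "x + h n *\<^sub>R ?e"] by (simp add: Q_def)
        then show ?thesis by (simp add: B_def)
      qed
    qed
  qed (simp add: b)
  then have "(\<integral>x. partial i u x \<partial>lborel) = 0"
    unfolding Q0 by (simp add: LIMSEQ_const_iff)
  then show ?thesis by (simp add: integral_completion b)
qed

lemma test_function_by_parts:
  fixes \<phi> \<psi> :: "real ^ 'n::finite \<Rightarrow> real"
  assumes \<phi>: "test_function \<phi>" and \<psi>: "test_function \<psi>"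
  shows "(\<integral>x. partial i \<psi> x * \<phi> x \<partial>lebesgue) = - (\<integral>x. \<psi> x * partial i \<phi> x \<partial>lebesgue)"
proof -
  obtain r where r: "\<And>x. r \<le> norm x \<Longrightarrow> \<phi> x = 0" using test_function_support[OF \<phi>] by blast
  have df: "(\<phi> has_derivative frechet_derivative \<phi> (at x)) (at x)"
    and dg: "(\<psi> has_derivative frechet_derivative \<psi> (at x)) (at x)" for x
    using test_function_differentiable \<phi> \<psi> by (auto simp: frechet_derivative_works[symmetric])
  have p: "partial i (\<lambda>x. \<psi> x * \<phi> x) = (\<lambda>x. \<psi> x * partial i \<phi> x + partial i \<psi> x * \<phi> x)"
    by (rule ext) (simp add: partial_eq[OF has_derivative_mult[OF dg df]] partial_def)
  note cont = test_function_continuous test_function_partial_continuous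
  have "(\<integral>x. partial i (\<lambda>x. \<psi> x * \<phi> x) x \<partial>lebesgue) = 0"
  proof (rule integral_partial_eq_0[where r = r])
    show "(\<lambda>x. \<psi> x * \<phi> x) differentiable at x" for x
      using has_derivative_mult[OF dg df] unfolding differentiable_def by blast
    show "continuous_on UNIV (partial i (\<lambda>x. \<psi> x * \<phi> x))"
      unfolding p by (intro continuous_intros cont \<phi> \<psi>)
  qed (simp add: r)
  moreover have "integrable lebesgue (\<lambda>x. \<phi> x *\<^sub>R partial i \<psi> x)"
    by (rule locally_integrable_mult_continuous[OF locally_integrable_continuous, where r = r])
       (auto intro: cont \<phi> \<psi> r)
  moreover have "integrable lebesgue (\<lambda>x. partial i \<phi> x *\<^sub>R \<psi> x)"
    by (rule locally_integrable_mult_continuous[OF locally_integrable_continuous, where r = r])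
       (auto intro: cont \<phi> \<psi> partial_eq_0_outside r)
  ultimately show ?thesis
    unfolding p by (simp add: mult.commute)
qed

section \<open>Local integrability and the calculus of weak gradients\<close>

lemma locally_integrable_measurable:
  fixes g :: "real ^ 'n::finite \<Rightarrow> 'b::{banach, second_countable_topology}"
  assumes "locally_integrable g"
  shows "g \<in> borel_measurable lebesgue"
proof (rule borel_measurable_LIMSEQ_metric)
  fix n :: nat
  have "set_integrable lebesgue (cball 0 (real n)) g"
    using assms by (simp add: locally_integrable_def)
  then show "(\<lambda>x. indicator (cball 0 (real n)) x *\<^sub>R g x) \<in> borel_measurable lebesgue"
    unfolding set_integrable_def by (rule borel_measurable_integrable)
next
  fix x :: "real ^ 'n"
  obtain N where "norm x \<le> real N" using real_arch_simple by blast
  then have "\<forall>\<^sub>F n in sequentially. indicator (cball 0 (real n)) x *\<^sub>R g x = g x"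
    unfolding eventually_sequentially by (intro exI[of _ N]) auto
  then show "(\<lambda>n. indicator (cball 0 (real n)) x *\<^sub>R g x) \<longlonglongrightarrow> g x" by (rule tendsto_eventually)
qed

lemma locally_integrable_add:
  "locally_integrable f \<Longrightarrow> locally_integrable g \<Longrightarrow> locally_integrable (\<lambda>x. f x + g x)"
  by (auto simp: locally_integrable_def)

lemma locally_integrable_linear:
  assumes "bounded_linear T" "locally_integrable f"
  shows "locally_integrable (\<lambda>x. T (f x))"
  using assms integrable_bounded_linear[OF assms(1)]
  by (auto simp: locally_integrable_def set_integrable_def linear_simps[OF assms(1), symmetric])

lemma locally_integrable_cong_AE:
  fixes f g :: "real ^ 'n::finite \<Rightarrow> 'b::{banach, second_countable_topology}"
  assumes "locally_integrable f" "g \<in> borel_measurable lebesgue" "AE x in lebesgue. f x = g x"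
  shows "locally_integrable g"
  unfolding locally_integrable_def
proof (intro allI impI)
  fix K :: "(real ^ 'n) set" assume "compact K"
  then have K: "K \<in> sets lebesgue" and f: "set_integrable lebesgue K f"
    using assms(1) by (auto simp: locally_integrable_def lmeasurable_compact fmeasurableD)
  show "set_integrable lebesgue K g"
    unfolding set_integrable_def
    by (rule integrable_cong_AE_imp[OF f[unfolded set_integrable_def]])
       (use assms(2,3) K in \<open>auto intro!: borel_measurable_scaleR borel_measurable_indicator\<close>)
qed

text \<open>Lets weak gradients pass through \<open>rep_L2\<close>, whose values on sums and
  multiples are determined only up to null sets.\<close>

lemma has_weak_gradient_cong_AE:
  assumes g: "has_weak_gradient g G" and ae: "AE x in lebesgue. g x = g' x" "AE x in lebesgue. G x = G' x"
    and m: "g' \<in> borel_measurable lebesgue" "G' \<in> borel_measurable lebesgue"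
  shows "has_weak_gradient g' G'"
proof -
  have l: "locally_integrable g" "locally_integrable G" "locally_integrable g'" "locally_integrable G'"
    using g locally_integrable_cong_AE[OF _ m(1) ae(1)] locally_integrable_cong_AE[OF _ m(2) ae(2)]
    by (auto simp: has_weak_gradient_def)
  note meas = l[THEN locally_integrable_measurable]
  have eq: "(\<integral>x. partial i \<phi> x *\<^sub>R g' x \<partial>lebesgue) = - (\<integral>x. \<phi> x *\<^sub>R (G' x $ i) \<partial>lebesgue)"
    if \<phi>: "test_function \<phi>" for \<phi> i
  proof -
    have c: "\<phi> \<in> borel_measurable lebesgue" "partial i \<phi> \<in> borel_measurable lebesgue"
      using continuous_on_UNIV_lebesgue_measurable test_function_continuous[OF \<phi>]
        test_function_partial_continuous[OF \<phi>] by blast+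
    have "(\<integral>x. partial i \<phi> x *\<^sub>R g' x \<partial>lebesgue) = (\<integral>x. partial i \<phi> x *\<^sub>R g x \<partial>lebesgue)"
      using ae(1) by (intro integral_cong_AE borel_measurable_scaleR c meas) auto
    moreover have "(\<integral>x. \<phi> x *\<^sub>R (G' x $ i) \<partial>lebesgue) = (\<integral>x. \<phi> x *\<^sub>R (G x $ i) \<partial>lebesgue)"
      using ae(2) by (intro integral_cong_AE borel_measurable_scaleR c locally_integrable_measurable
          locally_integrable_linear[OF bounded_linear_vec_nth] l) auto
    ultimately show ?thesis using g \<phi> by (simp add: has_weak_gradient_def)
  qed
  then show ?thesis using l by (auto simp: has_weak_gradient_def)
qed

lemma test_function_integrable:
  fixes g :: "real ^ 'n::finite \<Rightarrow> 'b::{banach, second_countable_topology}"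
  assumes \<phi>: "test_function \<phi>" and g: "locally_integrable g"
  shows "integrable lebesgue (\<lambda>x. \<phi> x *\<^sub>R g x)" "integrable lebesgue (\<lambda>x. partial i \<phi> x *\<^sub>R g x)"
proof -
  obtain r where r: "\<And>x. r \<le> norm x \<Longrightarrow> \<phi> x = 0" using test_function_support[OF \<phi>] by blast
  show "integrable lebesgue (\<lambda>x. \<phi> x *\<^sub>R g x)"
    by (rule locally_integrable_mult_continuous[OF g test_function_continuous[OF \<phi>], where r = r])
       (simp add: r)
  show "integrable lebesgue (\<lambda>x. partial i \<phi> x *\<^sub>R g x)"
    by (rule locally_integrable_mult_continuous[OF g test_function_partial_continuous[OF \<phi>], where r = r])
       (simp add: r partial_eq_0_outside[of r])
qed

text \<open>Tested against bumps, each component of the difference has vanishing integrals. This is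
  what makes the choice in \<open>weak_gradient\<close> harmless.\<close>

lemma has_weak_gradient_unique:
  assumes "has_weak_gradient g G" "has_weak_gradient g G'"
  shows "AE x in lebesgue. G x = G' x"
proof -
  have "AE x in lebesgue. G x $ i - G' x $ i = 0" for i
  proof (rule AE_eq_0_of_box_bump_integrals)
    have l: "locally_integrable (\<lambda>x. G x $ i)" "locally_integrable (\<lambda>x. G' x $ i)"
      using assms by (auto simp: has_weak_gradient_def intro: locally_integrable_linear[OF bounded_linear_vec_nth])
    then show "locally_integrable (\<lambda>x. G x $ i - G' x $ i)"
      by (auto simp: locally_integrable_def)
    fix a b m
    note t = test_function_box_bump[of a b m]
    show "(\<integral>x. box_bump a b m x *\<^sub>R (G x $ i - G' x $ i) \<partial>lebesgue) = 0"
    proof -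
      have "(\<integral>x. partial i (box_bump a b m) x *\<^sub>R g x \<partial>lebesgue)
          = - (\<integral>x. box_bump a b m x *\<^sub>R (G x $ i) \<partial>lebesgue)"
        "(\<integral>x. partial i (box_bump a b m) x *\<^sub>R g x \<partial>lebesgue)
          = - (\<integral>x. box_bump a b m x *\<^sub>R (G' x $ i) \<partial>lebesgue)"
        using assms t unfolding has_weak_gradient_def by blast+
      then show ?thesis
        using test_function_integrable(1)[OF t l(1)] test_function_integrable(1)[OF t l(2)]
        by (simp add: scaleR_diff_right)
    qed
  qed
  then have "AE x in lebesgue. \<forall>i. G x $ i - G' x $ i = 0"
    by (simp add: AE_all_countable)
  then show ?thesis by eventually_elim (simp add: vec_eq_iff)
qed

lemma has_weak_gradient_add:
  assumes "has_weak_gradient f F" "has_weak_gradient g G"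
  shows "has_weak_gradient (\<lambda>x. f x + g x) (\<lambda>x. F x + G x)"
  unfolding has_weak_gradient_def
proof (intro conjI allI impI)
  have l: "locally_integrable f" "locally_integrable g" "locally_integrable F" "locally_integrable G"
    using assms by (auto simp: has_weak_gradient_def)
  then show "locally_integrable (\<lambda>x. f x + g x)" "locally_integrable (\<lambda>x. F x + G x)"
    by (auto intro: locally_integrable_add)
  fix \<phi> :: "real ^ 'a \<Rightarrow> real" and i assume \<phi>: "test_function \<phi>"
  have l': "locally_integrable (\<lambda>x. F x $ i)" "locally_integrable (\<lambda>x. G x $ i)"
    using l by (auto intro: locally_integrable_linear[OF bounded_linear_vec_nth])
  show "(\<integral>x. partial i \<phi> x *\<^sub>R (f x + g x) \<partial>lebesgue) = - (\<integral>x. \<phi> x *\<^sub>R ((F x + G x) $ i) \<partial>lebesgue)"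
    using assms \<phi> test_function_integrable(1)[OF \<phi> l'(1)] test_function_integrable(1)[OF \<phi> l'(2)]
      test_function_integrable(2)[OF \<phi> l(1), of i] test_function_integrable(2)[OF \<phi> l(2), of i]
    by (simp add: scaleR_add_right has_weak_gradient_def)
qed

lemma norm_vector_smult: "norm (c *s v) = cmod c * norm (v :: complex ^ 'n::finite)"
  by (simp add: norm_vec_def L2_set_def norm_mult power_mult_distrib real_sqrt_mult
      flip: sum_distrib_left)

lemma bounded_linear_vector_smult: "bounded_linear (\<lambda>v :: complex ^ 'n::finite. c *s v)"
  by (rule bounded_linear_intro[where K = "cmod c"])
     (simp_all add: norm_vector_smult vec_eq_iff algebra_simps)

lemma has_weak_gradient_scale:
  assumes "has_weak_gradient f F"
  shows "has_weak_gradient (\<lambda>x. c * f x) (\<lambda>x. c *s F x)"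
  unfolding has_weak_gradient_def
proof (intro conjI allI impI)
  show "locally_integrable (\<lambda>x. c * f x)" "locally_integrable (\<lambda>x. c *s F x)"
    using assms by (auto simp: has_weak_gradient_def
        intro: locally_integrable_linear[OF bounded_linear_mult_right]
          locally_integrable_linear[OF bounded_linear_vector_smult])
  fix \<phi> :: "real ^ 'a \<Rightarrow> real" and i assume \<phi>: "test_function \<phi>"
  have "(\<integral>x. partial i \<phi> x *\<^sub>R (c * f x) \<partial>lebesgue) = c * (\<integral>x. partial i \<phi> x *\<^sub>R f x \<partial>lebesgue)"
    unfolding mult_scaleR_right[symmetric] by (rule integral_mult_right_zero)
  also have "\<dots> = - (c * (\<integral>x. \<phi> x *\<^sub>R (F x $ i) \<partial>lebesgue))"
    using assms \<phi> by (simp add: has_weak_gradient_def)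
  also have "c * (\<integral>x. \<phi> x *\<^sub>R (F x $ i) \<partial>lebesgue) = (\<integral>x. c * (\<phi> x *\<^sub>R (F x $ i)) \<partial>lebesgue)"
    by (rule integral_mult_right_zero[symmetric])
  finally show "(\<integral>x. partial i \<phi> x *\<^sub>R (c * f x) \<partial>lebesgue) = - (\<integral>x. \<phi> x *\<^sub>R ((c *s F x) $ i) \<partial>lebesgue)"
    by simp
qed

text \<open>Integration by parts against test functions; it supplies the form domain with enough
  elements for density.\<close>

lemma has_weak_gradient_test_function:
  assumes \<phi>: "test_function \<phi>"
  shows "has_weak_gradient (\<lambda>x. complex_of_real (\<phi> x)) (\<lambda>x. \<chi> i. complex_of_real (partial i \<phi> x))"
  unfolding has_weak_gradient_def
proof (intro conjI allI impI)
  show "locally_integrable (\<lambda>x. complex_of_real (\<phi> x))"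
    by (intro locally_integrable_continuous continuous_intros test_function_continuous \<phi>)
  show "locally_integrable (\<lambda>x. \<chi> i. complex_of_real (partial i \<phi> x))"
    by (intro locally_integrable_continuous continuous_intros test_function_partial_continuous \<phi>)
  fix \<psi> :: "real ^ 'a \<Rightarrow> real" and i assume \<psi>: "test_function \<psi>"
  have "(\<integral>x. partial i \<psi> x *\<^sub>R complex_of_real (\<phi> x) \<partial>lebesgue)
      = complex_of_real (\<integral>x. partial i \<psi> x * \<phi> x \<partial>lebesgue)"
    by (simp add: scaleR_conv_of_real flip: of_real_mult integral_complex_of_real)
  also have "\<dots> = - complex_of_real (\<integral>x. \<psi> x * partial i \<phi> x \<partial>lebesgue)"
    by (simp add: test_function_by_parts[OF \<phi> \<psi>])
  also have "complex_of_real (\<integral>x. \<psi> x * partial i \<phi> x \<partial>lebesgue)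
      = (\<integral>x. \<psi> x *\<^sub>R complex_of_real (partial i \<phi> x) \<partial>lebesgue)"
    by (simp add: scaleR_conv_of_real flip: of_real_mult integral_complex_of_real)
  finally show "(\<integral>x. partial i \<psi> x *\<^sub>R complex_of_real (\<phi> x) \<partial>lebesgue)
      = - (\<integral>x. \<psi> x *\<^sub>R ((\<chi> i. complex_of_real (partial i \<phi> x)) $ i) \<partial>lebesgue)" by simp
qed

lemma weak_gradient_eq:
  assumes "has_weak_gradient g G"
  shows "has_weak_gradient g (weak_gradient g)" "AE x in lebesgue. weak_gradient g x = G x"
proof -
  show *: "has_weak_gradient g (weak_gradient g)"
    unfolding weak_gradient_def by (rule someI[of "has_weak_gradient g", OF assms])
  show "AE x in lebesgue. weak_gradient g x = G x" by (rule has_weak_gradient_unique[OF * assms])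
qed

section \<open>Schroedinger forms\<close>

lemma square_integrable_imp_locally_integrable:
  assumes "square_integrable f"
  shows "locally_integrable f"
  unfolding locally_integrable_def set_integrable_def
proof (intro allI impI)
  fix K :: "(real ^ 'a) set" assume K: "compact K"
  then have Km: "K \<in> sets lebesgue" and Kf: "emeasure lebesgue K < \<infinity>"
    using lmeasurable_compact[OF K] by (auto simp: fmeasurable_def)
  have f: "f \<in> borel_measurable lebesgue" "integrable lebesgue (\<lambda>x. (cmod (f x))\<^sup>2)"
    using assms by (auto simp: square_integrable_def)
  show "integrable lebesgue (\<lambda>x. indicator K x *\<^sub>R f x)"
  proof (rule Bochner_Integration.integrable_bound)
    show "integrable lebesgue (\<lambda>x. indicator K x + (cmod (f x))\<^sup>2)"
      by (intro Bochner_Integration.integrable_add integrable_real_indicator Km Kf f)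
    show "(\<lambda>x. indicator K x *\<^sub>R f x) \<in> borel_measurable lebesgue"
      by (intro borel_measurable_scaleR borel_measurable_indicator Km f)
    have "a \<le> 1 + a\<^sup>2" for a :: real
    proof -
      have "0 \<le> (a - 1)\<^sup>2 + a\<^sup>2" by simp
      then show ?thesis using zero_le_power2[of a] by (simp add: power2_eq_square algebra_simps)
    qed
    then show "AE x in lebesgue. norm (indicator K x *\<^sub>R f x) \<le> norm (indicator K x + (cmod (f x))\<^sup>2)"
      by (auto simp: indicator_def)
  qed
qed

lemma norm_vec_square: "(norm (v :: complex ^ 'n::finite))\<^sup>2 = (\<Sum>i\<in>UNIV. (cmod (v $ i))\<^sup>2)"
  by (simp add: norm_vec_def L2_set_def sum_nonneg)

lemma sum_cnj_mult_self:
  "(\<Sum>i\<in>UNIV. cnj (v $ i) * v $ i) = complex_of_real ((norm (v :: complex ^ 'n::finite))\<^sup>2)"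
  unfolding norm_vec_square of_real_sum complex_norm_square by (simp only: mult.commute)

lemma cmod_sum_cnj_mult_le:
  "cmod (\<Sum>i\<in>UNIV. cnj (v $ i) * w $ i) \<le> (norm (v :: complex ^ 'n::finite))\<^sup>2 + (norm w)\<^sup>2"
proof -
  have "cmod (cnj (v $ i) * w $ i) \<le> (cmod (v $ i))\<^sup>2 + (cmod (w $ i))\<^sup>2" for i
  proof -
    have "0 \<le> cmod (v $ i) * cmod (w $ i)" by simp
    then have "cmod (v $ i) * cmod (w $ i) \<le> (cmod (v $ i))\<^sup>2 + (cmod (w $ i))\<^sup>2"
      using sum_squares_bound[of "cmod (v $ i)" "cmod (w $ i)"] by linarith
    then show ?thesis by (simp add: norm_mult)
  qed
  then show ?thesis
    unfolding norm_vec_square sum.distrib[symmetric] by (intro sum_norm_le)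
qed

text \<open>Covers the ground state with its extrema, the constant 1 and the reciprocal of the
  ground state; the bounds are parameters since each use has its own.\<close>

locale weight =
  fixes u :: "real ^ 'n::finite \<Rightarrow> real" and c1 c2 :: real
  assumes cont: "continuous_on UNIV u" and c1: "0 < c1" and bounds: "\<And>x. c1 \<le> u x" "\<And>x. u x \<le> c2"
begin

lemma pos: "0 < u x" "u x \<noteq> 0"
  using bounds(1)[of x] c1 by auto

lemma measurable_u [measurable]: "u \<in> borel_measurable lebesgue"
  by (rule continuous_on_UNIV_lebesgue_measurable[OF cont])

lemma u_square_le: "(u x)\<^sup>2 \<le> c2\<^sup>2"
  using bounds[of x] c1 by (auto intro!: power_mono)

lemma square_integrable_mult:
  assumes "square_integrable f"
  shows "square_integrable (\<lambda>x. complex_of_real (u x) * f x)"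
  unfolding square_integrable_def
proof
  have f [measurable]: "f \<in> borel_measurable lebesgue" and int: "integrable lebesgue (\<lambda>x. (cmod (f x))\<^sup>2)"
    using assms by (auto simp: square_integrable_def)
  show "(\<lambda>x. complex_of_real (u x) * f x) \<in> borel_measurable lebesgue" by measurable
  show "integrable lebesgue (\<lambda>x. (cmod (complex_of_real (u x) * f x))\<^sup>2)"
  proof (rule Bochner_Integration.integrable_bound)
    show "integrable lebesgue (\<lambda>x. c2\<^sup>2 * (cmod (f x))\<^sup>2)" using int by auto
    show "AE x in lebesgue. norm ((cmod (complex_of_real (u x) * f x))\<^sup>2) \<le> norm (c2\<^sup>2 * (cmod (f x))\<^sup>2)"
      using u_square_le by (auto simp: norm_mult power_mult_distrib intro!: mult_right_mono)
  qed measurable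
qed

abbreviation grad :: "'n L2 \<Rightarrow> real ^ 'n \<Rightarrow> complex ^ 'n" where
  "grad F \<equiv> weak_gradient (gs_quotient u F)"

lemma quotient_measurable: "gs_quotient u F \<in> borel_measurable lebesgue"
  unfolding gs_quotient_def by measurable

lemma domainI:
  assumes "has_weak_gradient g G" "AE x in lebesgue. g x = gs_quotient u F x"
    and "integrable lebesgue (\<lambda>x. (norm (G x))\<^sup>2 * (u x)\<^sup>2)"
  shows "F \<in> gs_domain u" and "AE x in lebesgue. grad F x = G x"
proof -
  have "G \<in> borel_measurable lebesgue"
    using assms(1) locally_integrable_measurable by (auto simp: has_weak_gradient_def)
  then have *: "has_weak_gradient (gs_quotient u F) G"
    using has_weak_gradient_cong_AE[OF assms(1,2) _ quotient_measurable] by simp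
  then show "F \<in> gs_domain u" using assms(3) by (auto simp: gs_domain_def)
  show "AE x in lebesgue. grad F x = G x" by (rule weak_gradient_eq(2)[OF *])
qed

lemma domainD:
  assumes "F \<in> gs_domain u"
  shows "has_weak_gradient (gs_quotient u F) (grad F)"
    and "integrable lebesgue (\<lambda>x. (norm (grad F x))\<^sup>2 * (u x)\<^sup>2)"
    and "grad F \<in> borel_measurable lebesgue" "(\<lambda>x. grad F x $ i) \<in> borel_measurable lebesgue"
proof -
  obtain G where G: "has_weak_gradient (gs_quotient u F) G"
    "integrable lebesgue (\<lambda>x. (norm (G x))\<^sup>2 * (u x)\<^sup>2)"
    using assms by (auto simp: gs_domain_def)
  show *: "has_weak_gradient (gs_quotient u F) (grad F)" by (rule weak_gradient_eq(1)[OF G(1)])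
  then have l: "locally_integrable (grad F)" by (simp add: has_weak_gradient_def)
  then show m[measurable]: "grad F \<in> borel_measurable lebesgue" by (rule locally_integrable_measurable)
  show "(\<lambda>x. grad F x $ i) \<in> borel_measurable lebesgue"
    by (rule locally_integrable_measurable[OF locally_integrable_linear[OF bounded_linear_vec_nth l]])
  show "integrable lebesgue (\<lambda>x. (norm (grad F x))\<^sup>2 * (u x)\<^sup>2)"
    by (rule integrable_cong_AE_imp[OF G(2)]) (use weak_gradient_eq(2)[OF G(1)] in auto)
qed

lemma domain_add:
  assumes "F \<in> gs_domain u" "F' \<in> gs_domain u"
  shows "F + F' \<in> gs_domain u" and "AE x in lebesgue. grad (F + F') x = grad F x + grad F' x"
proof -
  have w: "has_weak_gradient (\<lambda>x. gs_quotient u F x + gs_quotient u F' x) (\<lambda>x. grad F x + grad F' x)"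
    by (intro has_weak_gradient_add domainD assms)
  have ae: "AE x in lebesgue. gs_quotient u F x + gs_quotient u F' x = gs_quotient u (F + F') x"
    using rep_add_L2[of F F'] by eventually_elim (simp add: gs_quotient_def add_divide_distrib)
  have int: "integrable lebesgue (\<lambda>x. (norm (grad F x + grad F' x))\<^sup>2 * (u x)\<^sup>2)"
  proof (rule Bochner_Integration.integrable_bound)
    show "integrable lebesgue (\<lambda>x. 2 * ((norm (grad F x))\<^sup>2 * (u x)\<^sup>2) + 2 * ((norm (grad F' x))\<^sup>2 * (u x)\<^sup>2))"
      using domainD(2)[OF assms(1)] domainD(2)[OF assms(2)] by auto
    have [measurable]: "grad F \<in> borel_measurable lebesgue" "grad F' \<in> borel_measurable lebesgue"
      by (intro domainD assms)+
    show "(\<lambda>x. (norm (grad F x + grad F' x))\<^sup>2 * (u x)\<^sup>2) \<in> borel_measurable lebesgue" by measurable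
    have "(norm (a + b))\<^sup>2 \<le> 2 * (norm a)\<^sup>2 + 2 * (norm b)\<^sup>2" for a b :: "complex ^ 'n"
    proof -
      have "(norm (a + b))\<^sup>2 \<le> (norm a + norm b)\<^sup>2" by (intro power_mono norm_triangle_ineq) auto
      also have "\<dots> \<le> 2 * (norm a)\<^sup>2 + 2 * (norm b)\<^sup>2"
        using sum_squares_bound[of "norm a" "norm b"] by (simp add: power2_sum)
      finally show ?thesis .
    qed
    from mult_right_mono[OF this zero_le_power2]
    show "AE x in lebesgue. norm ((norm (grad F x + grad F' x))\<^sup>2 * (u x)\<^sup>2)
      \<le> norm (2 * ((norm (grad F x))\<^sup>2 * (u x)\<^sup>2) + 2 * ((norm (grad F' x))\<^sup>2 * (u x)\<^sup>2))"
      by (simp add: distrib_right mult.assoc)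
  qed
  show "F + F' \<in> gs_domain u" "AE x in lebesgue. grad (F + F') x = grad F x + grad F' x"
    by (rule domainI[OF w ae int])+
qed

lemma domain_scale:
  assumes "F \<in> gs_domain u"
  shows "c *\<^sub>C F \<in> gs_domain u" and "AE x in lebesgue. grad (c *\<^sub>C F) x = c *s grad F x"
proof -
  have w: "has_weak_gradient (\<lambda>x. c * gs_quotient u F x) (\<lambda>x. c *s grad F x)"
    by (intro has_weak_gradient_scale domainD assms)
  have ae: "AE x in lebesgue. c * gs_quotient u F x = gs_quotient u (c *\<^sub>C F) x"
    using rep_scaleC_L2[of c F] by eventually_elim (simp add: gs_quotient_def)
  have int: "integrable lebesgue (\<lambda>x. (norm (c *s grad F x))\<^sup>2 * (u x)\<^sup>2)"
    using domainD(2)[OF assms] by (simp add: norm_vector_smult power_mult_distrib mult.assoc)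
  show "c *\<^sub>C F \<in> gs_domain u" "AE x in lebesgue. grad (c *\<^sub>C F) x = c *s grad F x"
    by (rule domainI[OF w ae int])+
qed

text \<open>Dividing \<phi> u by u returns \<phi>, whose weak gradient is the classical one, even
  though u itself need not be differentiable.\<close>

lemma domain_test_function:
  assumes \<phi>: "test_function \<phi>"
  shows "square_integrable (\<lambda>x. complex_of_real (\<phi> x * u x))"
    and "abs_L2 (\<lambda>x. complex_of_real (\<phi> x * u x)) \<in> gs_domain u"
proof -
  have [measurable]: "\<phi> \<in> borel_measurable lebesgue"
    by (rule continuous_on_UNIV_lebesgue_measurable[OF test_function_continuous[OF \<phi>]])
  have "integrable lebesgue (\<lambda>x. \<phi> x *\<^sub>R (\<phi> x * (u x)\<^sup>2))"
    by (intro test_function_integrable(1)[OF \<phi>] locally_integrable_continuous continuous_intros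
        test_function_continuous \<phi> cont)
  then show sq: "square_integrable (\<lambda>x. complex_of_real (\<phi> x * u x))"
    unfolding square_integrable_def
    by (simp add: norm_mult power_mult_distrib power2_eq_square mult_ac abs_mult_self_eq)
  let ?G = "\<lambda>x. \<chi> i. complex_of_real (partial i \<phi> x)"
  show "abs_L2 (\<lambda>x. complex_of_real (\<phi> x * u x)) \<in> gs_domain u"
  proof (rule domainI(1)[OF has_weak_gradient_test_function[OF \<phi>]])
    show "AE x in lebesgue. complex_of_real (\<phi> x) = gs_quotient u (abs_L2 (\<lambda>x. complex_of_real (\<phi> x * u x))) x"
      using rep_abs_L2[OF sq] by eventually_elim (simp add: gs_quotient_def pos)
    have "integrable lebesgue (\<lambda>x. partial i \<phi> x *\<^sub>R (partial i \<phi> x * (u x)\<^sup>2))" for i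
      by (intro test_function_integrable(2)[OF \<phi>] locally_integrable_continuous continuous_intros
          test_function_partial_continuous \<phi> cont)
    then have "integrable lebesgue (\<lambda>x. \<Sum>i\<in>UNIV. partial i \<phi> x *\<^sub>R (partial i \<phi> x * (u x)\<^sup>2))"
      by (intro Bochner_Integration.integrable_sum)
    moreover have "(norm (?G x))\<^sup>2 * (u x)\<^sup>2 = (\<Sum>i\<in>UNIV. partial i \<phi> x *\<^sub>R (partial i \<phi> x * (u x)\<^sup>2))" for x
      unfolding norm_vec_square sum_distrib_right by (intro sum.cong) (simp_all add: power2_eq_square)
    ultimately show "integrable lebesgue (\<lambda>x. (norm (?G x))\<^sup>2 * (u x)\<^sup>2)" by simp
  qed
qed

lemma csubspace: "complex_vector.subspace (gs_domain u)"
proof -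
  have "0 \<in> gs_domain u"
    using domain_scale(1)[OF domain_test_function(2)[OF test_function_box_bump], of 0] by simp
  then show ?thesis
    unfolding complex_vector.subspace_def using domain_add(1) domain_scale(1) by blast
qed

text \<open>Orthogonality to all \<phi> u says that u F integrates to 0 against every bump, so u F =
  0 almost everywhere; then u > 0 is divided out.\<close>

lemma dense:
  fixes F :: "'n L2"
  assumes F: "\<And>k. k \<in> gs_domain u \<Longrightarrow> cinner k F = 0"
  shows "F = 0"
proof -
  have "AE x in lebesgue. complex_of_real (u x) * rep_L2 F x = 0"
  proof (rule AE_eq_0_of_box_bump_integrals)
    show "locally_integrable (\<lambda>x. complex_of_real (u x) * rep_L2 F x)"
      by (rule square_integrable_imp_locally_integrable[OF square_integrable_mult[OF rep_L2]])
    fix a b :: "real ^ 'n" and m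
    let ?\<phi> = "box_bump a b m"
    have [measurable]: "?\<phi> \<in> borel_measurable lebesgue"
      by (rule continuous_on_UNIV_lebesgue_measurable[OF test_function_continuous[OF test_function_box_bump]])
    let ?K = "abs_L2 (\<lambda>x. complex_of_real (?\<phi> x * u x))"
    note K = domain_test_function[OF test_function_box_bump, of a b m]
    have "(\<integral>x. ?\<phi> x *\<^sub>R (complex_of_real (u x) * rep_L2 F x) \<partial>lebesgue) = cinner ?K F"
      unfolding cinner_L2_eq
    proof (rule integral_cong_AE)
      show "AE x in lebesgue. ?\<phi> x *\<^sub>R (complex_of_real (u x) * rep_L2 F x) = cnj (rep_L2 ?K x) * rep_L2 F x"
        using rep_abs_L2[OF K(1)] by eventually_elim (simp add: scaleR_conv_of_real)
      show "(\<lambda>x. cnj (rep_L2 ?K x) * rep_L2 F x) \<in> borel_measurable lebesgue"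
        by (rule borel_measurable_integrable[OF square_integrable_prod[OF rep_L2 rep_L2]])
    qed measurable
    then show "(\<integral>x. ?\<phi> x *\<^sub>R (complex_of_real (u x) * rep_L2 F x) \<partial>lebesgue) = 0"
      using F[OF K(2)] by simp
  qed
  then have "AE x in lebesgue. rep_L2 F x = 0" by eventually_elim (simp add: pos)
  moreover have "AE x in lebesgue. rep_L2 (0 *\<^sub>C F) x = 0" using rep_scaleC_L2[of 0 F] by simp
  ultimately have "AE x in lebesgue. rep_L2 F x = rep_L2 (0 *\<^sub>C F) x" by eventually_elim simp
  then show ?thesis using L2_eqI[of F "0 *\<^sub>C F"] by simp
qed

lemma gs_integrable:
  assumes "F \<in> gs_domain u" "F' \<in> gs_domain u"
  shows "integrable lebesgue (\<lambda>x. (\<Sum>i\<in>UNIV. cnj (grad F x $ i) * grad F' x $ i) * complex_of_real ((u x)\<^sup>2))"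
proof (rule Bochner_Integration.integrable_bound)
  show "integrable lebesgue (\<lambda>x. (norm (grad F x))\<^sup>2 * (u x)\<^sup>2 + (norm (grad F' x))\<^sup>2 * (u x)\<^sup>2)"
    by (intro Bochner_Integration.integrable_add domainD assms)
  have [measurable]: "(\<lambda>x. grad F x $ i) \<in> borel_measurable lebesgue"
    "(\<lambda>x. grad F' x $ i) \<in> borel_measurable lebesgue" for i by (intro domainD assms)+
  have [measurable]: "(\<lambda>x. cnj (grad F x $ i)) \<in> borel_measurable lebesgue" for i
    by (rule borel_measurable_continuous_on[OF continuous_on_cnj[OF continuous_on_id]]) measurable
  show "(\<lambda>x. (\<Sum>i\<in>UNIV. cnj (grad F x $ i) * grad F' x $ i) * complex_of_real ((u x)\<^sup>2)) \<in> borel_measurable lebesgue"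
    by measurable
  show "AE x in lebesgue. norm ((\<Sum>i\<in>UNIV. cnj (grad F x $ i) * grad F' x $ i) * complex_of_real ((u x)\<^sup>2))
      \<le> norm ((norm (grad F x))\<^sup>2 * (u x)\<^sup>2 + (norm (grad F' x))\<^sup>2 * (u x)\<^sup>2)"
    using mult_right_mono[OF cmod_sum_cnj_mult_le zero_le_power2]
    by (intro AE_I2) (simp add: norm_mult distrib_right norm_power del: of_real_power)
qed

lemma gs_form_add:
  assumes "F \<in> gs_domain u" "A \<in> gs_domain u" "B \<in> gs_domain u"
  shows "gs_form u F (A + B) = gs_form u F A + gs_form u F B"
proof -
  have "gs_form u F (A + B) = (\<integral>x. (\<Sum>i\<in>UNIV. cnj (grad F x $ i) * grad A x $ i) * complex_of_real ((u x)\<^sup>2) +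
      (\<Sum>i\<in>UNIV. cnj (grad F x $ i) * grad B x $ i) * complex_of_real ((u x)\<^sup>2) \<partial>lebesgue)"
    unfolding gs_form_def
    by (rule integral_cong_AE)
       (use domain_add(2)[OF assms(2,3)] gs_integrable[OF assms(1) domain_add(1)[OF assms(2,3)]]
          gs_integrable[OF assms(1,2)] gs_integrable[OF assms(1,3)] in
        \<open>auto simp: distrib_left distrib_right sum.distrib intro!: borel_measurable_add\<close>)
  then show ?thesis
    unfolding gs_form_def using gs_integrable[OF assms(1,2)] gs_integrable[OF assms(1,3)] by simp
qed

lemma gs_form_scale:
  assumes "F \<in> gs_domain u" "A \<in> gs_domain u"
  shows "gs_form u F (c *\<^sub>C A) = c * gs_form u F A"
proof -
  have "gs_form u F (c *\<^sub>C A) = (\<integral>x. c * ((\<Sum>i\<in>UNIV. cnj (grad F x $ i) * grad A x $ i) *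
      complex_of_real ((u x)\<^sup>2)) \<partial>lebesgue)"
    unfolding gs_form_def
  proof (rule integral_cong_AE)
    show "AE x in lebesgue. (\<Sum>i\<in>UNIV. cnj (grad F x $ i) * grad (c *\<^sub>C A) x $ i) * complex_of_real ((u x)\<^sup>2)
      = c * ((\<Sum>i\<in>UNIV. cnj (grad F x $ i) * grad A x $ i) * complex_of_real ((u x)\<^sup>2))"
      using domain_scale(2)[OF assms(2), of c]
    proof eventually_elim
      case (elim x)
      have "(\<Sum>i\<in>UNIV. cnj (grad F x $ i) * grad (c *\<^sub>C A) x $ i)
          = c * (\<Sum>i\<in>UNIV. cnj (grad F x $ i) * grad A x $ i)"
        unfolding elim sum_distrib_left by (intro sum.cong) simp_all
      then show ?case by simp
    qed
  qed (use gs_integrable[OF assms(1) domain_scale(1)[OF assms(2)]] gs_integrable[OF assms] in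
      \<open>auto intro: borel_measurable_times\<close>)
  then show ?thesis unfolding gs_form_def by simp
qed

lemma gs_form_hermitian: "gs_form u F A = cnj (gs_form u A F)"
  unfolding gs_form_def Bochner_Integration.integral_cnj[symmetric] by (simp add: mult.commute)

lemma gs_form_diag:
  assumes "F \<in> gs_domain u"
  shows "Re (gs_form u F F) = (\<integral>x. (norm (grad F x))\<^sup>2 * (u x)\<^sup>2 \<partial>lebesgue)"
  unfolding gs_form_def sum_cnj_mult_self of_real_mult[symmetric]
  by (simp only: integral_complex_of_real Re_complex_of_real)

end

text \<open>Measurability of V makes the mixed products of V with two vectors measurable; their
  integrability then follows from the diagonal one in \<open>form_admissible\<close>.\<close>

locale admissible = weight u c1 c2
  for u :: "real ^ 'n::finite \<Rightarrow> real" and c1 c2 +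
  fixes V :: "real ^ 'n \<Rightarrow> real"
  assumes V: "V \<in> borel_measurable lebesgue" and admissible: "form_admissible u V"
begin

lemma V_integrable: "F \<in> gs_domain u \<Longrightarrow> integrable lebesgue (\<lambda>x. V x * (cmod (rep_L2 F x))\<^sup>2)"
  using admissible by (simp add: form_admissible_def)

lemma potential_integrable:
  assumes "F \<in> gs_domain u" "A \<in> gs_domain u"
  shows "integrable lebesgue (\<lambda>x. complex_of_real (V x) * (cnj (rep_L2 F x) * rep_L2 A x))"
proof (rule Bochner_Integration.integrable_bound)
  show "integrable lebesgue (\<lambda>x. \<bar>V x * (cmod (rep_L2 F x))\<^sup>2\<bar> + \<bar>V x * (cmod (rep_L2 A x))\<^sup>2\<bar>)"
    by (intro Bochner_Integration.integrable_add integrable_abs V_integrable assms)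
  have [measurable]: "(\<lambda>x. cnj (rep_L2 F x) * rep_L2 A x) \<in> borel_measurable lebesgue"
    by (rule borel_measurable_integrable[OF square_integrable_prod[OF rep_L2 rep_L2]])
  note V[measurable]
  show "(\<lambda>x. complex_of_real (V x) * (cnj (rep_L2 F x) * rep_L2 A x)) \<in> borel_measurable lebesgue"
    by measurable
  have "a * b \<le> a\<^sup>2 + b\<^sup>2" if "0 \<le> a" "0 \<le> b" for a b :: real
    using sum_squares_bound[of a b] mult_nonneg_nonneg[OF that] by linarith
  from mult_left_mono[OF this abs_ge_zero]
  show "AE x in lebesgue. norm (complex_of_real (V x) * (cnj (rep_L2 F x) * rep_L2 A x))
      \<le> norm (\<bar>V x * (cmod (rep_L2 F x))\<^sup>2\<bar> + \<bar>V x * (cmod (rep_L2 A x))\<^sup>2\<bar>)"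
    by (intro AE_I2) (simp add: norm_mult abs_mult distrib_left)
qed

lemma potential_form_add:
  assumes "F \<in> gs_domain u" "A \<in> gs_domain u" "B \<in> gs_domain u"
  shows "potential_form V F (A + B) = potential_form V F A + potential_form V F B"
proof -
  note int = potential_integrable[OF assms(1,2)] potential_integrable[OF assms(1,3)]
  have "potential_form V F (A + B) = (\<integral>x. complex_of_real (V x) * (cnj (rep_L2 F x) * rep_L2 A x)
      + complex_of_real (V x) * (cnj (rep_L2 F x) * rep_L2 B x) \<partial>lebesgue)"
    unfolding potential_form_def
    by (rule integral_cong_AE)
       (use rep_add_L2[of A B] int potential_integrable[OF assms(1) domain_add(1)[OF assms(2,3)]] in
        \<open>auto simp: distrib_left intro!: borel_measurable_add\<close>)
  then show ?thesis unfolding potential_form_def using int by simp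
qed

lemma potential_form_scale:
  assumes "F \<in> gs_domain u" "A \<in> gs_domain u"
  shows "potential_form V F (c *\<^sub>C A) = c * potential_form V F A"
proof -
  have "potential_form V F (c *\<^sub>C A)
      = (\<integral>x. c * (complex_of_real (V x) * (cnj (rep_L2 F x) * rep_L2 A x)) \<partial>lebesgue)"
    unfolding potential_form_def
    by (rule integral_cong_AE)
       (use rep_scaleC_L2[of c A] potential_integrable[OF assms]
          potential_integrable[OF assms(1) domain_scale(1)[OF assms(2)]] in
        \<open>auto intro: borel_measurable_times\<close>)
  then show ?thesis unfolding potential_form_def by simp
qed

lemma potential_form_hermitian: "potential_form V F A = cnj (potential_form V A F)"
  unfolding potential_form_def Bochner_Integration.integral_cnj[symmetric] by (simp add: mult.commute)

lemma potential_form_diag: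
  "Re (potential_form V F F) = (\<integral>x. V x * (cmod (rep_L2 F x))\<^sup>2 \<partial>lebesgue)"
proof -
  have "complex_of_real (V x) * (cnj (rep_L2 F x) * rep_L2 F x) = complex_of_real (V x * (cmod (rep_L2 F x))\<^sup>2)" for x
    unfolding of_real_mult complex_norm_square by (simp only: mult.commute)
  then show ?thesis
    unfolding potential_form_def by (simp only: integral_complex_of_real Re_complex_of_real)
qed

lemma schroedinger_form_diag:
  "F \<in> gs_domain u \<Longrightarrow> Re (schroedinger_form u V F F)
    = (\<integral>x. (norm (grad F x))\<^sup>2 * (u x)\<^sup>2 \<partial>lebesgue) + (\<integral>x. V x * (cmod (rep_L2 F x))\<^sup>2 \<partial>lebesgue)"
  by (simp add: schroedinger_form_def gs_form_diag potential_form_diag)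

lemma closed_complex_form: "closed_complex_form (gs_domain u) (schroedinger_form u V)"
proof
  show "x = 0" if "\<And>k. k \<in> gs_domain u \<Longrightarrow> cinner k x = 0" for x by (rule dense[OF that])
  show "schroedinger_form u V x y = cnj (schroedinger_form u V y x)" for x y
    unfolding schroedinger_form_def complex_cnj_add
    by (rule arg_cong2[where f = "(+)", OF gs_form_hermitian potential_form_hermitian])
qed (use admissible in \<open>simp_all add: csubspace form_admissible_def schroedinger_form_def gs_form_add
    gs_form_scale potential_form_add potential_form_scale algebra_simps\<close>)

end

section \<open>Change of the weight\<close>

text \<open>Sends g u to g (u w), so that it changes the weight from u to u w while keeping the
  quotient g.\<close>

definition mult_L2 :: "(real ^ 'n::finite \<Rightarrow> real) \<Rightarrow> 'n L2 \<Rightarrow> 'n L2" where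
  "mult_L2 w F = abs_L2 (\<lambda>x. complex_of_real (w x) * rep_L2 F x)"

context weight
begin

lemma rep_mult_L2: "AE x in lebesgue. rep_L2 (mult_L2 u F) x = complex_of_real (u x) * rep_L2 F x"
  unfolding mult_L2_def by (rule rep_abs_L2[OF square_integrable_mult[OF rep_L2]])

lemma linear_mult_L2: "Vector_Spaces.linear scaleC scaleC (mult_L2 u)"
proof
  show "mult_L2 u (F + G) = mult_L2 u F + mult_L2 u G" for F G
    by (rule L2_eqI)
       (use rep_mult_L2[of "F + G"] rep_mult_L2[of F] rep_mult_L2[of G] rep_add_L2[of F G]
          rep_add_L2[of "mult_L2 u F" "mult_L2 u G"] in \<open>eventually_elim, simp add: distrib_left\<close>)
  show "mult_L2 u (c *\<^sub>C F) = c *\<^sub>C mult_L2 u F" for c F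
    by (rule L2_eqI)
       (use rep_mult_L2[of "c *\<^sub>C F"] rep_mult_L2[of F] rep_scaleC_L2[of c F]
          rep_scaleC_L2[of c "mult_L2 u F"] in \<open>eventually_elim, simp\<close>)
qed

lemma inj_mult_L2: "inj (mult_L2 u)"
proof (rule injI)
  fix F G assume eq: "mult_L2 u F = mult_L2 u G"
  show "F = G"
    by (rule L2_eqI)
       (use rep_mult_L2[of F] rep_mult_L2[of G] in \<open>eventually_elim, simp add: eq pos\<close>)
qed

end

text \<open>The quotients before and after agree almost everywhere, hence so do the gradients;
  boundedness of w keeps the weighted gradient square integrable.\<close>

lemma mult_L2_domain:
  fixes u w :: "real ^ 'n::finite \<Rightarrow> real"
  assumes u: "weight u a b" and w: "weight w c d" and uw: "weight (\<lambda>x. u x * w x) e f"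
    and F: "F \<in> gs_domain u"
  shows "mult_L2 w F \<in> gs_domain (\<lambda>x. u x * w x)"
    and "AE x in lebesgue. weak_gradient (gs_quotient (\<lambda>x. u x * w x) (mult_L2 w F)) x
      = weak_gradient (gs_quotient u F) x"
proof -
  interpret u: weight u a b by fact
  interpret w: weight w c d by fact
  interpret uw: weight "\<lambda>x. u x * w x" e f by fact
  have ae: "AE x in lebesgue. gs_quotient u F x = gs_quotient (\<lambda>x. u x * w x) (mult_L2 w F) x"
    using w.rep_mult_L2[of F] by eventually_elim (simp add: gs_quotient_def w.pos)
  have int: "integrable lebesgue (\<lambda>x. (norm (u.grad F x))\<^sup>2 * (u x * w x)\<^sup>2)"
  proof (rule Bochner_Integration.integrable_bound)
    show "integrable lebesgue (\<lambda>x. d\<^sup>2 * ((norm (u.grad F x))\<^sup>2 * (u x)\<^sup>2))"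
      using u.domainD(2)[OF F] by auto
    note [measurable] = u.domainD(3)[OF F]
    show "(\<lambda>x. (norm (u.grad F x))\<^sup>2 * (u x * w x)\<^sup>2) \<in> borel_measurable lebesgue" by measurable
    show "AE x in lebesgue. norm ((norm (u.grad F x))\<^sup>2 * (u x * w x)\<^sup>2)
        \<le> norm (d\<^sup>2 * ((norm (u.grad F x))\<^sup>2 * (u x)\<^sup>2))"
      using mult_right_mono[OF w.u_square_le, of "(norm (u.grad F _))\<^sup>2 * (u _)\<^sup>2"]
      by (intro AE_I2) (simp add: power_mult_distrib mult_ac)
  qed
  show "mult_L2 w F \<in> gs_domain (\<lambda>x. u x * w x)"
    "AE x in lebesgue. weak_gradient (gs_quotient (\<lambda>x. u x * w x) (mult_L2 w F)) x = u.grad F x"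
    by (rule uw.domainI[OF u.domainD(1)[OF F] ae int])+
qed

text \<open>Multiplication by \<open>w\<close> changes the gradient, potential and mass terms of the form inequality
  by the weight \<open>w\<^sup>2\<close>; for \<open>t < 0\<close> the factor \<open>k\<close> moves all three in the favourable direction.\<close>

lemma schroedinger_moment_le:
  fixes u w V W :: "real ^ 'n::finite \<Rightarrow> real"
  assumes u: "weight u a b" and w: "weight w c d" and uw: "weight (\<lambda>x. u x * w x) e f"
    and V: "V \<in> borel_measurable lebesgue" "form_admissible u V"
    and W: "W \<in> borel_measurable lebesgue" "form_admissible (\<lambda>x. u x * w x) W"
    and k: "\<And>x. k * (w x)\<^sup>2 \<le> 1" "\<And>x. k * (W x * (w x)\<^sup>2) \<le> V x" "0 < k"
    and \<gamma>: "0 < \<gamma>"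
  shows "moment \<gamma> (schroedinger u V) \<le> moment \<gamma> (schroedinger (\<lambda>x. u x * w x) W)"
proof -
  interpret u: admissible u a b V using u V by (simp add: admissible_def admissible_axioms_def)
  interpret uw: admissible "\<lambda>x. u x * w x" e f W
    using uw W by (simp add: admissible_def admissible_axioms_def)
  interpret w: weight w c d by fact
  show ?thesis
    unfolding schroedinger_def
  proof (rule moment_le[OF uw.closed_complex_form u.closed_complex_form w.linear_mult_L2
        w.inj_mult_L2 mult_L2_domain(1)[OF u w uw] _ \<gamma>])
    fix t F
    assume t: "t < (0::real)" and F: "F \<in> gs_domain u"
      and le: "Re (schroedinger_form u V F F) \<le> t * (norm F)\<^sup>2"
    let ?F' = "mult_L2 w F"
    note F' = mult_L2_domain[OF u w uw F]
    note [measurable] = u.domainD(3)[OF F] uw.domainD(3)[OF F'(1)] V(1) W(1)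
    have "k * (\<integral>x. (norm (uw.grad ?F' x))\<^sup>2 * (u x * w x)\<^sup>2 \<partial>lebesgue)
        \<le> (\<integral>x. (norm (u.grad F x))\<^sup>2 * (u x)\<^sup>2 \<partial>lebesgue)"
      unfolding integral_mult_right_zero[symmetric]
    proof (rule integral_mono_AE)
      show "AE x in lebesgue. k * ((norm (uw.grad ?F' x))\<^sup>2 * (u x * w x)\<^sup>2) \<le> (norm (u.grad F x))\<^sup>2 * (u x)\<^sup>2"
        using F'(2)
      proof eventually_elim
        case (elim x)
        show ?case
          using mult_right_mono[OF k(1)[of x], of "(norm (u.grad F x))\<^sup>2 * (u x)\<^sup>2"] elim
          by (simp add: power_mult_distrib mult_ac)
      qed
    qed (use uw.domainD(2)[OF F'(1)] u.domainD(2)[OF F] in auto)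
    moreover have "k * (\<integral>x. W x * (cmod (rep_L2 ?F' x))\<^sup>2 \<partial>lebesgue) \<le> (\<integral>x. V x * (cmod (rep_L2 F x))\<^sup>2 \<partial>lebesgue)"
      unfolding integral_mult_right_zero[symmetric]
    proof (rule integral_mono_AE)
      show "AE x in lebesgue. k * (W x * (cmod (rep_L2 ?F' x))\<^sup>2) \<le> V x * (cmod (rep_L2 F x))\<^sup>2"
        using w.rep_mult_L2[of F]
      proof eventually_elim
        case (elim x)
        show ?case
          using mult_right_mono[OF k(2)[of x], of "(cmod (rep_L2 F x))\<^sup>2"] elim
          by (simp add: norm_mult power_mult_distrib mult_ac)
      qed
    qed (use uw.V_integrable[OF F'(1)] u.V_integrable[OF F] in auto)
    ultimately have "k * Re (schroedinger_form (\<lambda>x. u x * w x) W ?F' ?F') \<le> t * (norm F)\<^sup>2"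
      using le unfolding u.schroedinger_form_diag[OF F] uw.schroedinger_form_diag[OF F'(1)]
      by (simp add: distrib_left)
    also have "k * (norm ?F')\<^sup>2 \<le> (norm F)\<^sup>2"
      unfolding norm_L2_square integral_mult_right_zero[symmetric]
    proof (rule integral_mono_AE)
      show "AE x in lebesgue. k * (cmod (rep_L2 ?F' x))\<^sup>2 \<le> (cmod (rep_L2 F x))\<^sup>2"
        using w.rep_mult_L2[of F]
      proof eventually_elim
        case (elim x)
        show ?case
          using mult_right_mono[OF k(1)[of x], of "(cmod (rep_L2 F x))\<^sup>2"] elim
          by (simp add: norm_mult power_mult_distrib mult_ac)
      qed
    qed (use rep_L2_integrable in auto)
    \<comment> \<open>Multiplication by t < 0 reverses the inequality between the norms.\<close>
    then have "t * (norm F)\<^sup>2 \<le> t * (k * (norm ?F')\<^sup>2)"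
      using t by (simp add: mult_left_mono_neg)
    finally have "k * Re (schroedinger_form (\<lambda>x. u x * w x) W ?F' ?F') \<le> k * (t * (norm ?F')\<^sup>2)"
      by (simp add: mult_ac)
    then show "Re (schroedinger_form (\<lambda>x. u x * w x) W ?F' ?F') \<le> t * (norm ?F')\<^sup>2"
      using k(3) by simp
  qed
qed

theorem corollary1p2:
  fixes V0 V u0 :: "real ^ 'n::finite \<Rightarrow> real" and \<beta> \<gamma> :: real
  assumes "regular_ground_state V0 u0"
    and "inf_spec (schroedinger u0 (\<lambda>x. 0)) = 0"
    and "\<beta> = ground_state_ratio u0"
    and "V \<in> borel_measurable lebesgue" and "\<forall>x. V x \<le> 0"
    and "form_admissible u0 V"
    and "form_admissible (\<lambda>x. 1) (\<lambda>x. \<beta> * V x)"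
    and "form_admissible (\<lambda>x. 1) (\<lambda>x. inverse \<beta> * V x)"
    and "\<gamma> > 0"
  shows "moment \<gamma> (schroedinger (\<lambda>x. 1) (\<lambda>x. inverse \<beta> * V x)) \<le> moment \<gamma> (schroedinger u0 V) \<and>
         moment \<gamma> (schroedinger u0 V) \<le> moment \<gamma> (schroedinger (\<lambda>x. 1) (\<lambda>x. \<beta> * V x))"
proof -
  obtain a b where cont: "continuous_on UNIV u0" and a: "0 < a" and ab: "\<And>x. a \<le> u0 x" "\<And>x. u0 x \<le> b"
    using assms(1) by (auto simp: regular_ground_state_def)
  \<comment> \<open>a and b merely ensure that the extrema are finite and positive; \<beta> is
    formed from the extrema themselves.\<close>
  define c1 where "c1 = (INF x. u0 x)"
  define c2 where "c2 = (SUP x. u0 x)"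
  have "a \<le> c1" unfolding c1_def by (rule cINF_greatest) (auto simp: ab)
  then have c1: "0 < c1" using a by simp
  have le1: "c1 \<le> u0 x" for x
    unfolding c1_def by (rule cINF_lower) (auto intro: bdd_belowI2 ab)
  have le2: "u0 x \<le> c2" for x
    unfolding c2_def by (rule cSUP_upper) (auto intro: bdd_aboveI2 ab)
  have c2: "0 < c2" using c1 le1[of 0] le2[of 0] by linarith
  have \<beta>: "\<beta> = c2\<^sup>2 / c1\<^sup>2"
    using assms(3) by (simp add: ground_state_ratio_def c1_def c2_def power_divide)
  have pos: "0 < u0 x" for x using le1[of x] c1 by simp
  have sq: "c1\<^sup>2 \<le> (u0 x)\<^sup>2" "(u0 x)\<^sup>2 \<le> c2\<^sup>2" for x
    using le1[of x] le2[of x] c1 by (auto intro!: power_mono)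
  have w0: "weight u0 c1 c2" by unfold_locales (auto simp: cont c1 le1 le2)
  have w1: "weight (\<lambda>x::real^'n. 1) 1 1" by unfold_locales auto
  have wi: "weight (\<lambda>x. 1 / u0 x) (1 / c2) (1 / c1)"
  proof
    show "continuous_on UNIV (\<lambda>x. 1 / u0 x)"
      using pos by (intro continuous_intros cont) (auto simp: less_imp_neq[symmetric])
    show "1 / c2 \<le> 1 / u0 x" "1 / u0 x \<le> 1 / c1" for x
      using pos[of x] c1 le1[of x] le2[of x] by (auto intro!: divide_left_mono mult_pos_pos)
  qed (use c2 in simp)
  have one: "(\<lambda>x. u0 x * (1 / u0 x)) = (\<lambda>x. 1)" using pos by (auto simp: less_imp_neq[symmetric])
  have V0: "V x \<le> 0" for x using assms(5) by simp
  have mV: "(\<lambda>x. r * V x) \<in> borel_measurable lebesgue" for r using assms(4) by simp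
  \<comment> \<open>Here the weight 1 becomes u0. The constant k comes from k u0^2 \<le> 1, and u0^2
    \<ge> c1^2 with V \<le> 0 leaves the factor c1^2 / c2^2 = 1 / \<beta> on V.\<close>
  have "moment \<gamma> (schroedinger (\<lambda>x. 1) (\<lambda>x. inverse \<beta> * V x)) \<le> moment \<gamma> (schroedinger (\<lambda>x. 1 * u0 x) V)"
  proof (rule schroedinger_moment_le[OF w1 w0 _ mV assms(8) assms(4) _ _ _ _ assms(9), where k = "1 / c2\<^sup>2"])
    show "weight (\<lambda>x. 1 * u0 x) c1 c2" "form_admissible (\<lambda>x. 1 * u0 x) V" using w0 assms(6) by simp_all
    show "1 / c2\<^sup>2 * (u0 x)\<^sup>2 \<le> 1" for x using sq(2)[of x] c2 by (simp add: divide_simps)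
    show "1 / c2\<^sup>2 * (V x * (u0 x)\<^sup>2) \<le> inverse \<beta> * V x" for x
      using mult_left_mono_neg[OF sq(1)[of x] V0[of x]] c1 c2 by (simp add: \<beta> divide_simps mult_ac)
  qed (use c2 in simp)
  \<comment> \<open>Here u0 becomes 1 through division by u0. Now k / u0^2 \<le> 1 asks for k =
    c1^2, and k \<beta> = c2^2 \<ge> u0^2 with V \<le> 0 gives the bound on the potential.\<close>
  moreover have "moment \<gamma> (schroedinger u0 V) \<le> moment \<gamma> (schroedinger (\<lambda>x. u0 x * (1 / u0 x)) (\<lambda>x. \<beta> * V x))"
  proof (rule schroedinger_moment_le[OF w0 wi _ assms(4) assms(6) mV _ _ _ _ assms(9), where k = "c1\<^sup>2"])
    show "weight (\<lambda>x. u0 x * (1 / u0 x)) 1 1" "form_admissible (\<lambda>x. u0 x * (1 / u0 x)) (\<lambda>x. \<beta> * V x)"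
      unfolding one by (fact w1, fact assms(7))
    show "c1\<^sup>2 * (1 / u0 x)\<^sup>2 \<le> 1" for x using sq(1)[of x] pos[of x] by (simp add: divide_simps)
    show "c1\<^sup>2 * (\<beta> * V x * (1 / u0 x)\<^sup>2) \<le> V x" for x
      using mult_left_mono_neg[OF sq(2)[of x] V0[of x]] c1 pos[of x] by (simp add: \<beta> divide_simps mult_ac)
  qed (use c1 in simp)
  ultimately show ?thesis unfolding one by simp
qed

end
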